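(* Let $k\in\mathbb{N}$ and $\varepsilon>0$. For $n=2g+2$ large, $$\frac{1}{|\mathcal{H}_{2g+2}|}\sum_{D\in\mathcal{H}_{2g+2}}\big|\mathcal{L}(q^{-1/2},\chi_D)\big|^{k}\ll_{k,\varepsilon}g^{\frac12k(k+1)+\varepsilon}.$$
   Context: $\mathbb{F}_q$ is a fixed finite field of odd cardinality $q$ (implied constants may depend on $q$). $\mathcal{H}_n$ is the set of monic square-free polynomials of degree $n$ in $\mathbb{F}_q[t]$. For monic irreducible $P\in\mathbb{F}_q[t]$, $\left(\frac{f}{P}\right)$ is $0$ if $P\mid f$, $1$ if $P\nmid f$ and $f$ is a square mod $P$, and $-1$ otherwise. For $D$ monic square-free, $\chi_D(f)=\left(\frac{D}{f}\right)$ for monic $f$, extended multiplicatively in $f$ from the symbols $\left(\frac{D}{P}\right)$. The $L$-function is $$\mathcal{L}(u,\chi_D)=\sum_{f\ \mathrm{monic}}\chi_D(f)u^{\deg f}=\prod_{P}\big(1-\chi_D(P)u^{\deg P}\big)^{-1},\qquad |u|<1/q$$ (sum over all monic $f\in\mathbb{F}_q[t]$, including $f=1$; product over monic irreducibles). For $\deg D\ge1$ it is a polynomial in $u$ of degree at most $\deg D-1$, hence defined for all $u\in\mathbb{C}$. *)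

theory Defs
  imports
    "HOL-Analysis.Analysis"
    "HOL-Computational_Algebra.Squarefree"
    "HOL-Number_Theory.Cong"
    "HOL-Library.Landau_Symbols"
begin

text \<open>
  The field with \<open>q\<close> elements is a type \<open>'a::{finite,field}\<close> with \<open>q = CARD('a)\<close>; every finite
  field is isomorphic to such a type.
\<close>

definition monic_polys :: "'a::{finite,field} poly set" where
  "monic_polys = {f. lead_coeff f = 1}"

definition monic_squarefree :: "nat \<Rightarrow> 'a::{finite,field} poly set" where
  "monic_squarefree n = {D \<in> monic_polys. squarefree D \<and> degree D = n}"

text \<open>Intended for monic irreducible \<open>P\<close> only.\<close>

definition quadratic_symbol :: "'a::{finite,field} poly \<Rightarrow> 'a poly \<Rightarrow> int" where
  "quadratic_symbol f P =
     (if P dvd f then 0 else if \<exists>h. [h ^ 2 = f] (mod P) then 1 else -1)"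

text \<open>
  The library's \<open>multiplicity\<close> needs the class \<open>factorial_semiring\<close>, of which polynomials over
  a plain field type are not an instance. The set is finite for irreducible \<open>P\<close> and \<open>f \<noteq> 0\<close>.
\<close>

definition poly_multiplicity :: "'a::{finite,field} poly \<Rightarrow> 'a poly \<Rightarrow> nat" where
  "poly_multiplicity P f = Max {m. P ^ m dvd f}"

text \<open>
  Multiplicative extension of the quadratic symbol along the factorisation of a monic \<open>f\<close> into
  monic irreducibles; the product is empty for \<open>f = 1\<close>.
\<close>

definition quadratic_char :: "'a::{finite,field} poly \<Rightarrow> 'a poly \<Rightarrow> int" where
  "quadratic_char D f =
     (\<Prod>P | P \<in> monic_polys \<and> irreducible P \<and> P dvd f.
        quadratic_symbol D P ^ poly_multiplicity P f)"

text \<open>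
  For \<open>degree D \<ge> 1\<close> the series over all monic polynomials, absolutely convergent for
  \<open>norm u < 1 / q\<close>, is there equal to a polynomial in \<open>u\<close>. Such a polynomial is unique, because
  it is determined by its values on a disc, and it defines the \<open>L\<close>-function on the whole plane.
\<close>

definition L_poly :: "'a::{finite,field} poly \<Rightarrow> complex poly" where
  "L_poly D = (THE p. \<forall>u::complex. norm u < 1 / real CARD('a) \<longrightarrow>
     ((\<lambda>f. of_int (quadratic_char D f) * u ^ degree f) has_sum poly p u) monic_polys)"

definition L_fun :: "complex \<Rightarrow> 'a::{finite,field} poly \<Rightarrow> complex" where
  "L_fun u D = poly (L_poly D) u"

end

theory Submission
  imports
    Defs
    "HOL-Computational_Algebra.Polynomial_Factorial"
    "HOL-Computational_Algebra.Fundamental_Theorem_Algebra"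
    "HOL-Real_Asymp.Real_Asymp"
begin

text \<open>
  Soundararajan's method. Stepanov's method bounds the prime power sums of \<open>\<chi>\<^sub>D\<close>, which gives the
  Riemann hypothesis for \<open>L(u, \<chi>\<^sub>D)\<close>: its inverse roots satisfy \<open>\<bar>\<alpha>\<bar> \<le> \<surd>q\<close>. Majorising
  \<open>log \<bar>1 - z\<bar>\<close> on the unit disc by Fejer's kernel then yields, for every \<open>h \<le> n\<close>,
  \<open>log \<bar>L(q\<^sup>-\<^sup>1\<^sup>/\<^sup>2, \<chi>\<^sub>D)\<bar> \<le> n/h + \<Sum> w(P) \<chi>\<^sub>D(P) \<bar>P\<bar>\<^sup>-\<^sup>1\<^sup>/\<^sup>2 + (log n)/2 + O(1)\<close>, the sum being over \<open>deg P \<le> h\<close>.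
  When \<open>D\<close> ranges over all monic polynomials of degree \<open>n\<close>, symbols at primes of total degree at most
  \<open>n\<close> are exactly independent, so even moments of the prime sum are at most those of a sum of random
  signs; the latter has variance about \<open>log n\<close>, whence the factor \<open>n\<close> to the power \<open>k\<^sup>2/2\<close>. Primes of
  degree close to \<open>n\<close> have small variance and are discarded by a large deviation estimate.
\<close>

section \<open>Residues modulo monic irreducible polynomials\<close>

text \<open>The obstacle is that moments of a sum over primes of degree at most \<open>z\<close> are
  controlled only up to order \<open>n / z\<close>, so the full prime sum cannot be exponentiated.
  Hence three scales: \<open>h\<close> near \<open>n / (delta log n)\<close> makes the cost
  \<open>n / h\<close> a small multiple of \<open>log n\<close>; \<open>z\<close> near
  \<open>n / (log n)^2\<close> leaves moments of order \<open>(log n)^2\<close>, enough to replace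
  \<open>exp\<close> by a truncated \<open>cosh\<close> as long as the short sum is
  \<open>O(log n)\<close>; between \<open>z\<close> and \<open>h\<close> the variance is only of
  size \<open>log log n\<close>. Both size conditions fail on sets of density \<open>n^(-A)\<close>,
  which helps only against a moment bound of size \<open>n^A\<close>. So a crude bound for the
  \<open>2 k\<close>-th moment is proved beforehand and played off against the density by AM-GM.
  Averages run over all monic \<open>D\<close>, since these fill residue classes evenly; square-free
  ones are at least half of them, so nonnegative majorants may be summed over the larger set. The
  remaining \<open>k / 2\<close> in the exponent is due to squares of primes, where the character is
  never negative. Even degree of \<open>D\<close> cancels the sign in reciprocity, which makes
  \<open>chi_D\<close> periodic modulo \<open>D\<close>.\<close>

definition monic_irreducibles :: "'a::{finite,field} poly set" where
  "monic_irreducibles = {P \<in> monic_polys. irreducible P}"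

definition monic_of_degree :: "nat \<Rightarrow> 'a::{finite,field} poly set" where
  "monic_of_degree n = {f \<in> monic_polys. degree f = n}"

text \<open>For \<open>n = degree P\<close> this is the complete system of reduced residues modulo
  \<open>P\<close>. The condition on coefficients makes closure under addition immediate and admits
  0 for every \<open>n\<close>, including \<open>n = 0\<close>, where \<open>degree f < n\<close>
  would exclude it.\<close>

definition polys_below :: "nat \<Rightarrow> 'a::{finite,field} poly set" where
  "polys_below n = {f. \<forall>i\<ge>n. coeff f i = 0}"

lemma polys_below_0: "polys_below 0 = {0}"
  by (auto simp: polys_below_def poly_eq_iff)

lemma polys_below_Suc: "polys_below (Suc n) = (\<lambda>(c, f). pCons c f) ` (UNIV \<times> polys_below n)"
proof (intro equalityI subsetI)
  fix f :: "'a poly" assume "f \<in> polys_below (Suc n)"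
  moreover obtain c g where "f = pCons c g" by (cases f)
  ultimately show "f \<in> (\<lambda>(c, f). pCons c f) ` (UNIV \<times> polys_below n)"
    by (force simp: polys_below_def coeff_pCons split: nat.splits)
qed (auto simp: polys_below_def coeff_pCons split: nat.splits)

lemma finite_polys_below [simp, intro]: "finite (polys_below n)"
  by (induction n) (auto simp: polys_below_0 polys_below_Suc)

lemma card_polys_below: "card (polys_below n :: 'a::{finite,field} poly set) = CARD('a) ^ n"
proof (induction n)
  case (Suc n)
  have "inj_on (\<lambda>(c, f). pCons c f) (UNIV \<times> polys_below n :: ('a \<times> 'a poly) set)"
    by (auto simp: inj_on_def)
  thus ?case
    using Suc by (simp add: polys_below_Suc card_image card_cartesian_product)
qed (simp add: polys_below_0)

lemma polys_below_iff: "f \<in> polys_below n \<longleftrightarrow> f = 0 \<or> degree f < n"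
proof
  assume "f \<in> polys_below n"
  thus "f = 0 \<or> degree f < n"
    unfolding polys_below_def using leading_coeff_0_iff[of f] not_less by blast
qed (auto simp: polys_below_def coeff_eq_0)

lemma polys_below_add: "f \<in> polys_below n \<Longrightarrow> g \<in> polys_below n \<Longrightarrow> f + g \<in> polys_below n"
  and polys_below_diff: "f \<in> polys_below n \<Longrightarrow> g \<in> polys_below n \<Longrightarrow> f - g \<in> polys_below n"
  and polys_below_uminus: "f \<in> polys_below n \<Longrightarrow> - f \<in> polys_below n"
  and zero_in_polys_below [simp]: "0 \<in> polys_below n"
  by (auto simp: polys_below_def)

lemma polys_below_sum: "(\<And>x. x \<in> A \<Longrightarrow> f x \<in> polys_below n) \<Longrightarrow> sum f A \<in> polys_below n"
  by (induction A rule: infinite_finite_induct) (auto intro: polys_below_add)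

lemma polys_below_mono: "f \<in> polys_below n \<Longrightarrow> n \<le> m \<Longrightarrow> f \<in> polys_below m"
  by (auto simp: polys_below_def)

lemma mod_in_polys_below: "P \<noteq> 0 \<Longrightarrow> f mod P \<in> polys_below (degree P)"
  using degree_mod_less[of P f] by (auto simp: polys_below_iff)

lemma mod_polys_below: "f \<in> polys_below (degree P) \<Longrightarrow> f mod P = f"
  by (auto simp: polys_below_iff mod_poly_less)

lemma polys_below_cong_eq:
  assumes "f \<in> polys_below (degree P)" "g \<in> polys_below (degree P)" "[f = g] (mod P)"
  shows   "f = g"
  using assms by (simp add: cong_def mod_polys_below)

lemma monic_of_degree_conv_image:
  "monic_of_degree n = (\<lambda>f. f + monom 1 n) ` (polys_below n :: 'a::{finite,field} poly set)"
proof (intro equalityI subsetI)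
  fix f :: "'a poly" assume f: "f \<in> monic_of_degree n"
  have "f - monom 1 n \<in> polys_below n"
    using f by (auto simp: monic_of_degree_def monic_polys_def polys_below_def coeff_eq_0 le_less)
  thus "f \<in> (\<lambda>f. f + monom 1 n) ` polys_below n"
    by (intro image_eqI[of _ _ "f - monom 1 n"]) auto
next
  fix f :: "'a poly" assume "f \<in> (\<lambda>f. f + monom 1 n) ` polys_below n"
  then obtain g where g: "f = g + monom 1 n" "g \<in> polys_below n" by auto
  have "degree f = n"
  proof (rule order.antisym)
    show "degree f \<le> n" using g by (intro degree_le) (auto simp: polys_below_def)
    show "n \<le> degree f" using g by (intro le_degree) (auto simp: polys_below_def)
  qed
  thus "f \<in> monic_of_degree n"
    using g by (auto simp: monic_of_degree_def monic_polys_def polys_below_def)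
qed

lemma finite_monic_of_degree [simp, intro]: "finite (monic_of_degree n)"
  by (simp add: monic_of_degree_conv_image)

lemma card_monic_of_degree:
  "card (monic_of_degree n :: 'a::{finite,field} poly set) = CARD('a) ^ n"
  unfolding monic_of_degree_conv_image
  by (subst card_image) (auto simp: inj_on_def card_polys_below)

lemma monic_of_degree_0: "monic_of_degree 0 = {1}"
  by (simp add: monic_of_degree_conv_image polys_below_0 one_pCons monom_0)

lemma monic_polys_mult: "f \<in> monic_polys \<Longrightarrow> g \<in> monic_polys \<Longrightarrow> f * g \<in> monic_polys"
  by (auto simp: monic_polys_def lead_coeff_mult)

lemma monic_polys_power: "f \<in> monic_polys \<Longrightarrow> f ^ n \<in> monic_polys"
  by (auto simp: monic_polys_def lead_coeff_power)

lemma one_in_monic_polys [simp]: "1 \<in> monic_polys"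
  by (auto simp: monic_polys_def)

lemma monic_polys_prod: "(\<And>x. x \<in> A \<Longrightarrow> f x \<in> monic_polys) \<Longrightarrow> prod f A \<in> monic_polys"
  by (induction A rule: infinite_finite_induct) (auto intro: monic_polys_mult)

lemma monic_polys_nonzero: "f \<in> monic_polys \<Longrightarrow> f \<noteq> 0"
  by (auto simp: monic_polys_def)

lemma monic_polys_degree_mult:
  "f \<in> monic_polys \<Longrightarrow> g \<in> monic_polys \<Longrightarrow> degree (f * g) = degree f + degree g"
  by (simp add: degree_mult_eq monic_polys_nonzero)

lemma monic_polys_multD: "f * g \<in> monic_polys \<Longrightarrow> f \<in> monic_polys \<Longrightarrow> g \<in> monic_polys"
  by (auto simp: monic_polys_def lead_coeff_mult)

lemma monic_polys_dvd_antisym: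
  assumes "f \<in> monic_polys" "g \<in> monic_polys" "f dvd g" "degree g \<le> degree f"
  shows   "f = g"
proof -
  obtain h where h: "g = f * h" using assms by auto
  hence "h \<in> monic_polys" using assms monic_polys_multD by blast
  moreover from this have "degree h = 0"
    using h assms monic_polys_degree_mult[of f h] by simp
  ultimately have "h = 1" using monic_of_degree_0 by (auto simp: monic_of_degree_def)
  thus ?thesis using h by simp
qed

text \<open>Injectivity is uniqueness of quotient and remainder; surjectivity follows because both
  sides have \<open>q^n\<close> elements.\<close>

lemma bij_betw_div_mod_monic:
  fixes M :: "'a::{finite,field} poly"
  assumes M: "M \<in> monic_polys" "degree M \<le> n"
  shows   "bij_betw (\<lambda>(h, r). h * M + r)
             (monic_of_degree (n - degree M) \<times> polys_below (degree M)) (monic_of_degree n)"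
proof -
  have [simp]: "M \<noteq> 0" using M monic_polys_nonzero by blast
  have eq: "(h * M + r) div M = h" "(h * M + r) mod M = r" if "r \<in> polys_below (degree M)" for h r :: "'a poly"
    using that mod_polys_below[OF that] by (auto simp: polys_below_iff div_poly_less)
  have inj: "inj_on (\<lambda>(h, r). h * M + r)
             (monic_of_degree (n - degree M) \<times> polys_below (degree M))"
  proof (rule inj_onI, clarify)
    fix h r h' r' :: "'a poly"
    assume "r \<in> polys_below (degree M)" "r' \<in> polys_below (degree M)"
      and *: "h * M + r = h' * M + r'"
    with eq[of r h] eq[of r' h'] show "h = h' \<and> r = r'" by simp
  qed
  have "(\<lambda>(h, r). h * M + r) ` (monic_of_degree (n - degree M) \<times> polys_below (degree M))
          \<subseteq> monic_of_degree n"
  proof safe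
    fix h r :: "'a poly" assume h: "h \<in> monic_of_degree (n - degree M)" and r: "r \<in> polys_below (degree M)"
    have hM: "h * M \<in> monic_of_degree n"
      using h M by (auto simp: monic_of_degree_def monic_polys_mult monic_polys_degree_mult)
    then obtain s where "h * M = s + monom 1 n" "s \<in> polys_below n"
      by (auto simp: monic_of_degree_conv_image)
    thus "h * M + r \<in> monic_of_degree n"
      using r M by (auto simp: monic_of_degree_conv_image intro!: image_eqI[of _ _ "s + r"]
                      polys_below_add intro: polys_below_mono)
  qed
  moreover have "card ((\<lambda>(h, r). h * M + r) `
      (monic_of_degree (n - degree M) \<times> polys_below (degree M))) = card (monic_of_degree n :: 'a poly set)"
    using M by (subst card_image[OF inj])
      (simp add: card_cartesian_product card_monic_of_degree card_polys_below flip: power_add)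
  ultimately have "(\<lambda>(h, r). h * M + r) ` (monic_of_degree (n - degree M) \<times> polys_below (degree M))
                     = monic_of_degree n"
    by (intro card_subset_eq) auto
  thus ?thesis using inj by (simp add: bij_betw_def)
qed

text \<open>Quotient and remainder of the division by \<open>M\<close> vary independently, so all
  residue classes are hit equally often, with no error term. This is the source of the exact
  independence of the symbols.\<close>

lemma sum_monic_of_degree_mod:
  fixes g :: "'a::{finite,field} poly \<Rightarrow> 'b::comm_semiring_1"
  assumes M: "M \<in> monic_polys" "degree M \<le> n"
  shows   "(\<Sum>f\<in>monic_of_degree n. g (f mod M)) =
             of_nat (CARD('a) ^ (n - degree M)) * (\<Sum>r\<in>polys_below (degree M). g r)"
proof -
  have "(\<Sum>f\<in>monic_of_degree n. g (f mod M)) =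
        (\<Sum>(h,r)\<in>monic_of_degree (n - degree M) \<times> polys_below (degree M). g ((h * M + r) mod M))"
    by (subst sum.reindex_bij_betw[OF bij_betw_div_mod_monic[OF M], symmetric])
       (simp add: case_prod_unfold)
  also have "\<dots> = (\<Sum>(h,r)\<in>(monic_of_degree (n - degree M) :: 'a poly set) \<times> polys_below (degree M). g r)"
    by (intro sum.cong refl) (auto simp: mod_polys_below)
  finally show ?thesis
    by (simp add: sum.cartesian_product[symmetric] card_monic_of_degree)
qed

lemma monic_irreducibles_monic: "P \<in> monic_irreducibles \<Longrightarrow> P \<in> monic_polys"
  by (simp add: monic_irreducibles_def)

lemma monic_irreducibles_nonzero: "P \<in> monic_irreducibles \<Longrightarrow> P \<noteq> 0"
  by (auto simp: monic_irreducibles_def)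

lemma monic_irreducibles_prime_elem: "P \<in> monic_irreducibles \<Longrightarrow> prime_elem P"
  by (auto simp: monic_irreducibles_def field_poly_irreducible_imp_prime)

lemma monic_irreducibles_dvd_mult_iff:
  "P \<in> monic_irreducibles \<Longrightarrow> P dvd f * g \<longleftrightarrow> P dvd f \<or> P dvd g"
  by (simp add: monic_irreducibles_prime_elem prime_elem_dvd_mult_iff)

lemma monic_irreducibles_dvd_power:
  "P \<in> monic_irreducibles \<Longrightarrow> P dvd f ^ n \<Longrightarrow> P dvd f"
  by (metis monic_irreducibles_prime_elem prime_elem_dvd_power)

lemma monic_irreducibles_not_unit: "P \<in> monic_irreducibles \<Longrightarrow> \<not> P dvd 1"
  by (simp add: monic_irreducibles_def irreducible_not_unit)

lemma monic_irreducibles_dvd_prod_iff: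
  assumes "P \<in> monic_irreducibles" "finite A"
  shows "P dvd prod f A \<longleftrightarrow> (\<exists>x\<in>A. P dvd f x)"
  using assms(2,1) by (induction A rule: finite_induct)
     (auto simp: monic_irreducibles_dvd_mult_iff monic_irreducibles_not_unit)

lemma monic_irreducibles_degree_pos:
  assumes "P \<in> monic_irreducibles" shows "degree P > 0"
proof (rule ccontr)
  assume "\<not> degree P > 0"
  hence "P = 1"
    using assms monic_of_degree_0 by (auto simp: monic_of_degree_def monic_irreducibles_def)
  thus False using assms by (simp add: monic_irreducibles_def)
qed

lemma monic_irreducibles_dvd_iff:
  assumes "P \<in> monic_irreducibles" "Q \<in> monic_irreducibles"
  shows   "P dvd Q \<longleftrightarrow> P = Q"
proof
  assume "P dvd Q"
  then obtain R where R: "Q = P * R" by auto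
  hence "R dvd 1"
    using assms irreducibleD[of Q P R] monic_irreducibles_not_unit
    by (auto simp: monic_irreducibles_def)
  hence "degree R = 0" by (auto elim: is_unit_polyE)
  thus "P = Q"
    using R assms degree_mult_le[of P R]
    by (intro monic_polys_dvd_antisym) (auto simp: monic_irreducibles_def)
qed auto

lemma not_dvd_polys_below:
  "P \<in> monic_irreducibles \<Longrightarrow> f \<in> polys_below (degree P) \<Longrightarrow> f \<noteq> 0 \<Longrightarrow> \<not> P dvd f"
  by (auto simp: polys_below_iff dest: dvd_imp_degree_le)

lemma cong_cancel_monic_irreducible:
  assumes "P \<in> monic_irreducibles" "\<not> P dvd f" "[f * g = f * h] (mod P)"
  shows   "[g = h] (mod P)"
  using assms monic_irreducibles_dvd_mult_iff[of P f "g - h"]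
  by (simp add: cong_iff_dvd_diff algebra_simps)

lemma bij_betw_mult_mod:
  assumes P: "P \<in> monic_irreducibles" "\<not> P dvd f"
  shows "bij_betw (\<lambda>g. (f * g) mod P) (polys_below (degree P)) (polys_below (degree P))"
proof -
  have "inj_on (\<lambda>g. (f * g) mod P) (polys_below (degree P))"
  proof (rule inj_onI)
    fix g h assume *: "g \<in> polys_below (degree P)" "h \<in> polys_below (degree P)"
      "(f * g) mod P = (f * h) mod P"
    from *(3) have "[g = h] (mod P)"
      using cong_cancel_monic_irreducible[OF P, of g h] by (simp add: cong_def)
    with * show "g = h" by (intro polys_below_cong_eq[of g P h])
  qed
  moreover have "(\<lambda>g. (f * g) mod P) ` polys_below (degree P) \<subseteq> polys_below (degree P)"
    by (intro image_subsetI mod_in_polys_below monic_irreducibles_nonzero P)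
  ultimately show ?thesis
    unfolding bij_betw_def by (intro conjI endo_inj_surj) auto
qed

lemma bij_betw_mult_mod_nonzero:
  assumes P: "P \<in> monic_irreducibles" "\<not> P dvd f"
  shows "bij_betw (\<lambda>g. (f * g) mod P) (polys_below (degree P) - {0}) (polys_below (degree P) - {0})"
proof -
  have "bij_betw (\<lambda>g. (f * g) mod P) {0} {0}" by (simp add: bij_betw_def)
  from bij_betw_DiffI[OF bij_betw_mult_mod[OF P] this] show ?thesis by simp
qed

lemma inverse_mod_exists:
  assumes P: "P \<in> monic_irreducibles" "\<not> P dvd f" "\<not> P dvd c"
  obtains g where "g \<in> polys_below (degree P) - {0}" "[f * g = c] (mod P)"
proof -
  have "c mod P \<noteq> 0" using P(3) by (rule contrapos_nn) (rule mod_0_imp_dvd)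
  moreover have "c mod P \<in> polys_below (degree P)"
    by (rule mod_in_polys_below[OF monic_irreducibles_nonzero[OF P(1)]])
  ultimately have "c mod P \<in> polys_below (degree P) - {0}" by blast
  hence "c mod P \<in> (\<lambda>g. (f * g) mod P) ` (polys_below (degree P) - {0})"
    by (simp only: bij_betw_imp_surj_on[OF bij_betw_mult_mod_nonzero[OF P(1,2)]])
  then obtain g where "g \<in> polys_below (degree P) - {0}" "c mod P = (f * g) mod P"
    by (rule imageE)
  thus ?thesis by (intro that[of g]) (simp_all add: cong_def)
qed

lemma not_dvd_prod_nonzero:
  fixes P :: "'a::{finite,field} poly"
  assumes "P \<in> monic_irreducibles"
  shows   "\<not> P dvd \<Prod>(polys_below (degree P) - {0})"
  using not_dvd_polys_below[OF assms]
  by (subst monic_irreducibles_dvd_prod_iff[OF assms]) auto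

section \<open>Fermat, Wilson and Euler's criterion modulo a monic irreducible\<close>

lemma fermat_monic_irreducible:
  fixes P :: "'a::{finite,field} poly"
  assumes P: "P \<in> monic_irreducibles" "\<not> P dvd f"
  shows   "[f ^ (CARD('a) ^ degree P - 1) = 1] (mod P)"
proof -
  define S where "S = polys_below (degree P) - {0 :: 'a poly}"
  have card: "card S = CARD('a) ^ degree P - 1"
    unfolding S_def by (subst card_Diff_subset) (auto simp: card_polys_below)
  have "\<Prod>S = (\<Prod>g\<in>S. (f * g) mod P)"
    using bij_betw_mult_mod_nonzero[OF P]
    by (intro prod.reindex_bij_betw[symmetric]) (simp add: S_def)
  also have "[\<dots> = (\<Prod>g\<in>S. f * g)] (mod P)"
    by (intro cong_prod) auto
  also have "(\<Prod>g\<in>S. f * g) = \<Prod>S * f ^ card S"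
    by (simp add: prod.distrib mult_ac)
  finally have "[\<Prod>S * f ^ card S = \<Prod>S * 1] (mod P)" unfolding mult_1_right by (rule cong_sym)
  from cong_cancel_monic_irreducible[OF P(1) not_dvd_prod_nonzero[OF P(1)] this[unfolded S_def]]
  show ?thesis unfolding card[symmetric] S_def .
qed

lemma fermat_monic_irreducible':
  fixes P :: "'a::{finite,field} poly"
  assumes P: "P \<in> monic_irreducibles"
  shows   "[f ^ (CARD('a) ^ degree P) = f] (mod P)"
proof (cases "P dvd f")
  case True
  hence "P dvd f ^ (CARD('a) ^ degree P) - f"
    by (intro dvd_diff dvd_trans[OF True dvd_power]) auto
  thus ?thesis by (simp add: cong_iff_dvd_diff)
next
  case False
  have "[f * f ^ (CARD('a) ^ degree P - 1) = f * 1] (mod P)"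
    by (intro cong_mult fermat_monic_irreducible P False) auto
  moreover have "f * f ^ (CARD('a) ^ degree P - 1) = f ^ (CARD('a) ^ degree P)"
    using power_minus_mult[of "CARD('a) ^ degree P" f] by (simp add: mult.commute)
  ultimately show ?thesis by (simp only: mult_1_right)
qed

text \<open>The residue field of \<open>P\<close> lies in the field with \<open>q^n\<close>
  elements. Stepanov's method uses this with \<open>n = 2 * e\<close> to reduce powers of the
  variable.\<close>

lemma fermat_monic_irreducible_iterated:
  fixes P :: "'a::{finite,field} poly"
  assumes P: "P \<in> monic_irreducibles" "degree P dvd n"
  shows   "[f ^ (CARD('a) ^ n) = f] (mod P)"
proof -
  obtain k where k: "n = degree P * k" using P by auto
  have "[f ^ (CARD('a) ^ (degree P * k)) = f] (mod P)"
  proof (induction k)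
    case (Suc k)
    have "f ^ (CARD('a) ^ (degree P * Suc k)) = (f ^ (CARD('a) ^ (degree P * k))) ^ (CARD('a) ^ degree P)"
      by (simp add: power_add mult_ac flip: power_mult)
    also have "[\<dots> = f ^ (CARD('a) ^ degree P)] (mod P)" by (intro cong_pow Suc)
    also have "[f ^ (CARD('a) ^ degree P) = f] (mod P)" using P by (intro fermat_monic_irreducible')
    finally show ?case .
  qed auto
  thus ?thesis using k by simp
qed

text \<open>Pairing off \<open>x\<close> with \<open>\<sigma> x\<close>, as in the classical proofs of Wilson's theorem and Euler's criterion.\<close>

lemma prod_pairing_cong:
  fixes c m :: "'b::unique_euclidean_ring"
  assumes "finite S" "\<And>x. x \<in> S \<Longrightarrow> \<sigma> x \<in> S" "\<And>x. x \<in> S \<Longrightarrow> \<sigma> (\<sigma> x) = x"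
    "\<And>x. x \<in> S \<Longrightarrow> \<sigma> x \<noteq> x" "\<And>x. x \<in> S \<Longrightarrow> [x * \<sigma> x = c] (mod m)"
  shows   "even (card S) \<and> [\<Prod>S = c ^ (card S div 2)] (mod m)"
  using assms
proof (induction "card S" arbitrary: S rule: less_induct)
  case less
  show ?case
  proof (cases "S = {}")
    case False
    then obtain x where x: "x \<in> S" by auto
    define T where "T = S - {x, \<sigma> x}"
    have xS: "{x, \<sigma> x} \<subseteq> S" using x less.prems by auto
    have "x \<noteq> \<sigma> x" using less.prems(4)[OF x] by simp
    hence card2: "card {x, \<sigma> x} = 2" by simp
    have cT: "card S = card T + 2"
      using card_Diff_subset[of "{x, \<sigma> x}" S] card_mono[OF less.prems(1) xS] xS card2
      by (simp add: T_def)
    have "even (card T) \<and> [\<Prod>T = c ^ (card T div 2)] (mod m)"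
    proof (rule less.hyps)
      show "card T < card S" using cT by simp
      show "finite T" using less.prems by (simp add: T_def)
      fix y assume "y \<in> T"
      hence y: "y \<in> S" "y \<noteq> x" "y \<noteq> \<sigma> x" by (auto simp: T_def)
      show "\<sigma> y \<in> T" using y x less.prems(2,3) unfolding T_def by (metis Diff_iff empty_iff insert_iff)
      show "\<sigma> (\<sigma> y) = y" "\<sigma> y \<noteq> y" "[y * \<sigma> y = c] (mod m)" using y less.prems by auto
    qed
    moreover have "\<Prod>S = (x * \<sigma> x) * \<Prod>T"
      using prod.subset_diff[OF xS less.prems(1), of "\<lambda>x. x"] card2 less.prems(4)[OF x]
      by (simp add: T_def mult_ac)
    moreover have "[x * \<sigma> x = c] (mod m)" using less.prems x by simp
    ultimately show ?thesis
      using cT by (simp add: cong_mult)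
  qed auto
qed

text \<open>In characteristic 2 the map \<open>x + 1\<close> would pair off all field elements and
  make \<open>q\<close> even. The pairing lemma is applied to constant polynomials with modulus 1,
  where its congruences are trivial and only the parity matters.\<close>

lemma two_neq_zero:
  assumes "odd CARD('a::{finite,field})"
  shows   "(1::'a) + 1 \<noteq> 0"
proof
  assume *: "(1::'a) + 1 = 0"
  have **: "x + 1 + 1 = x" "x + 1 \<noteq> x" for x :: 'a
    by (simp_all only: add.assoc * add_0_right) simp
  define S where "S = (\<lambda>x::'a. [:x:]) ` UNIV"
  have S: "\<exists>c. x = [:c:]" if "x \<in> S" for x using that by (auto simp: S_def)
  have "even (card S) \<and> [\<Prod>S = 0 ^ (card S div 2)] (mod (1::'a poly))"
  proof (rule prod_pairing_cong[where \<sigma> = "\<lambda>x. x + [:1:]"])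
    fix x :: "'a poly" assume x: "x \<in> S"
    then obtain c where c: "x = [:c:]" using S by blast
    show "x + [:1:] \<in> S" unfolding c S_def add_pCons by simp
    show "x + [:1:] + [:1:] = x" unfolding c add_pCons ** by simp
    show "x + [:1:] \<noteq> x" using **(2)[of c] unfolding c add_pCons by simp
  qed (auto simp: S_def cong_def)
  moreover have "card S = CARD('a)" by (auto simp: S_def intro!: card_image injI)
  ultimately show False using assms by simp
qed

lemma one_neq_minus_one:
  assumes "odd CARD('a::{finite,field})"
  shows   "(1::'a poly) \<noteq> -1"
proof
  assume "(1::'a poly) = -1"
  hence "poly (1::'a poly) 0 = poly (-1) 0" by (rule arg_cong)
  hence "(1::'a) + 1 = 0" by (metis add.right_inverse poly_1 poly_minus)
  thus False using two_neq_zero[where ?'a = 'a] assms by blast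
qed

lemma one_in_polys_below [simp]: "n > 0 \<Longrightarrow> 1 \<in> polys_below n"
  by (auto simp: polys_below_iff)

lemma card_nonzero_residues:
  "card (polys_below n - {0 :: 'a::{finite,field} poly}) = CARD('a) ^ n - 1"
  by (subst card_Diff_subset) (auto simp: card_polys_below)

lemma square_cong_one:
  assumes "P \<in> monic_irreducibles" "[f ^ 2 = 1] (mod P)"
  shows   "[f = 1] (mod P) \<or> [f = -1] (mod P)"
  using assms monic_irreducibles_dvd_mult_iff[of P "f - 1" "f + 1"]
  by (simp add: cong_iff_dvd_diff algebra_simps power2_eq_square)

text \<open>The map is \<open>x\<close> to \<open>c / x\<close>. It is used with
  \<open>c = 1\<close> for Wilson's theorem and with a nonsquare \<open>c\<close> for Euler's
  criterion.\<close>

lemma residue_involution: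
  fixes P :: "'a::{finite,field} poly"
  assumes P: "P \<in> monic_irreducibles" and c: "\<not> P dvd c"
  obtains \<sigma> :: "'a poly \<Rightarrow> 'a poly"
  where "\<And>x. x \<in> polys_below (degree P) - {0} \<Longrightarrow> \<sigma> x \<in> polys_below (degree P) - {0}"
    "\<And>x. x \<in> polys_below (degree P) - {0} \<Longrightarrow> \<sigma> (\<sigma> x) = x"
    "\<And>x. x \<in> polys_below (degree P) - {0} \<Longrightarrow> [x * \<sigma> x = c] (mod P)"
proof -
  define R where "R = polys_below (degree P) - {0 :: 'a poly}"
  have "\<exists>y\<in>R. [x * y = c] (mod P)" if "x \<in> R" for x
    using inverse_mod_exists[OF P _ c, of x] not_dvd_polys_below[OF P, of x] c that
    unfolding R_def by (metis DiffD1 DiffD2 singletonI)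
  then obtain \<sigma> where \<sigma>: "\<And>x. x \<in> R \<Longrightarrow> \<sigma> x \<in> R \<and> [x * \<sigma> x = c] (mod P)" by metis
  have inv: "\<sigma> (\<sigma> x) = x" if x: "x \<in> R" for x
  proof -
    have "[\<sigma> x * \<sigma> (\<sigma> x) = c] (mod P)" "[x * \<sigma> x = c] (mod P)" using \<sigma> x by auto
    hence "[\<sigma> x * \<sigma> (\<sigma> x) = \<sigma> x * x] (mod P)" by (metis cong_sym cong_trans mult.commute)
    hence "[\<sigma> (\<sigma> x) = x] (mod P)"
      using cong_cancel_monic_irreducible[OF P] not_dvd_polys_below[OF P, of "\<sigma> x"] \<sigma>[OF x]
      by (auto simp: R_def)
    thus ?thesis using polys_below_cong_eq[of "\<sigma> (\<sigma> x)" P x] \<sigma>[OF x] \<sigma>[of "\<sigma> x"] x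
      by (auto simp: R_def)
  qed
  show ?thesis
  proof (rule that[of \<sigma>])
    fix x :: "'a poly" assume "x \<in> polys_below (degree P) - {0}"
    hence x: "x \<in> R" by (simp only: R_def)
    show "\<sigma> x \<in> polys_below (degree P) - {0}" "[x * \<sigma> x = c] (mod P)"
      using \<sigma>[OF x] unfolding R_def by blast+
    show "\<sigma> (\<sigma> x) = x" by (rule inv[OF x])
  qed
qed

text \<open>Inversion fixes only 1 and -1, which are distinct because \<open>q\<close> is odd; all
  other residues cancel in pairs.\<close>

lemma wilson_monic_irreducible:
  fixes P :: "'a::{finite,field} poly"
  assumes odd: "odd CARD('a)" and P: "P \<in> monic_irreducibles"
  shows   "[\<Prod>(polys_below (degree P) - {0}) = -1] (mod P)"
proof -
  define R where "R = polys_below (degree P) - {0 :: 'a poly}"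
  have one: "1 \<in> R" "-1 \<in> R"
    using monic_irreducibles_degree_pos[OF P] by (auto simp: R_def intro: polys_below_uminus)
  obtain \<sigma> where \<sigma>: "\<And>x. x \<in> R \<Longrightarrow> \<sigma> x \<in> R" "\<And>x. x \<in> R \<Longrightarrow> \<sigma> (\<sigma> x) = x"
    "\<And>x. x \<in> R \<Longrightarrow> [x * \<sigma> x = 1] (mod P)"
    using residue_involution[OF P monic_irreducibles_not_unit[OF P]] unfolding R_def by blast
  have fix_iff: "\<sigma> x = x \<longleftrightarrow> x = 1 \<or> x = -1" if x: "x \<in> R" for x
  proof
    assume "\<sigma> x = x"
    hence "[x ^ 2 = 1] (mod P)" using \<sigma>(3)[OF x] by (simp add: power2_eq_square)
    thus "x = 1 \<or> x = -1"
      using square_cong_one[OF P] x one polys_below_cong_eq by (auto simp: R_def)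
  next
    assume "x = 1 \<or> x = -1"
    hence "[\<sigma> x = x] (mod P)"
    proof
      assume "x = -1"
      thus ?thesis using \<sigma>(3)[OF x] cong_minus_minus_iff[of "\<sigma> x" "-1" P] by simp
    qed (use \<sigma>(3)[OF x] in auto)
    thus "\<sigma> x = x" using x \<sigma>(1)[OF x] polys_below_cong_eq[of "\<sigma> x" P x] by (auto simp: R_def)
  qed
  define S where "S = R - {1, -1}"
  have "even (card S) \<and> [\<Prod>S = 1 ^ (card S div 2)] (mod P)"
  proof (rule prod_pairing_cong[where \<sigma> = \<sigma>])
    show "finite S" by (simp add: S_def R_def)
    fix x assume "x \<in> S"
    hence x: "x \<in> R" "x \<noteq> 1" "x \<noteq> -1" by (auto simp: S_def)
    have "\<sigma> x \<noteq> x" using fix_iff x by auto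
    moreover have "\<sigma> x \<noteq> 1" "\<sigma> x \<noteq> -1"
      using fix_iff[OF one(1)] fix_iff[OF one(2)] \<sigma>(2)[OF x(1)] x by metis+
    ultimately show "\<sigma> x \<in> S" "\<sigma> x \<noteq> x" using \<sigma> x by (auto simp: S_def)
  qed (use \<sigma> in \<open>auto simp: S_def\<close>)
  moreover have "\<Prod>R = \<Prod>S * (1 * -1)"
    using prod.subset_diff[of "{1,-1}" R "\<lambda>x. x"] one one_neq_minus_one[OF odd]
    by (simp add: S_def R_def)
  ultimately show ?thesis
    by (simp add: R_def cong_minus_minus_iff)
qed

lemma half_card_residues:
  assumes "odd CARD('a::{finite,field})"
  shows   "2 * ((CARD('a) ^ n - 1) div 2) = CARD('a) ^ n - 1"
  using assms by simp

lemma card_field_ge_3: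
  assumes "odd CARD('a::{finite,field})"
  shows   "CARD('a) \<ge> 3"
proof -
  have "card {0, 1 :: 'a} \<le> CARD('a)" by (intro card_mono) auto
  moreover have "card {0, 1 :: 'a} = 2" by simp
  moreover have "CARD('a) \<noteq> 2" using assms by auto
  ultimately show ?thesis by linarith
qed

lemma card_nonzero_residues_ge:
  assumes "odd CARD('a::{finite,field})" "n > 0"
  shows   "CARD('a) ^ n - 1 \<ge> 2"
proof -
  have "CARD('a) ^ 1 \<le> CARD('a) ^ n" using assms by (intro power_increasing) auto
  thus ?thesis using card_field_ge_3[OF assms(1)] by simp
qed

text \<open>If \<open>f\<close> is a square, Fermat applies to its root. If not, the involution
  \<open>x\<close> to \<open>f / x\<close> has no fixed point, so the product of all nonzero
  residues is \<open>f\<close> to half their number, and Wilson evaluates that product as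
  -1.\<close>

theorem euler_criterion_monic_irreducible:
  fixes P :: "'a::{finite,field} poly"
  assumes odd: "odd CARD('a)" and P: "P \<in> monic_irreducibles"
  shows   "[of_int (quadratic_symbol f P) = f ^ ((CARD('a) ^ degree P - 1) div 2)] (mod P)"
proof (cases "P dvd f")
  case True
  have "(CARD('a) ^ degree P - 1) div 2 > 0"
    using card_nonzero_residues_ge[OF odd, of "degree P"] monic_irreducibles_degree_pos[OF P] by linarith
  hence "P dvd f ^ ((CARD('a) ^ degree P - 1) div 2)"
    using True by (intro dvd_trans[OF True dvd_power]) auto
  thus ?thesis using True by (simp add: quadratic_symbol_def cong_iff_dvd_diff)
next
  case False
  define N where "N = (CARD('a) ^ degree P - 1) div 2"
  have N2: "2 * N = CARD('a) ^ degree P - 1" using half_card_residues[OF odd] by (simp add: N_def)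
  show ?thesis
  proof (cases "\<exists>h. [h ^ 2 = f] (mod P)")
    case True
    then obtain h where h: "[h ^ 2 = f] (mod P)" by auto
    hence "[f = 0] (mod P)" if "P dvd h"
      using that by (metis cong_0_iff cong_sym cong_trans dvd_mult2 power2_eq_square)
    hence "\<not> P dvd h" using False by (auto simp: cong_0_iff)
    hence "[h ^ (2 * N) = 1] (mod P)" using fermat_monic_irreducible[OF P] N2 by simp
    moreover have "[h ^ (2 * N) = f ^ N] (mod P)" using cong_pow[OF h, of N] by (simp add: power_mult)
    ultimately have "[1 = f ^ N] (mod P)" by (metis cong_sym cong_trans)
    thus ?thesis using True False by (simp add: quadratic_symbol_def N_def)
  next
    case nonsquare: False
    define R where "R = polys_below (degree P) - {0 :: 'a poly}"
    obtain \<sigma> where \<sigma>: "\<And>x. x \<in> R \<Longrightarrow> \<sigma> x \<in> R" "\<And>x. x \<in> R \<Longrightarrow> \<sigma> (\<sigma> x) = x"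
      "\<And>x. x \<in> R \<Longrightarrow> [x * \<sigma> x = f] (mod P)"
      using residue_involution[OF P False] unfolding R_def by blast
    have "even (card R) \<and> [\<Prod>R = f ^ (card R div 2)] (mod P)"
    proof (rule prod_pairing_cong[where \<sigma> = \<sigma>])
      fix x assume "x \<in> R"
      thus "\<sigma> x \<noteq> x" using \<sigma>(3)[of x] nonsquare by (auto simp: power2_eq_square)
    qed (use \<sigma> in \<open>auto simp: R_def\<close>)
    moreover have "[\<Prod>R = -1] (mod P)" using wilson_monic_irreducible[OF odd P] by (simp add: R_def)
    ultimately have "[-1 = f ^ N] (mod P)"
      by (metis N_def R_def card_nonzero_residues cong_sym cong_trans)
    thus ?thesis using nonsquare False by (simp add: quadratic_symbol_def N_def)
  qed
qed

section \<open>Arithmetic of the quadratic symbol\<close>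

lemma quadratic_symbol_range: "quadratic_symbol f P \<in> {-1, 0, 1}"
  by (simp add: quadratic_symbol_def)

text \<open>The constants -1, 0, 1 are reduced residues and pairwise distinct for odd
  \<open>q\<close>. This turns congruences from Euler's criterion into equalities of
  integers.\<close>

lemma cong_of_int_sign:
  fixes P :: "'a::{finite,field} poly"
  assumes "odd CARD('a)" "P \<in> monic_irreducibles" "a \<in> {-1, 0, 1}" "b \<in> {-1, 0, 1}"
    "[of_int a = of_int b] (mod P)"
  shows   "a = b"
proof -
  have deg: "degree P > 0" using assms(2) by (rule monic_irreducibles_degree_pos)
  have "(of_int a :: 'a poly) \<in> polys_below (degree P)" "(of_int b :: 'a poly) \<in> polys_below (degree P)"
    using assms(3,4) deg one_in_polys_below[OF deg, where ?'a = 'a]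
      polys_below_uminus[OF one_in_polys_below[OF deg, where ?'a = 'a]] by auto
  hence "of_int a = (of_int b :: 'a poly)" using assms(5) polys_below_cong_eq by blast
  thus ?thesis using assms(3,4) one_neq_minus_one[OF assms(1)] by auto
qed

lemma quadratic_symbol_cong:
  assumes "[f = g] (mod P)" shows "quadratic_symbol f P = quadratic_symbol g P"
proof -
  have "P dvd f \<longleftrightarrow> P dvd g"
    using assms by (metis cong_0_iff cong_sym cong_trans)
  moreover have "[h ^ 2 = f] (mod P) \<longleftrightarrow> [h ^ 2 = g] (mod P)" for h
    using assms by (metis cong_sym cong_trans)
  ultimately show ?thesis by (simp add: quadratic_symbol_def)
qed

lemma quadratic_symbol_eq_0_iff: "quadratic_symbol f P = 0 \<longleftrightarrow> P dvd f"
  by (simp add: quadratic_symbol_def)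

lemma quadratic_symbol_mult:
  fixes P :: "'a::{finite,field} poly"
  assumes odd: "odd CARD('a)" and P: "P \<in> monic_irreducibles"
  shows   "quadratic_symbol (f * g) P = quadratic_symbol f P * quadratic_symbol g P"
proof (rule cong_of_int_sign[OF odd P])
  show "quadratic_symbol f P * quadratic_symbol g P \<in> {-1, 0, 1}"
    using quadratic_symbol_range[of f P] quadratic_symbol_range[of g P] by auto
  note euler = euler_criterion_monic_irreducible[OF odd P]
  have *: "[of_int (quadratic_symbol f P) * of_int (quadratic_symbol g P) =
          f ^ ((CARD('a) ^ degree P - 1) div 2) * g ^ ((CARD('a) ^ degree P - 1) div 2)] (mod P)"
    by (intro cong_mult euler)
  thus "[of_int (quadratic_symbol (f * g) P) = of_int (quadratic_symbol f P * quadratic_symbol g P)] (mod P)"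
    using euler[of "f * g"] cong_trans[OF _ cong_sym[OF *]] by (simp add: power_mult_distrib)
qed (rule quadratic_symbol_range)

lemma quadratic_symbol_1: 
  assumes "P \<in> monic_irreducibles" shows "quadratic_symbol 1 P = 1"
  using monic_irreducibles_not_unit[OF assms] by (auto simp: quadratic_symbol_def intro: exI[of _ 1])

lemma quadratic_symbol_prod:
  fixes P :: "'a::{finite,field} poly"
  assumes "odd CARD('a)" "P \<in> monic_irreducibles"
  shows   "quadratic_symbol (prod f A) P = (\<Prod>x\<in>A. quadratic_symbol (f x) P)"
  by (induction A rule: infinite_finite_induct)
     (auto simp: quadratic_symbol_mult[OF assms] quadratic_symbol_1[OF assms(2)])

text \<open>Squaring identifies 1 and -1, so on the finite set of residues it is not injective and
  hence not surjective.\<close>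

lemma exists_nonresidue:
  fixes P :: "'a::{finite,field} poly"
  assumes odd: "odd CARD('a)" and P: "P \<in> monic_irreducibles"
  obtains f where "quadratic_symbol f P = -1"
proof -
  define R where "R = (polys_below (degree P) :: 'a poly set)"
  have "\<not> (\<lambda>h. h ^ 2 mod P) ` R \<supseteq> R"
  proof
    assume "R \<subseteq> (\<lambda>h. h ^ 2 mod P) ` R"
    hence "inj_on (\<lambda>h. h ^ 2 mod P) R"
      by (metis R_def card_image_le card_mono eq_card_imp_inj_on finite_imageI finite_polys_below order_antisym)
    moreover have "1 \<in> R" "-1 \<in> R" "(1::'a poly) ^ 2 mod P = (-1) ^ 2 mod P"
      using monic_irreducibles_degree_pos[OF P] by (auto simp: R_def intro: polys_below_uminus)
    ultimately have "(1::'a poly) = -1" by (rule_tac inj_onD)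
    thus False using one_neq_minus_one[OF odd] by contradiction
  qed
  then obtain f where f: "f \<in> R" "f \<notin> (\<lambda>h. h ^ 2 mod P) ` R" by auto
  have "f \<noteq> 0" using f by (auto simp: R_def intro!: image_eqI[of _ _ 0])
  moreover have "\<not> [h ^ 2 = f] (mod P)" for h
  proof
    assume "[h ^ 2 = f] (mod P)"
    hence "(h mod P) ^ 2 mod P = f" using f by (simp add: cong_def R_def mod_polys_below power_mod)
    thus False using f monic_irreducibles_nonzero[OF P] by (auto simp: R_def intro: mod_in_polys_below)
  qed
  ultimately have "quadratic_symbol f P = -1"
    using f not_dvd_polys_below[OF P, of f] by (auto simp: quadratic_symbol_def R_def)
  thus ?thesis using that by blast
qed

section \<open>Factorisation and prime power sums\<close>

lemma monic_associate_exists: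
  fixes g :: "'a::{finite,field} poly"
  assumes "g \<noteq> 0"
  obtains h where "h \<in> monic_polys" "h dvd g" "g dvd h" "degree h = degree g"
proof (rule that[of "smult (inverse (lead_coeff g)) g"])
  show "smult (inverse (lead_coeff g)) g \<in> monic_polys"
    using assms by (simp add: monic_polys_def)
  show "smult (inverse (lead_coeff g)) g dvd g"
    using assms by (intro smult_dvd) auto
  show "g dvd smult (inverse (lead_coeff g)) g" by (rule dvd_smult) simp
  show "degree (smult (inverse (lead_coeff g)) g) = degree g" using assms by simp
qed

lemma poly_unit_iff_degree_0:
  fixes g :: "'a::{finite,field} poly"
  assumes "g \<noteq> 0" shows "g dvd 1 \<longleftrightarrow> degree g = 0"
  using assms by (auto simp: is_unit_poly_iff dvd_field_iff elim!: degree_eq_zeroE)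

lemma monic_irreducible_divisor_exists:
  fixes f :: "'a::{finite,field} poly"
  assumes "f \<in> monic_polys" "degree f > 0"
  shows   "\<exists>P\<in>monic_irreducibles. P dvd f"
  using assms
proof (induction "degree f" arbitrary: f rule: less_induct)
  case less
  have f0: "f \<noteq> 0" using less.prems monic_polys_nonzero by blast
  show ?case
  proof (cases "irreducible f")
    case True
    thus ?thesis using less.prems by (intro bexI[of _ f]) (auto simp: monic_irreducibles_def)
  next
    case False
    moreover have "\<not> f dvd 1" using less.prems f0 by (simp add: poly_unit_iff_degree_0)
    ultimately obtain a b where ab: "f = a * b" "\<not> a dvd 1" "\<not> b dvd 1"
      using f0 unfolding irreducible_def by blast
    have ab0: "a \<noteq> 0" "b \<noteq> 0" using ab f0 by auto
    obtain h where h: "h \<in> monic_polys" "h dvd a" "degree h = degree a"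
      using monic_associate_exists[OF ab0(1)] by metis
    have "degree a > 0" "degree b > 0" using ab ab0 by (simp_all add: poly_unit_iff_degree_0)
    hence "degree h < degree f" "degree h > 0" using ab ab0 h by (simp_all add: degree_mult_eq)
    then obtain P where "P \<in> monic_irreducibles" "P dvd h" using less.hyps[of h] h(1) by metis
    thus ?thesis using h ab by (meson dvd_mult2 dvd_trans)
  qed
qed

text \<open>One irreducible factor is removed at a time, so identities between completely
  multiplicative functions need checking on irreducibles only.\<close>

lemma monic_polys_induct [consumes 1, case_names one mult]:
  fixes f :: "'a::{finite,field} poly"
  assumes "f \<in> monic_polys" "Q 1"
    "\<And>p g. p \<in> monic_irreducibles \<Longrightarrow> g \<in> monic_polys \<Longrightarrow> Q g \<Longrightarrow> Q (p * g)"
  shows   "Q f"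
  using assms(1)
proof (induction "degree f" arbitrary: f rule: less_induct)
  case less
  show ?case
  proof (cases "degree f = 0")
    case True
    hence "f \<in> monic_of_degree 0" using less.prems by (simp add: monic_of_degree_def)
    thus ?thesis using assms(2) by (simp add: monic_of_degree_0)
  next
    case False
    then obtain p where p: "p \<in> monic_irreducibles" "p dvd f"
      using monic_irreducible_divisor_exists[of f] less.prems by auto
    then obtain g where g: "f = p * g" by auto
    have pm: "p \<in> monic_polys" using p by (rule_tac monic_irreducibles_monic)
    have gm: "g \<in> monic_polys" using less.prems g pm monic_polys_multD by blast
    have "degree g < degree f"
      using monic_irreducibles_degree_pos[OF p(1)] monic_polys_degree_mult[OF pm gm] g by simp
    thus ?thesis using less.hyps gm g p assms(3) by blast
  qed
qed

section \<open>Multiplicities and the multiplicative extension of the symbol\<close>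

definition monic_irreducibles_upto :: "nat \<Rightarrow> 'a::{finite,field} poly set" where
  "monic_irreducibles_upto m = {P \<in> monic_irreducibles. degree P \<le> m}"

lemma finite_monic_irreducibles_upto [simp, intro]: "finite (monic_irreducibles_upto m)"
proof (rule finite_subset)
  show "monic_irreducibles_upto m \<subseteq> (\<Union>n\<le>m. monic_of_degree n)"
    by (auto simp: monic_irreducibles_upto_def monic_of_degree_def monic_irreducibles_def)
qed auto

lemma finite_monic_irreducible_divisors:
  "f \<noteq> 0 \<Longrightarrow> finite {P \<in> monic_irreducibles. P dvd f}"
  by (rule finite_subset[OF _ finite_monic_irreducibles_upto[of "degree f"]])
     (auto simp: monic_irreducibles_upto_def dvd_imp_degree_le)

lemma power_dvd_bound:
  fixes P :: "'a::{finite,field} poly"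
  assumes "P \<in> monic_irreducibles" "f \<noteq> 0" "P ^ m dvd f"
  shows   "m \<le> degree f"
proof -
  have "m * 1 \<le> m * degree P"
    using monic_irreducibles_degree_pos[OF assms(1)] by (intro mult_le_mono) auto
  also have "\<dots> = degree (P ^ m)"
    using monic_irreducibles_nonzero[OF assms(1)] by (simp add: degree_power_eq)
  also have "\<dots> \<le> degree f" using assms by (intro dvd_imp_degree_le)
  finally show ?thesis by simp
qed

text \<open>Here the \<open>Max\<close> in \<open>poly_multiplicity\<close> acquires its meaning:
  the set of exponents contains 0 and is bounded by the degree of \<open>f\<close>.\<close>

lemma power_dvd_iff_le_multiplicity:
  fixes P :: "'a::{finite,field} poly"
  assumes "P \<in> monic_irreducibles" "f \<noteq> 0"
  shows   "P ^ m dvd f \<longleftrightarrow> m \<le> poly_multiplicity P f"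
proof -
  let ?S = "{m. P ^ m dvd f}"
  have fin: "finite ?S"
    by (rule finite_subset[of _ "{..degree f}"]) (use power_dvd_bound[OF assms] in auto)
  have "Max ?S \<in> ?S" by (rule Max_in) (use fin in \<open>auto intro: exI[of _ 0]\<close>)
  hence "P ^ poly_multiplicity P f dvd f" by (simp add: poly_multiplicity_def)
  moreover have "m \<le> poly_multiplicity P f" if "P ^ m dvd f"
    unfolding poly_multiplicity_def using fin that by (intro Max_ge) auto
  ultimately show ?thesis by (metis dvd_trans le_imp_power_dvd)
qed

lemma poly_multiplicity_le_degree:
  fixes P :: "'a::{finite,field} poly"
  assumes "P \<in> monic_irreducibles" "f \<noteq> 0"
  shows "poly_multiplicity P f \<le> degree f"
  using power_dvd_iff_le_multiplicity[OF assms] power_dvd_bound[OF assms] by blast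

lemma poly_multiplicity_eqI:
  fixes P :: "'a::{finite,field} poly"
  assumes "P \<in> monic_irreducibles" "f = P ^ a * g" "\<not> P dvd g"
  shows   "poly_multiplicity P f = a"
proof -
  have P0: "P \<noteq> 0" using assms(1) by (rule monic_irreducibles_nonzero)
  have f0: "f \<noteq> 0" using assms P0 by auto
  have "a \<le> poly_multiplicity P f"
    unfolding power_dvd_iff_le_multiplicity[OF assms(1) f0, symmetric] by (simp add: assms(2))
  moreover have "\<not> Suc a \<le> poly_multiplicity P f"
    unfolding power_dvd_iff_le_multiplicity[OF assms(1) f0, symmetric]
    using P0 assms(3) by (simp add: assms(2) mult.commute[of P])
  ultimately show ?thesis by simp
qed

lemma poly_multiplicity_decompose:
  fixes P :: "'a::{finite,field} poly"
  assumes "P \<in> monic_irreducibles" "f \<noteq> 0"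
  obtains g where "f = P ^ poly_multiplicity P f * g" "\<not> P dvd g"
proof -
  obtain g where g: "f = P ^ poly_multiplicity P f * g"
    using power_dvd_iff_le_multiplicity[OF assms, of "poly_multiplicity P f"] by auto
  have "\<not> P dvd g"
  proof
    assume "P dvd g"
    then obtain h where "g = P * h" by auto
    hence "f = P ^ Suc (poly_multiplicity P f) * h" by (subst g) (simp add: mult_ac)
    hence "P ^ Suc (poly_multiplicity P f) dvd f" by (metis dvd_triv_left)
    thus False unfolding power_dvd_iff_le_multiplicity[OF assms] by simp
  qed
  thus ?thesis using that g by blast
qed

lemma poly_multiplicity_mult:
  fixes P :: "'a::{finite,field} poly"
  assumes P: "P \<in> monic_irreducibles" and "f \<noteq> 0" "g \<noteq> 0"
  shows   "poly_multiplicity P (f * g) = poly_multiplicity P f + poly_multiplicity P g"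
proof -
  obtain f' where f: "f = P ^ poly_multiplicity P f * f'" "\<not> P dvd f'"
    using poly_multiplicity_decompose[OF assms(1,2)] .
  obtain g' where g: "g = P ^ poly_multiplicity P g * g'" "\<not> P dvd g'"
    using poly_multiplicity_decompose[OF assms(1,3)] .
  show ?thesis
  proof (rule poly_multiplicity_eqI[OF P])
    show "f * g = P ^ (poly_multiplicity P f + poly_multiplicity P g) * (f' * g')"
      by (subst f(1), subst g(1)) (simp add: power_add mult_ac)
    show "\<not> P dvd f' * g'" using f g monic_irreducibles_dvd_mult_iff[OF P] by blast
  qed
qed

lemma poly_multiplicity_eq_0:
  fixes P :: "'a::{finite,field} poly"
  assumes "P \<in> monic_irreducibles" "\<not> P dvd f"
  shows "poly_multiplicity P f = 0"
  by (rule poly_multiplicity_eqI[OF assms(1), of f 0 f]) (use assms in auto)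

lemma poly_multiplicity_irreducible:
  fixes P :: "'a::{finite,field} poly"
  assumes P: "P \<in> monic_irreducibles" and Q: "Q \<in> monic_irreducibles"
  shows "poly_multiplicity P Q = (if P = Q then 1 else 0)"
proof (cases "P = Q")
  case True
  thus ?thesis using monic_irreducibles_not_unit[OF P]
    using poly_multiplicity_eqI[OF P, of Q 1 1] by simp
qed (use poly_multiplicity_eq_0[OF P] monic_irreducibles_dvd_iff[OF P Q] in auto)

text \<open>The range \<open>{1..m}\<close> is the same for all \<open>f\<close> of degree at most
  \<open>m\<close>, which allows the sum over \<open>f\<close> and the sum over exponents to be
  interchanged later.\<close>

lemma poly_multiplicity_eq_card:
  fixes P :: "'a::{finite,field} poly"
  assumes "P \<in> monic_irreducibles" "f \<noteq> 0" "degree f \<le> m"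
  shows "poly_multiplicity P f = card {j \<in> {1..m}. P ^ j dvd f}"
proof -
  have "{j \<in> {1..m}. P ^ j dvd f} = {1..poly_multiplicity P f}"
    using poly_multiplicity_le_degree[OF assms(1,2)] assms(3)
    by (auto simp: power_dvd_iff_le_multiplicity[OF assms(1,2)])
  thus ?thesis by simp
qed

text \<open>Primes not dividing \<open>f\<close> contribute a factor with exponent 0. A larger index
  set \<open>T\<close> is allowed so that several polynomials can share one product.\<close>

lemma quadratic_char_eq_prod:
  fixes D f :: "'a::{finite,field} poly"
  assumes "finite T" "T \<subseteq> monic_irreducibles" "{P \<in> monic_irreducibles. P dvd f} \<subseteq> T"
  shows   "quadratic_char D f = (\<Prod>P\<in>T. quadratic_symbol D P ^ poly_multiplicity P f)"
  unfolding quadratic_char_def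
proof (rule prod.mono_neutral_left)
  show "{P \<in> monic_polys. irreducible P \<and> P dvd f} \<subseteq> T"
    using assms(3) by (auto simp: monic_irreducibles_def)
  show "\<forall>i\<in>T - {P \<in> monic_polys. irreducible P \<and> P dvd f}.
          quadratic_symbol D i ^ poly_multiplicity i f = 1"
  proof
    fix P assume "P \<in> T - {P \<in> monic_polys. irreducible P \<and> P dvd f}"
    hence "P \<in> monic_irreducibles" "\<not> P dvd f"
      using assms(2) by (auto simp: monic_irreducibles_def)
    thus "quadratic_symbol D P ^ poly_multiplicity P f = 1"
      by (simp add: poly_multiplicity_eq_0)
  qed
qed fact

lemma quadratic_char_mult:
  fixes D f g :: "'a::{finite,field} poly"
  assumes "f \<in> monic_polys" "g \<in> monic_polys"
  shows   "quadratic_char D (f * g) = quadratic_char D f * quadratic_char D g"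
proof -
  define T where "T = {P \<in> monic_irreducibles. P dvd f * g}"
  have 0: "f \<noteq> 0" "g \<noteq> 0" "f * g \<noteq> 0" using assms monic_polys_nonzero by auto
  have fin: "finite T" unfolding T_def by (rule finite_monic_irreducible_divisors[OF 0(3)])
  have "quadratic_char D h = (\<Prod>P\<in>T. quadratic_symbol D P ^ poly_multiplicity P h)"
    if "h dvd f * g" for h
    by (rule quadratic_char_eq_prod) (use that fin in \<open>auto simp: T_def intro: dvd_trans\<close>)
  hence *: "quadratic_char D f = (\<Prod>P\<in>T. quadratic_symbol D P ^ poly_multiplicity P f)"
    "quadratic_char D g = (\<Prod>P\<in>T. quadratic_symbol D P ^ poly_multiplicity P g)"
    "quadratic_char D (f * g) = (\<Prod>P\<in>T. quadratic_symbol D P ^ poly_multiplicity P (f * g))"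
    by auto
  show ?thesis
    unfolding * prod.distrib[symmetric]
    by (intro prod.cong refl) (auto simp: T_def poly_multiplicity_mult 0 power_add)
qed

lemma quadratic_char_1 [simp]: "quadratic_char D 1 = 1"
  using quadratic_char_eq_prod[of "{}" 1 D] monic_irreducibles_not_unit by auto

lemma quadratic_char_irreducible:
  assumes P: "P \<in> monic_irreducibles"
  shows "quadratic_char D P = quadratic_symbol D P"
proof -
  have "quadratic_char D P = (\<Prod>Q\<in>{P}. quadratic_symbol D Q ^ poly_multiplicity Q P)"
    by (rule quadratic_char_eq_prod) (use P monic_irreducibles_dvd_iff[OF _ P] in auto)
  thus ?thesis by (simp add: poly_multiplicity_irreducible[OF P P])
qed

lemma quadratic_char_abs_le: 
  assumes "f \<in> monic_polys" shows "\<bar>quadratic_char D f\<bar> \<le> 1"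
  using assms
proof (induction f rule: monic_polys_induct)
  case (mult p g)
  have "\<bar>quadratic_symbol D p\<bar> * \<bar>quadratic_char D g\<bar> \<le> 1 * 1"
    by (intro mult_mono) (use quadratic_symbol_range[of D p] mult in auto)
  thus ?case using mult
    by (simp add: quadratic_char_mult monic_irreducibles_monic quadratic_char_irreducible abs_mult)
qed auto

text \<open>The polynomial analogue of \<open>log = Lambda\<close> convolved with 1, which starts
  the recurrence for degree sums.\<close>

lemma degree_eq_sum_multiplicity:
  fixes f :: "'a::{finite,field} poly"
  assumes "f \<in> monic_polys" "finite T" "T \<subseteq> monic_irreducibles"
    "{P \<in> monic_irreducibles. P dvd f} \<subseteq> T"
  shows   "degree f = (\<Sum>P\<in>T. degree P * poly_multiplicity P f)"
  using assms(1,4)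
proof (induction f rule: monic_polys_induct)
  case one
  have "(\<Sum>P\<in>T. degree P * poly_multiplicity P 1) = (\<Sum>P\<in>T. 0)"
  proof (intro sum.cong refl)
    fix P assume "P \<in> T"
    hence "P \<in> monic_irreducibles" using assms(3) by blast
    hence "poly_multiplicity P 1 = 0"
      by (intro poly_multiplicity_eq_0 monic_irreducibles_not_unit)
    thus "degree P * poly_multiplicity P 1 = 0" by simp
  qed
  thus ?case by simp
next
  case (mult p g)
  have p: "p \<in> T" using mult by auto
  have 0: "p \<noteq> 0" "g \<noteq> 0" using mult by (auto simp: monic_irreducibles_nonzero monic_polys_nonzero)
  have "(\<Sum>P\<in>T. degree P * poly_multiplicity P (p * g)) =
        (\<Sum>P\<in>T. degree P * (if P = p then 1 else 0) + degree P * poly_multiplicity P g)"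
    using assms(3) mult 0
    by (intro sum.cong refl)
       (auto simp: poly_multiplicity_mult poly_multiplicity_irreducible subset_iff algebra_simps)
  also have "\<dots> = (\<Sum>P\<in>T. if P = p then degree p else 0) + (\<Sum>P\<in>T. degree P * poly_multiplicity P g)"
    by (subst sum.distrib, intro arg_cong2[of _ _ _ _ "(+)"] sum.cong refl) auto
  also have "(\<Sum>P\<in>T. degree P * poly_multiplicity P g) = degree g"
  proof (rule mult.IH[symmetric])
    show "{P \<in> monic_irreducibles. P dvd g} \<subseteq> T"
      using mult.prems dvd_mult[of _ g p] by blast
  qed
  also have "(\<Sum>P\<in>T. if P = p then degree p else 0) = degree p"
    using p assms(2) by (simp add: sum.delta)
  finally show ?case using 0 by (simp add: degree_mult_eq)
qed

text \<open>\<open>prime_power_sum \<psi> k\<close> is the sum of \<open>\<Lambda>(f) \<psi>(f)\<close> over monic \<open>f\<close> of degree \<open>k\<close>, where \<open>\<Lambda>\<close> is the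
  von Mangoldt function.\<close>

definition prime_power_sum :: "('a::{finite,field} poly \<Rightarrow> 'b::comm_ring_1) \<Rightarrow> nat \<Rightarrow> 'b" where
  "prime_power_sum \<psi> k =
     (\<Sum>P | P \<in> monic_irreducibles \<and> degree P dvd k. of_nat (degree P) * \<psi> P ^ (k div degree P))"

section \<open>The recurrence linking degree sums and prime power sums\<close>

definition degree_sum :: "('a::{finite,field} poly \<Rightarrow> 'b::comm_ring_1) \<Rightarrow> nat \<Rightarrow> 'b" where
  "degree_sum \<psi> m = (\<Sum>f\<in>monic_of_degree m. \<psi> f)"

lemma sum_multiples_of_power:
  fixes \<psi> :: "'a::{finite,field} poly \<Rightarrow> 'b::comm_ring_1"
  assumes \<psi>: "\<And>p g. p \<in> monic_irreducibles \<Longrightarrow> g \<in> monic_polys \<Longrightarrow> \<psi> (p * g) = \<psi> p * \<psi> g"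
  assumes P: "P \<in> monic_irreducibles"
  shows "(\<Sum>f\<in>{f \<in> monic_of_degree m. P ^ j dvd f}. \<psi> f) =
           (if j * degree P \<le> m then \<psi> P ^ j * degree_sum \<psi> (m - j * degree P) else 0)"
proof -
  have P0: "P \<noteq> 0" using P by (rule monic_irreducibles_nonzero)
  have Pm: "P ^ j \<in> monic_polys" using P by (intro monic_polys_power monic_irreducibles_monic)
  have deg: "degree (P ^ j * g) = j * degree P + degree g" if "g \<in> monic_polys" for g
    using that P0 monic_polys_nonzero[OF that] by (simp add: degree_mult_eq degree_power_eq)
  have pow: "\<psi> (P ^ j * g) = \<psi> P ^ j * \<psi> g" if "g \<in> monic_polys" for g
    using that
  proof (induction j)
    case (Suc j)
    have "P ^ j * g \<in> monic_polys" using Suc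
      by (intro monic_polys_mult monic_polys_power monic_irreducibles_monic[OF P])
    thus ?case using Suc \<psi>[OF P, of "P ^ j * g"] by (simp add: mult_ac)
  qed auto
  show ?thesis
  proof (cases "j * degree P \<le> m")
    case True
    have "{f. f \<in> monic_of_degree m \<and> P ^ j dvd f} = (\<lambda>g. P ^ j * g) ` monic_of_degree (m - j * degree P)"
    proof (intro equalityI subsetI)
      fix f assume "f \<in> {f. f \<in> monic_of_degree m \<and> P ^ j dvd f}"
      then obtain g where f: "f \<in> monic_of_degree m" "f = P ^ j * g" by auto
      have g: "g \<in> monic_polys"
        using f Pm monic_polys_multD by (auto simp: monic_of_degree_def)
      thus "f \<in> (\<lambda>g. P ^ j * g) ` monic_of_degree (m - j * degree P)"
        using f deg[OF g] by (auto simp: monic_of_degree_def)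
    next
      fix f assume "f \<in> (\<lambda>g. P ^ j * g) ` monic_of_degree (m - j * degree P)"
      thus "f \<in> {f. f \<in> monic_of_degree m \<and> P ^ j dvd f}"
        using True deg by (auto simp: monic_of_degree_def intro: monic_polys_mult Pm)
    qed
    moreover have "inj_on (\<lambda>g. P ^ j * g) A" for A using P0 by (auto intro: inj_onI)
    ultimately have "(\<Sum>f\<in>{f \<in> monic_of_degree m. P ^ j dvd f}. \<psi> f) =
        (\<Sum>g\<in>monic_of_degree (m - j * degree P). \<psi> (P ^ j * g))"
      by (simp add: sum.reindex)
    also have "\<dots> = (\<Sum>g\<in>monic_of_degree (m - j * degree P). \<psi> P ^ j * \<psi> g)"
      by (intro sum.cong refl pow) (auto simp: monic_of_degree_def)
    finally show ?thesis using True by (simp add: degree_sum_def sum_distrib_left)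
  next
    case False
    have "{f. f \<in> monic_of_degree m \<and> P ^ j dvd f} = {}"
    proof (rule ccontr)
      assume "{f. f \<in> monic_of_degree m \<and> P ^ j dvd f} \<noteq> {}"
      then obtain f where f: "f \<in> monic_of_degree m" "P ^ j dvd f" by auto
      hence "f \<noteq> 0" "degree f = m" by (auto simp: monic_of_degree_def monic_polys_nonzero)
      hence "degree (P ^ j) \<le> m" using f dvd_imp_degree_le by metis
      thus False using False P0 by (simp add: degree_power_eq)
    qed
    thus ?thesis using False by (simp only: sum.empty if_False)
  qed
qed

text \<open>This is \<open>u L'(u) = L(u) * (sum over k of p_k u^k)\<close> compared at
  \<open>u^m\<close>, with \<open>p_k\<close> the prime power sums. It is proved without power
  series: the factor \<open>m = deg f\<close> is the sum of \<open>deg P\<close> over all prime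
  powers \<open>P^j\<close> dividing \<open>f\<close>; dividing out \<open>P^j\<close> and setting
  \<open>k = j * degree P\<close> gives the right-hand side.\<close>

theorem degree_sum_recurrence:
  fixes \<psi> :: "'a::{finite,field} poly \<Rightarrow> 'b::comm_ring_1"
  assumes \<psi>: "\<And>p g. p \<in> monic_irreducibles \<Longrightarrow> g \<in> monic_polys \<Longrightarrow> \<psi> (p * g) = \<psi> p * \<psi> g"
  shows "of_nat m * degree_sum \<psi> m = (\<Sum>k=1..m. prime_power_sum \<psi> k * degree_sum \<psi> (m - k))"
proof -
  define T where "T = (monic_irreducibles_upto m :: 'a poly set)"
  have T: "finite T" "T \<subseteq> monic_irreducibles" unfolding T_def by (simp, auto simp: monic_irreducibles_upto_def)
  have deg: "of_nat m * \<psi> f = (\<Sum>P\<in>T. \<Sum>j=1..m. if P ^ j dvd f then of_nat (degree P) * \<psi> f else 0)"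
    if f: "f \<in> monic_of_degree m" for f
  proof -
    have f': "f \<in> monic_polys" "degree f = m" "f \<noteq> 0"
      using f by (auto simp: monic_of_degree_def monic_polys_nonzero)
    have "m = (\<Sum>P\<in>T. degree P * poly_multiplicity P f)"
      unfolding f'(2)[symmetric]
      by (rule degree_eq_sum_multiplicity[OF f'(1) T])
         (use f' in \<open>auto simp: T_def monic_irreducibles_upto_def dest: dvd_imp_degree_le\<close>)
    also have "\<dots> = (\<Sum>P\<in>T. degree P * card {j \<in> {1..m}. P ^ j dvd f})"
    proof (intro sum.cong refl)
      fix P assume "P \<in> T"
      hence "P \<in> monic_irreducibles" using T(2) by blast
      from poly_multiplicity_eq_card[OF this f'(3), of m] f'(2)
      show "degree P * poly_multiplicity P f = degree P * card {j \<in> {1..m}. P ^ j dvd f}" by simp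
    qed
    also have "\<dots> = (\<Sum>P\<in>T. \<Sum>j=1..m. if P ^ j dvd f then degree P else 0)"
    proof (intro sum.cong refl)
      fix P
      have "degree P * card {j \<in> {1..m}. P ^ j dvd f} = (\<Sum>j\<in>{j \<in> {1..m}. P ^ j dvd f}. degree P)"
        by (simp only: sum_constant of_nat_id mult.commute)
      also have "\<dots> = (\<Sum>j=1..m. if P ^ j dvd f then degree P else 0)"
        by (rule sum.inter_filter) simp
      finally show "degree P * card {j \<in> {1..m}. P ^ j dvd f} =
                      (\<Sum>j=1..m. if P ^ j dvd f then degree P else 0)" .
    qed
    finally have "of_nat m * \<psi> f = of_nat (\<Sum>P\<in>T. \<Sum>j=1..m. if P ^ j dvd f then degree P else 0) * \<psi> f"
      by (rule arg_cong)
    also have "\<dots> = (\<Sum>P\<in>T. \<Sum>j=1..m. of_nat (if P ^ j dvd f then degree P else 0) * \<psi> f)"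
      by (simp add: sum_distrib_right)
    also have "\<dots> = (\<Sum>P\<in>T. \<Sum>j=1..m. if P ^ j dvd f then of_nat (degree P) * \<psi> f else 0)"
      by (intro sum.cong refl) auto
    finally show ?thesis .
  qed
  have "of_nat m * degree_sum \<psi> m = (\<Sum>f\<in>monic_of_degree m.
          \<Sum>P\<in>T. \<Sum>j=1..m. if P ^ j dvd f then of_nat (degree P) * \<psi> f else 0)"
    unfolding degree_sum_def sum_distrib_left by (intro sum.cong refl deg)
  also have "\<dots> = (\<Sum>P\<in>T. \<Sum>j=1..m. \<Sum>f\<in>monic_of_degree m. if P ^ j dvd f then of_nat (degree P) * \<psi> f else 0)"
    by (subst sum.swap, rule sum.cong[OF refl], rule sum.swap)
  also have "\<dots> = (\<Sum>P\<in>T. \<Sum>j=1..m. of_nat (degree P) * (\<Sum>f\<in>{f \<in> monic_of_degree m. P ^ j dvd f}. \<psi> f))"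
    by (simp only: sum_distrib_left sum.inter_filter[OF finite_monic_of_degree]
          if_distrib[of "\<lambda>x. of_nat (degree _) * x"] mult_zero_right)
  also have "\<dots> = (\<Sum>P\<in>T. \<Sum>j=1..m. if j * degree P \<le> m then
       of_nat (degree P) * \<psi> P ^ j * degree_sum \<psi> (m - j * degree P) else 0)"
  proof (intro sum.cong refl)
    fix P j assume "P \<in> T"
    hence "P \<in> monic_irreducibles" using T(2) by blast
    from sum_multiples_of_power[OF \<psi> this, where m = m and j = j]
    show "of_nat (degree P) * (\<Sum>f\<in>{f \<in> monic_of_degree m. P ^ j dvd f}. \<psi> f) =
      (if j * degree P \<le> m then of_nat (degree P) * \<psi> P ^ j * degree_sum \<psi> (m - j * degree P) else 0)"
      by (simp add: mult.assoc)
  qed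
  also have "\<dots> = (\<Sum>P\<in>T. \<Sum>k=1..m. if degree P dvd k then
       of_nat (degree P) * \<psi> P ^ (k div degree P) * degree_sum \<psi> (m - k) else 0)"
  proof (rule sum.cong[OF refl])
    fix P assume "P \<in> T"
    hence pos: "degree P > 0" using T monic_irreducibles_degree_pos by auto
    let ?F = "\<lambda>k. of_nat (degree P) * \<psi> P ^ (k div degree P) * degree_sum \<psi> (m - k)"
    have "(\<Sum>j=1..m. if j * degree P \<le> m then
            of_nat (degree P) * \<psi> P ^ j * degree_sum \<psi> (m - j * degree P) else 0) =
          (\<Sum>j | j \<in> {1..m} \<and> j * degree P \<le> m. ?F (j * degree P))"
      using pos by (subst sum.inter_filter[symmetric]) auto
    also have "\<dots> = (\<Sum>k | k \<in> {1..m} \<and> degree P dvd k. ?F k)"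
    proof (rule sum.reindex_bij_witness[of _ "\<lambda>k. k div degree P" "\<lambda>j. j * degree P"])
      fix k assume "k \<in> {k \<in> {1..m}. degree P dvd k}"
      then obtain j where j: "k = degree P * j" "1 \<le> k" "k \<le> m" by auto
      have "j \<ge> 1" using j by (cases j) auto
      moreover have "1 * j \<le> degree P * j" using pos by (intro mult_le_mono) auto
      hence "j \<le> m" using j by linarith
      ultimately show "k div degree P \<in> {j \<in> {1..m}. j * degree P \<le> m}"
        using j pos by (auto simp: mult.commute)
    qed (use pos in auto)
    also have "\<dots> = (\<Sum>k=1..m. if degree P dvd k then ?F k else 0)"
      by (subst sum.inter_filter[symmetric]) auto
    finally show "(\<Sum>j=1..m. if j * degree P \<le> m then
            of_nat (degree P) * \<psi> P ^ j * degree_sum \<psi> (m - j * degree P) else 0) =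
       (\<Sum>k=1..m. if degree P dvd k then ?F k else 0)" .
  qed
  also have "\<dots> = (\<Sum>k=1..m. \<Sum>P\<in>T. if degree P dvd k then
       of_nat (degree P) * \<psi> P ^ (k div degree P) * degree_sum \<psi> (m - k) else 0)"
    by (rule sum.swap)
  also have "\<dots> = (\<Sum>k=1..m. prime_power_sum \<psi> k * degree_sum \<psi> (m - k))"
  proof (intro sum.cong refl)
    fix k assume k: "k \<in> {1..m}"
    have "{P \<in> T. degree P dvd k} = {P. P \<in> monic_irreducibles \<and> degree P dvd k}"
      using k by (auto simp: T_def monic_irreducibles_upto_def dest: dvd_imp_le)
    thus "(\<Sum>P\<in>T. if degree P dvd k then
       of_nat (degree P) * \<psi> P ^ (k div degree P) * degree_sum \<psi> (m - k) else 0) =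
       prime_power_sum \<psi> k * degree_sum \<psi> (m - k)"
      using T by (simp add: prime_power_sum_def sum_distrib_right flip: sum.inter_filter)
  qed
  finally show ?thesis .
qed

lemma finite_irreducibles_degree_dvd:
  assumes "k > 0" shows "finite {P \<in> monic_irreducibles. degree P dvd k}"
  by (rule finite_subset[OF _ finite_monic_irreducibles_upto[of k]])
     (use assms in \<open>auto simp: monic_irreducibles_upto_def dvd_imp_le\<close>)

text \<open>Comparing the recurrence for \<open>\<psi> = 1\<close> with \<open>m q\<^sup>m = \<Sum> q\<^sup>k q\<^sup>m\<^sup>-\<^sup>k\<close> determines the prime power sums.\<close>

theorem sum_degree_irreducibles:
  assumes "n > 0"
  shows "(\<Sum>P | P \<in> monic_irreducibles \<and> degree P dvd n. degree (P :: 'a::{finite,field} poly)) = CARD('a) ^ n"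
proof -
  define \<psi> where "\<psi> = (\<lambda>_::'a poly. 1::int)"
  have A: "degree_sum \<psi> m = int CARD('a) ^ m" for m
    by (simp add: degree_sum_def \<psi>_def card_monic_of_degree)
  have "prime_power_sum \<psi> n = int CARD('a) ^ n" if "n > 0" for n
    using that
  proof (induction n rule: less_induct)
    case (less n)
    have "of_nat n * degree_sum \<psi> n = (\<Sum>k=1..n. prime_power_sum \<psi> k * degree_sum \<psi> (n - k))"
      by (rule degree_sum_recurrence) (simp add: \<psi>_def)
    also have "{1..n} = insert n {1..<n}" using less.prems by auto
    also have "(\<Sum>k\<in>insert n {1..<n}. prime_power_sum \<psi> k * degree_sum \<psi> (n - k)) =
        prime_power_sum \<psi> n + (\<Sum>k\<in>{1..<n}. prime_power_sum \<psi> k * degree_sum \<psi> (n - k))"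
      by (simp add: A)
    also have "(\<Sum>k\<in>{1..<n}. prime_power_sum \<psi> k * degree_sum \<psi> (n - k)) = (\<Sum>k\<in>{1..<n}. int CARD('a) ^ n)"
      by (intro sum.cong refl) (simp add: less.IH A flip: power_add)
    also have "\<dots> = (int n - 1) * int CARD('a) ^ n" using less.prems by (simp add: of_nat_diff)
    finally show ?case by (simp add: A algebra_simps)
  qed
  from this[OF assms] have "int (\<Sum>P | P \<in> monic_irreducibles \<and> degree P dvd n. degree (P :: 'a poly)) = int (CARD('a) ^ n)"
    by (simp add: prime_power_sum_def \<psi>_def)
  thus ?thesis by (simp only: of_nat_eq_iff)
qed

text \<open>Only the terms with \<open>degree P = n\<close> are kept in the exact formula for the
  sum of degrees. This half of the prime number theorem bounds the variance later.\<close>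

lemma card_irreducibles_of_degree:
  "n * card {P \<in> monic_irreducibles. degree (P :: 'a::{finite,field} poly) = n} \<le> CARD('a) ^ n"
proof (cases "n = 0")
  case False
  have "n * card {P \<in> monic_irreducibles. degree (P :: 'a poly) = n} =
        (\<Sum>P | P \<in> monic_irreducibles \<and> degree (P :: 'a poly) = n. degree P)" by simp
  also have "\<dots> \<le> (\<Sum>P | P \<in> monic_irreducibles \<and> degree P dvd n. degree (P :: 'a poly))"
    using False by (intro sum_mono2 finite_irreducibles_degree_dvd) auto
  also have "\<dots> = CARD('a) ^ n" using False by (intro sum_degree_irreducibles) auto
  finally show ?thesis .
qed auto

section \<open>Reciprocity and the L-polynomial\<close>

lemma prod_irreducibles_dvd:
  fixes T :: "'a::{finite,field} poly set"
  assumes "finite T" "T \<subseteq> monic_irreducibles" "\<And>P. P \<in> T \<Longrightarrow> P dvd x"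
  shows   "\<Prod>T dvd x"
  using assms
proof (induction T rule: finite_induct)
  case (insert P T)
  then obtain y where y: "x = \<Prod>T * y" by auto
  have P: "P \<in> monic_irreducibles" using insert.prems by simp
  have "\<not> P dvd \<Prod>T"
  proof
    assume "P dvd \<Prod>T"
    then obtain R where "R \<in> T" "P dvd R"
      using monic_irreducibles_dvd_prod_iff[OF P insert.hyps(1), of "\<lambda>x. x"] by auto
    thus False using insert.hyps insert.prems monic_irreducibles_dvd_iff[OF P, of R] by auto
  qed
  hence "P dvd y" using y monic_irreducibles_dvd_mult_iff[OF P] insert.prems(2)[of P] by blast
  then obtain z where "y = P * z" by auto
  thus ?case using y insert.hyps by (simp add: mult_ac)
qed auto

lemma degree_prod_irreducibles:
  fixes T :: "'a::{finite,field} poly set"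
  assumes "T \<subseteq> monic_irreducibles"
  shows   "degree (\<Prod>T) = (\<Sum>P\<in>T. degree P)"
  using assms monic_irreducibles_nonzero by (intro degree_prod_sum_eq) auto

lemma prod_irreducibles_monic:
  "T \<subseteq> monic_irreducibles \<Longrightarrow> \<Prod>T \<in> monic_polys"
  by (rule monic_polys_prod) (auto simp: monic_irreducibles_monic subset_iff)

text \<open>The product \<open>g\<close> is periodic modulo \<open>M\<close>, the product of all
  \<open>P\<close> in \<open>T\<close>, and the condition on \<open>n\<close> makes the sum run over
  full periods. Multiplication by a unit \<open>c\<close> that is a nonresidue modulo
  \<open>P0\<close> and 1 modulo the other primes permutes the residues and changes the sign of
  \<open>g\<close>, because \<open>e P0\<close> is odd.\<close>

theorem character_sum_vanishes:
  fixes T :: "'a::{finite,field} poly set"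
  assumes odd: "odd CARD('a)" and T: "finite T" "T \<subseteq> monic_irreducibles"
    and P0: "P0 \<in> T" "odd (e P0)" and n: "(\<Sum>P\<in>T. degree P) \<le> n"
  shows   "(\<Sum>f\<in>monic_of_degree n. \<Prod>P\<in>T. quadratic_symbol f P ^ e P) = 0"
proof -
  define M where "M = \<Prod>T"
  define g where "g = (\<lambda>f. \<Prod>P\<in>T. quadratic_symbol f P ^ e P)"
  have MI: "P \<in> monic_irreducibles" if "P \<in> T" for P using that T(2) by blast
  have M: "M \<in> monic_polys" "degree M \<le> n"
    using prod_irreducibles_monic[OF T(2)] degree_prod_irreducibles[OF T(2)] n
    by (simp_all add: M_def)
  have M0: "M \<noteq> 0" using M monic_polys_nonzero by blast
  have dvdM: "P dvd M" if "P \<in> T" for P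
    using that T(1) unfolding M_def by (intro dvd_prodI[of T P "\<lambda>x. x"]) auto
  have g_mod: "g (f mod M) = g f" for f
    unfolding g_def
  proof (intro prod.cong refl arg_cong2[of _ _ _ _ "(^)"] quadratic_symbol_cong)
    fix P assume "P \<in> T"
    show "[f mod M = f] (mod P)"
      by (rule cong_dvd_modulus[OF _ dvdM[OF \<open>P \<in> T\<close>]]) simp
  qed
  have g_mult: "g (f * h) = g f * g h" for f h
    unfolding g_def prod.distrib[symmetric]
    by (intro prod.cong refl) (simp add: quadratic_symbol_mult[OF odd MI] power_mult_distrib)
  obtain v where v: "quadratic_symbol v P0 = -1"
    using exists_nonresidue[OF odd MI[OF P0(1)]] .
  \<comment> \<open>\<open>inverse_mod_exists\<close> solves congruences only for right-hand sides
    prime to \<open>P0\<close>.\<close>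
  have v1: "\<not> P0 dvd v - 1"
  proof
    assume "P0 dvd v - 1"
    hence "[v = 1] (mod P0)" by (simp add: cong_iff_dvd_diff)
    from quadratic_symbol_cong[OF this] v quadratic_symbol_1[OF MI[OF P0(1)]] show False by simp
  qed
  define M' where "M' = \<Prod>(T - {P0})"
  have "\<not> P0 dvd M'"
  proof
    assume "P0 dvd M'"
    then obtain R where "R \<in> T - {P0}" "P0 dvd R"
      using monic_irreducibles_dvd_prod_iff[OF MI[OF P0(1)], of "T - {P0}" "\<lambda>x. x"] T(1)
      by (auto simp: M'_def)
    thus False using monic_irreducibles_dvd_iff[OF MI[OF P0(1)], of R] MI by auto
  qed
  then obtain u where u: "[M' * u = v - 1] (mod P0)"
    using inverse_mod_exists[OF MI[OF P0(1)] _ v1] by metis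
  \<comment> \<open>An explicit Chinese remainder solution: \<open>c\<close> is 1 modulo every
    divisor of \<open>M'\<close> and congruent to the nonresidue \<open>v\<close> modulo
    \<open>P0\<close>.\<close>
  define c where "c = 1 + M' * u"
  have c0: "quadratic_symbol c P0 = -1"
  proof -
    have "[1 + M' * u = 1 + (v - 1)] (mod P0)" by (intro cong_add cong_refl u)
    hence "[c = v] (mod P0)" by (simp add: c_def)
    thus ?thesis using quadratic_symbol_cong v by metis
  qed
  have c1: "quadratic_symbol c P = 1" if P: "P \<in> T" "P \<noteq> P0" for P
  proof -
    have "P dvd M'" unfolding M'_def using P T(1) by (intro dvd_prodI[of "T - {P0}" P "\<lambda>x. x"]) auto
    hence "[c = 1] (mod P)" by (simp add: c_def cong_iff_dvd_diff)
    thus ?thesis using quadratic_symbol_cong quadratic_symbol_1[OF MI[OF P(1)]] by metis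
  qed
  have "g c = (\<Prod>P\<in>T. if P = P0 then (-1) ^ e P0 else 1)"
    unfolding g_def by (intro prod.cong refl) (auto simp: c0 c1)
  also have "\<dots> = -1" using P0 T(1) by (simp add: prod.delta)
  finally have gc: "g c = -1" .
  have c_ndvd: "\<not> P dvd c" if "P \<in> T" for P
    using c0 c1[OF that] quadratic_symbol_eq_0_iff[of c P] by (cases "P = P0") auto
  have inj: "inj_on (\<lambda>r. (c * r) mod M) (polys_below (degree M))"
  proof (rule inj_onI)
    fix r s assume rs: "r \<in> polys_below (degree M)" "s \<in> polys_below (degree M)"
      "(c * r) mod M = (c * s) mod M"
    from rs(3) have "M dvd c * (r - s)"
      by (simp add: mod_eq_dvd_iff algebra_simps)
    have "P dvd r - s" if "P \<in> T" for P
    proof -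
      have "P dvd c * (r - s)" using dvdM[OF that] \<open>M dvd c * (r - s)\<close> dvd_trans by blast
      thus ?thesis using c_ndvd[OF that] monic_irreducibles_dvd_mult_iff[OF MI[OF that]] by blast
    qed
    hence "M dvd r - s" unfolding M_def using T by (intro prod_irreducibles_dvd)
    hence "[r = s] (mod M)" by (simp add: cong_iff_dvd_diff)
    thus "r = s" using rs polys_below_cong_eq by blast
  qed
  have "(\<lambda>r. (c * r) mod M) ` polys_below (degree M) \<subseteq> polys_below (degree M)"
    by (intro image_subsetI mod_in_polys_below M0)
  hence bij: "bij_betw (\<lambda>r. (c * r) mod M) (polys_below (degree M)) (polys_below (degree M))"
    unfolding bij_betw_def using inj by (intro conjI endo_inj_surj) auto
  have "(\<Sum>r\<in>polys_below (degree M). g r) = (\<Sum>r\<in>polys_below (degree M). g ((c * r) mod M))"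
    by (rule sum.reindex_bij_betw[OF bij, symmetric])
  also have "\<dots> = - (\<Sum>r\<in>polys_below (degree M). g r)"
    by (simp add: g_mod g_mult gc sum_negf)
  finally have "(\<Sum>r\<in>polys_below (degree M). g r) = 0" by simp
  moreover have "(\<Sum>f\<in>monic_of_degree n. g f) = (\<Sum>f\<in>monic_of_degree n. g (f mod M))"
    by (simp add: g_mod)
  ultimately show ?thesis
    using sum_monic_of_degree_mod[OF M, of g] by (simp add: g_def)
qed

lemma squarefree_monic_eq_prod:
  fixes D :: "'a::{finite,field} poly"
  assumes "D \<in> monic_polys" "squarefree D"
  shows   "D = \<Prod>{P \<in> monic_irreducibles. P dvd D}"
proof -
  define T where "T = {P \<in> monic_irreducibles. P dvd D}"
  have D0: "D \<noteq> 0" using assms monic_polys_nonzero by blast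
  have T: "finite T" "T \<subseteq> monic_irreducibles"
    using finite_monic_irreducible_divisors[OF D0] by (auto simp: T_def)
  obtain R where R: "D = \<Prod>T * R"
    using prod_irreducibles_dvd[OF T, of D] by (auto simp: T_def)
  have Rm: "R \<in> monic_polys" using R assms monic_polys_multD prod_irreducibles_monic[OF T(2)] by metis
  have "degree R = 0"
  proof (rule ccontr)
    assume "degree R \<noteq> 0"
    then obtain P where P: "P \<in> monic_irreducibles" "P dvd R"
      using monic_irreducible_divisor_exists[OF Rm] by auto
    hence "P dvd D" using R by (metis dvd_mult)
    hence "P \<in> T" using P by (simp add: T_def)
    hence "P dvd \<Prod>T" using T by (intro dvd_prodI[of T P "\<lambda>x. x"]) auto
    hence "P ^ 2 dvd D" using P R by (auto simp: power2_eq_square intro: mult_dvd_mono)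
    thus False using assms P monic_irreducibles_not_unit squarefreeD by blast
  qed
  hence "R = 1" using Rm monic_of_degree_0 by (auto simp: monic_of_degree_def)
  thus ?thesis using R by (simp add: T_def)
qed


section \<open>Products of monic polynomials and quadratic reciprocity\<close>

definition monic_below :: "nat \<Rightarrow> 'a::{finite,field} poly set" where
  "monic_below n = (\<Union>i<n. monic_of_degree i)"

lemma monic_below_iff: "f \<in> monic_below n \<longleftrightarrow> f \<in> monic_polys \<and> degree f < n"
  by (auto simp: monic_below_def monic_of_degree_def)

lemma finite_monic_below [simp, intro]: "finite (monic_below n)"
  by (auto simp: monic_below_def)

lemma monic_below_subset: "monic_below n \<subseteq> polys_below n - {0}"
  by (auto simp: monic_below_iff polys_below_iff monic_polys_def)

lemma monic_of_degree_disjoint: "i \<noteq> j \<Longrightarrow> monic_of_degree i \<inter> monic_of_degree j = {}"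
  by (auto simp: monic_of_degree_def)

lemma card_monic_below: "card (monic_below n :: 'a::{finite,field} poly set) = (\<Sum>i<n. CARD('a) ^ i)"
  unfolding monic_below_def
  by (subst card_UN_disjoint) (simp_all add: card_monic_of_degree monic_of_degree_disjoint)

lemma geometric_sum_nat: "((q::nat) - 1) * (\<Sum>i<n. q ^ i) = q ^ n - 1"
proof (cases q)
  case (Suc r)
  have "r * (\<Sum>i<n. Suc r ^ i) + 1 = Suc r ^ n" by (induction n) (auto simp: algebra_simps)
  thus ?thesis using Suc by simp
qed (cases n, auto)

lemma minus_one_power_geometric_sum:
  assumes "odd q"
  shows "(-1 :: 'b::ring_1) ^ (\<Sum>i<n. q ^ i) = (-1) ^ n"
  using assms by (induction n) (auto simp: power_add)

text \<open>Wilson's theorem for the irreducible polynomial \<open>X\<close>, whose reduced residues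
  are the constants.\<close>

lemma prod_nonzero_constants:
  assumes odd: "odd CARD('a::{finite,field})"
  shows   "(\<Prod>c\<in>UNIV - {0::'a}. c) = -1"
proof -
  let ?X = "[:0, 1:] :: 'a poly"
  have X: "?X \<in> monic_irreducibles"
    by (simp add: monic_irreducibles_def monic_polys_def irreducible_linear_field_poly)
  have *: "polys_below (degree ?X) - {0} = (\<lambda>c. [:c:]) ` (UNIV - {0::'a})"
    by (auto simp: polys_below_iff image_iff elim!: degree_eq_zeroE) (metis Diff_iff UNIV_I singletonD)
  have "\<Prod>(polys_below (degree ?X) - {0}) = (\<Prod>c\<in>UNIV - {0::'a}. [:c:])"
    unfolding * by (subst prod.reindex) (auto simp: inj_on_def)
  also have "\<dots> = [:\<Prod>c\<in>UNIV - {0::'a}. c:]"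
    by (induction "UNIV - {0::'a}" rule: infinite_finite_induct) (simp_all add: prod_to_poly)
  finally have "[[:\<Prod>c\<in>UNIV - {0::'a}. c:] = [:-1:]] (mod ?X)"
    using wilson_monic_irreducible[OF odd X] by (simp add: one_pCons)
  hence "[:\<Prod>c\<in>UNIV - {0::'a}. c:] = [:-1:]"
    by (rule polys_below_cong_eq[rotated 2]) (auto simp: polys_below_iff)
  thus ?thesis by simp
qed

text \<open>Each nonzero residue is uniquely a constant times a monic polynomial. In Wilson's
  product the constants contribute -1 to the number of monics, which has the parity of
  \<open>degree P\<close>, and each monic occurs \<open>q - 1\<close> times.\<close>

lemma prod_monic_below_power:
  fixes P :: "'a::{finite,field} poly"
  assumes odd: "odd CARD('a)" and P: "P \<in> monic_irreducibles"
  shows   "[\<Prod>(monic_below (degree P)) ^ (CARD('a) - 1) = (-1) ^ (degree P + 1)] (mod P)"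
proof -
  define a where "a = degree P"
  define S where "S = (\<Sum>i<a. CARD('a) ^ i)"
  have "bij_betw (\<lambda>(c, f). smult c f) ((UNIV - {0::'a}) \<times> monic_below a) (polys_below a - {0})"
    unfolding bij_betw_def
  proof
    show "inj_on (\<lambda>(c, f). smult c f) ((UNIV - {0::'a}) \<times> monic_below a)"
    proof (rule inj_onI)
      fix x y assume xy: "x \<in> (UNIV - {0::'a}) \<times> monic_below a" "y \<in> (UNIV - {0::'a}) \<times> monic_below a"
        "(\<lambda>(c, f). smult c f) x = (\<lambda>(c, f). smult c f) y"
      obtain c f d g where [simp]: "x = (c, f)" "y = (d, g)" by (cases x, cases y)
      have *: "f \<in> monic_below a" "g \<in> monic_below a" "smult c f = smult d g" "c \<noteq> 0" "d \<noteq> 0"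
        using xy by auto
      have "lead_coeff (smult c f) = lead_coeff (smult d g)" using * by simp
      hence "c = d" using *(1,2,4,5) by (simp add: monic_below_iff monic_polys_def)
      moreover from this have "f = g"
        using arg_cong[OF *(3), of "smult (inverse d)"] *(5) by simp
      ultimately show "x = y" by simp
    qed
    show "(\<lambda>(c, f). smult c f) ` ((UNIV - {0::'a}) \<times> monic_below a) = polys_below a - {0}"
    proof (intro equalityI subsetI)
      fix f :: "'a poly" assume f: "f \<in> polys_below a - {0}"
      thus "f \<in> (\<lambda>(c, f). smult c f) ` ((UNIV - {0::'a}) \<times> monic_below a)"
        by (intro image_eqI[of _ _ "(lead_coeff f, smult (inverse (lead_coeff f)) f)"])
           (auto simp: monic_below_iff monic_polys_def polys_below_iff)
    qed (auto simp: monic_below_iff monic_polys_nonzero polys_below_iff)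
  qed
  hence "\<Prod>(polys_below a - {0}) = (\<Prod>(c, f)\<in>(UNIV - {0::'a}) \<times> monic_below a. smult c f)"
    by (subst prod.reindex_bij_betw[symmetric]) (auto simp: case_prod_unfold)
  also have "\<dots> = (\<Prod>c\<in>UNIV - {0::'a}. \<Prod>f\<in>monic_below a. smult c f)"
    by (rule prod.cartesian_product[symmetric])
  also have "\<dots> = smult (\<Prod>c\<in>UNIV - {0::'a}. c ^ S) (\<Prod>(monic_below a) ^ (CARD('a) - 1))"
    by (simp add: prod_smult S_def card_monic_below card_Diff_subset)
  also have "(\<Prod>c\<in>UNIV - {0::'a}. c ^ S) = (-1) ^ a"
    using prod_nonzero_constants[OF odd] minus_one_power_geometric_sum[OF odd, where n = a]
    by (simp add: S_def flip: prod_power_distrib)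
  also have "smult ((-1) ^ a) (\<Prod>(monic_below a) ^ (CARD('a) - 1)) =
               (-1) ^ a * \<Prod>(monic_below a :: 'a poly set) ^ (CARD('a) - 1)"
    by (cases "even a") auto
  finally have "[(-1) ^ a * \<Prod>(monic_below a) ^ (CARD('a) - 1) = -1] (mod P)"
    using wilson_monic_irreducible[OF odd P] by (simp add: a_def)
  from cong_mult[OF cong_refl[of "(-1) ^ a"] this]
  show ?thesis by (simp add: a_def flip: mult.assoc power_mult_distrib)
qed

text \<open>Division by \<open>P\<close> splits the set into \<open>q^(j - degree P)\<close>
  complete systems of nonzero residues. Each has product -1 by Wilson, and their number is
  odd.\<close>

lemma prod_monic_of_degree_not_dvd:
  fixes P :: "'a::{finite,field} poly"
  assumes odd: "odd CARD('a)" and P: "P \<in> monic_irreducibles" and j: "degree P \<le> j"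
  shows   "[\<Prod>{f \<in> monic_of_degree j. \<not> P dvd f} = -1] (mod P)"
proof -
  define H where "H = (monic_of_degree (j - degree P) :: 'a poly set)"
  define R where "R = polys_below (degree P) - {0 :: 'a poly}"
  have Pm: "P \<in> monic_polys" using P by (rule monic_irreducibles_monic)
  note bij = bij_betw_div_mod_monic[OF Pm j]
  have img: "(\<lambda>(h, r). h * P + r) ` (H \<times> R) = {f \<in> monic_of_degree j. \<not> P dvd f}"
  proof (intro equalityI subsetI)
    fix f assume "f \<in> (\<lambda>(h, r). h * P + r) ` (H \<times> R)"
    then obtain h r where hr: "f = h * P + r" "h \<in> H" "r \<in> R" by auto
    moreover have "\<not> P dvd r" using hr not_dvd_polys_below[OF P, of r] by (auto simp: R_def)
    moreover have "f \<in> monic_of_degree j"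
      using bij_betw_imp_surj_on[OF bij] hr by (force simp: R_def H_def)
    ultimately show "f \<in> {f \<in> monic_of_degree j. \<not> P dvd f}"
      by (auto simp: dvd_add_right_iff)
  next
    fix f assume "f \<in> {f \<in> monic_of_degree j. \<not> P dvd f}"
    moreover from this obtain h r where "f = h * P + r" "h \<in> H" "r \<in> polys_below (degree P)"
      using bij_betw_imp_surj_on[OF bij] by (force simp: H_def)
    ultimately show "f \<in> (\<lambda>(h, r). h * P + r) ` (H \<times> R)"
      by (intro image_eqI[of _ _ "(h, r)"]) (auto simp: R_def)
  qed
  have "inj_on (\<lambda>(h, r). h * P + r) (H \<times> R)"
    by (rule inj_on_subset[OF bij_betw_imp_inj_on[OF bij]]) (auto simp: H_def R_def)
  hence "\<Prod>{f \<in> monic_of_degree j. \<not> P dvd f} = (\<Prod>(h, r)\<in>H \<times> R. h * P + r)"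
    unfolding img[symmetric] by (subst prod.reindex) (auto simp: case_prod_unfold)
  also have "\<dots> = (\<Prod>h\<in>H. \<Prod>r\<in>R. h * P + r)" by (rule prod.cartesian_product[symmetric])
  also have "[\<dots> = (\<Prod>h\<in>H. \<Prod>r\<in>R. r)] (mod P)"
    by (intro cong_prod) (simp add: cong_iff_dvd_diff)
  also have "[(\<Prod>h\<in>H. \<Prod>r\<in>R. r) = (\<Prod>h\<in>H. -1)] (mod P)"
    using wilson_monic_irreducible[OF odd P] by (intro cong_prod) (simp add: R_def)
  also have "(\<Prod>h\<in>H. -1 :: 'a poly) = -1"
    using odd by (simp add: H_def card_monic_of_degree)
  finally show ?thesis .
qed

definition coprime_monics :: "'a::{finite,field} poly \<Rightarrow> 'a poly \<Rightarrow> 'a poly set" where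
  "coprime_monics P Q = {f \<in> monic_below (degree P + degree Q). \<not> P dvd f \<and> \<not> Q dvd f}"

text \<open>The monics of degree below \<open>degree P + degree Q\<close> prime to \<open>P\<close>
  are multiplied in two ways. By degree: those below \<open>degree P\<close>, then
  \<open>degree Q\<close> blocks of product -1 each. By divisibility:
  \<open>coprime_monics P Q\<close>, then the multiples \<open>Q * h\<close> with \<open>h\<close>
  of degree below \<open>degree P\<close>. The product over \<open>monic_below (degree P)\<close>
  cancels.\<close>

lemma prod_coprime_monics:
  fixes P Q :: "'a::{finite,field} poly"
  assumes odd: "odd CARD('a)" and P: "P \<in> monic_irreducibles" and Q: "Q \<in> monic_irreducibles"
    and PQ: "P \<noteq> Q"
  shows   "[\<Prod>(coprime_monics P Q) * Q ^ (\<Sum>i<degree P. CARD('a) ^ i) = (-1) ^ degree Q] (mod P)"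
proof -
  define a b where "a = degree P" and "b = degree Q"
  define W where "W = {f \<in> monic_below (a + b). \<not> P dvd f}"
  have MI: "\<not> P dvd f" if "f \<in> monic_below a" for f
    using that monic_below_subset[of a] not_dvd_polys_below[OF P, of f] by (auto simp: a_def)
  have W1: "W = monic_below a \<union> (\<Union>j\<in>{a..<a+b}. {f \<in> monic_of_degree j. \<not> P dvd f})"
    using MI by (auto simp: W_def monic_below_iff monic_of_degree_def)
  have "\<Prod>W = \<Prod>(monic_below a) * \<Prod>(\<Union>j\<in>{a..<a+b}. {f \<in> monic_of_degree j. \<not> P dvd f})"
    unfolding W1 by (rule prod.union_disjoint) (simp, simp, auto simp: monic_below_iff monic_of_degree_def)
  also have "\<Prod>(\<Union>j\<in>{a..<a+b}. {f \<in> monic_of_degree j. \<not> P dvd f}) =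
               (\<Prod>j\<in>{a..<a+b}. \<Prod>{f \<in> monic_of_degree j. \<not> P dvd f})"
  proof (rule prod.UNION_disjoint)
    have "finite {f \<in> monic_of_degree i. \<not> P dvd f}" for i by simp
    thus "\<forall>i\<in>{a..<a + b}. finite {f \<in> monic_of_degree i. \<not> P dvd f}" by blast
    show "\<forall>i\<in>{a..<a + b}. \<forall>j\<in>{a..<a + b}. i \<noteq> j \<longrightarrow>
       {f \<in> monic_of_degree i. \<not> P dvd f} \<inter> {f \<in> monic_of_degree j. \<not> P dvd f} = {}"
      by (auto simp: monic_of_degree_def)
  qed simp
  also have "[\<Prod>(monic_below a) * \<dots> = \<Prod>(monic_below a) * (\<Prod>j\<in>{a..<a+b}. -1)] (mod P)"
    by (intro cong_mult cong_prod prod_monic_of_degree_not_dvd[OF odd P]) (auto simp: a_def)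
  finally have eq1: "[\<Prod>W = \<Prod>(monic_below a) * (-1) ^ b] (mod P)" by simp
  have W2: "W = coprime_monics P Q \<union> (\<lambda>h. Q * h) ` monic_below a"
  proof (intro equalityI subsetI)
    fix f assume f: "f \<in> W"
    show "f \<in> coprime_monics P Q \<union> (\<lambda>h. Q * h) ` monic_below a"
    proof (cases "Q dvd f")
      case True
      then obtain h where h: "f = Q * h" by auto
      hence "h \<in> monic_polys"
        using f monic_irreducibles_monic[OF Q] monic_polys_multD by (auto simp: W_def monic_below_iff)
      moreover from this have "degree h < a"
        using f h monic_irreducibles_monic[OF Q]
        by (simp add: W_def monic_below_iff monic_polys_degree_mult b_def)
      ultimately show ?thesis using h by (auto simp: monic_below_iff)
    qed (use f in \<open>auto simp: W_def coprime_monics_def a_def b_def\<close>)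
  next
    fix f assume f: "f \<in> coprime_monics P Q \<union> (\<lambda>h. Q * h) ` monic_below a"
    show "f \<in> W"
    proof (cases "f \<in> coprime_monics P Q")
      case False
      then obtain h where h: "f = Q * h" "h \<in> monic_below a" using f by auto
      moreover have "\<not> P dvd f"
        using h MI PQ monic_irreducibles_dvd_iff[OF P Q] monic_irreducibles_dvd_mult_iff[OF P] by blast
      ultimately show ?thesis
        using monic_irreducibles_monic[OF Q]
        by (auto simp: W_def monic_below_iff monic_polys_degree_mult monic_polys_mult b_def)
    qed (auto simp: W_def coprime_monics_def a_def b_def)
  qed
  have "\<Prod>W = \<Prod>(coprime_monics P Q) * \<Prod>((\<lambda>h. Q * h) ` monic_below a)"
    unfolding W2 by (rule prod.union_disjoint) (auto simp: coprime_monics_def)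
  also have "\<Prod>((\<lambda>h. Q * h) ` monic_below a) = (\<Prod>h\<in>monic_below a. Q * h)"
    using monic_irreducibles_nonzero[OF Q] by (subst prod.reindex) (auto simp: inj_on_def)
  also have "\<dots> = Q ^ (\<Sum>i<a. CARD('a) ^ i) * \<Prod>(monic_below a)"
    by (simp add: prod.distrib card_monic_below)
  finally have "[\<Prod>(monic_below a) * (\<Prod>(coprime_monics P Q) * Q ^ (\<Sum>i<a. CARD('a) ^ i)) =
                  \<Prod>(monic_below a) * (-1) ^ b] (mod P)"
    using eq1 by (simp add: mult_ac)
  moreover have "\<not> P dvd \<Prod>(monic_below a)"
    using MI by (subst monic_irreducibles_dvd_prod_iff[OF P]) auto
  ultimately show ?thesis
    using cong_cancel_monic_irreducible[OF P] by (simp add: a_def b_def)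
qed

lemma bij_betw_crt:
  fixes P Q :: "'a::{finite,field} poly"
  assumes P: "P \<in> monic_irreducibles" and Q: "Q \<in> monic_irreducibles" and PQ: "P \<noteq> Q"
  shows   "bij_betw (\<lambda>f. (f mod P, f mod Q)) (polys_below (degree P + degree Q))
             (polys_below (degree P) \<times> polys_below (degree Q))"
proof -
  have 0: "P \<noteq> 0" "Q \<noteq> 0" using P Q monic_irreducibles_nonzero by auto
  have inj: "inj_on (\<lambda>f. (f mod P, f mod Q)) (polys_below (degree P + degree Q))"
  proof (rule inj_onI, clarify)
    fix f g assume *: "f \<in> polys_below (degree P + degree Q)" "g \<in> polys_below (degree P + degree Q)"
      "f mod P = g mod P" "f mod Q = g mod Q"
    have "P dvd f - g" "Q dvd f - g" using *(3,4) by (simp_all add: mod_eq_dvd_iff)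
    hence "\<Prod>{P, Q} dvd f - g" using P Q by (intro prod_irreducibles_dvd) auto
    hence "P * Q dvd f - g" using PQ by simp
    moreover have "f - g \<in> polys_below (degree (P * Q))"
      using * 0 by (intro polys_below_diff) (auto simp: degree_mult_eq)
    ultimately show "f = g"
      by (auto simp: polys_below_iff dest: dvd_imp_degree_le)
  qed
  have sub: "(\<lambda>f. (f mod P, f mod Q)) ` polys_below (degree P + degree Q) \<subseteq>
          polys_below (degree P) \<times> polys_below (degree Q)"
    using 0 by (auto intro: mod_in_polys_below)
  have "(\<lambda>f. (f mod P, f mod Q)) ` polys_below (degree P + degree Q) =
          polys_below (degree P) \<times> polys_below (degree Q)"
    by (rule card_subset_eq[OF _ sub])
       (simp_all add: card_image[OF inj] card_polys_below card_cartesian_product power_add)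
  thus ?thesis using inj by (simp add: bij_betw_def)
qed

definition crt_monics :: "'a::{finite,field} poly \<Rightarrow> 'a poly \<Rightarrow> 'a poly set" where
  "crt_monics P Q = {f \<in> polys_below (degree P + degree Q). f mod P \<in> monic_below (degree P) \<and> \<not> Q dvd f}"

text \<open>By the Chinese remainder theorem the set is a product of residues modulo
  \<open>P\<close> and residues modulo \<open>Q\<close>, so each residue of one factor is repeated
  as often as the other factor has elements.\<close>

lemma prod_crt_monics:
  fixes P Q :: "'a::{finite,field} poly"
  assumes P: "P \<in> monic_irreducibles" and Q: "Q \<in> monic_irreducibles" and PQ: "P \<noteq> Q"
  shows   "[\<Prod>(crt_monics P Q) = \<Prod>(monic_below (degree P)) ^ (CARD('a) ^ degree Q - 1)] (mod P)"
    and   "[\<Prod>(crt_monics P Q) =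
             \<Prod>(polys_below (degree Q) - {0}) ^ (\<Sum>i<degree P. CARD('a) ^ i)] (mod Q)"
proof -
  define X where "X = (monic_below (degree P) :: 'a poly set) \<times> (polys_below (degree Q) - {0 :: 'a poly})"
  have bij: "bij_betw (\<lambda>f. (f mod P, f mod Q)) (crt_monics P Q) X"
    unfolding bij_betw_def
  proof
    show "inj_on (\<lambda>f. (f mod P, f mod Q)) (crt_monics P Q)"
      by (rule inj_on_subset[OF bij_betw_imp_inj_on[OF bij_betw_crt[OF assms]]])
         (auto simp: crt_monics_def)
    have *: "\<exists>f\<in>polys_below (degree P + degree Q). x = (f mod P, f mod Q)" if "x \<in> X" for x
    proof -
      have "x \<in> (\<lambda>f. (f mod P, f mod Q)) ` polys_below (degree P + degree Q)"
        using that monic_below_subset[of "degree P"]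
        unfolding bij_betw_imp_surj_on[OF bij_betw_crt[OF assms]] X_def by auto
      thus ?thesis by auto
    qed
    show "(\<lambda>f. (f mod P, f mod Q)) ` crt_monics P Q = X"
    proof (intro equalityI subsetI)
      fix x assume "x \<in> (\<lambda>f. (f mod P, f mod Q)) ` crt_monics P Q"
      thus "x \<in> X" using monic_irreducibles_nonzero[OF Q]
        by (auto simp: X_def crt_monics_def mod_in_polys_below mod_eq_0_iff_dvd)
    next
      fix x assume x: "x \<in> X"
      with * obtain f where "f \<in> polys_below (degree P + degree Q)" "x = (f mod P, f mod Q)" by blast
      thus "x \<in> (\<lambda>f. (f mod P, f mod Q)) ` crt_monics P Q"
        using x by (intro image_eqI[of _ _ f]) (auto simp: X_def crt_monics_def mod_eq_0_iff_dvd)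
    qed
  qed
  have "[\<Prod>(crt_monics P Q) = (\<Prod>f\<in>crt_monics P Q. fst (f mod P, f mod Q))] (mod P)"
    by (intro cong_prod) auto
  also have "(\<Prod>f\<in>crt_monics P Q. fst (f mod P, f mod Q)) = (\<Prod>x\<in>X. fst x)"
    by (rule prod.reindex_bij_betw[OF bij])
  also have "\<dots> = (\<Prod>r\<in>monic_below (degree P). \<Prod>s\<in>polys_below (degree Q) - {0 :: 'a poly}. r)"
    unfolding X_def by (subst prod.cartesian_product) (simp add: case_prod_unfold)
  also have "\<dots> = \<Prod>(monic_below (degree P)) ^ (CARD('a) ^ degree Q - 1)"
    by (simp add: card_nonzero_residues prod_power_distrib)
  finally show "[\<Prod>(crt_monics P Q) = \<Prod>(monic_below (degree P)) ^ (CARD('a) ^ degree Q - 1)] (mod P)" .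
  have "[\<Prod>(crt_monics P Q) = (\<Prod>f\<in>crt_monics P Q. snd (f mod P, f mod Q))] (mod Q)"
    by (intro cong_prod) auto
  also have "(\<Prod>f\<in>crt_monics P Q. snd (f mod P, f mod Q)) = (\<Prod>x\<in>X. snd x)"
    by (rule prod.reindex_bij_betw[OF bij])
  also have "\<dots> = (\<Prod>r\<in>(monic_below (degree P) :: 'a poly set). \<Prod>s\<in>polys_below (degree Q) - {0}. s)"
    unfolding X_def by (subst prod.cartesian_product) (simp add: case_prod_unfold)
  also have "\<dots> = \<Prod>(polys_below (degree Q) - {0}) ^ (\<Sum>i<degree P. CARD('a) ^ i)"
    by (simp add: card_monic_below)
  finally show "[\<Prod>(crt_monics P Q) =
             \<Prod>(polys_below (degree Q) - {0}) ^ (\<Sum>i<degree P. CARD('a) ^ i)] (mod Q)" .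
qed

text \<open>Making each element monic is a bijection onto \<open>coprime_monics P Q\<close>, and
  \<open>c\<close> is the product of the leading coefficients removed. One and the same constant
  appears modulo \<open>P\<close> and modulo \<open>Q\<close>; this is what relates the two
  symbols.\<close>

lemma prod_crt_monics_eq_smult:
  fixes P Q :: "'a::{finite,field} poly"
  assumes P: "P \<in> monic_irreducibles" and Q: "Q \<in> monic_irreducibles"
  obtains c where "c \<noteq> 0" "\<Prod>(crt_monics P Q) = smult c (\<Prod>(coprime_monics P Q))"
proof -
  define \<phi> where "\<phi> = (\<lambda>f :: 'a poly. smult (inverse (lead_coeff f)) f)"
  have P0: "P \<noteq> 0" using P by (rule monic_irreducibles_nonzero)
  have V0: "f \<noteq> 0" if "f \<in> crt_monics P Q" for f using that by (auto simp: crt_monics_def)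
  have fin: "finite (crt_monics P Q)" by (simp add: crt_monics_def)
  have bij: "bij_betw \<phi> (crt_monics P Q) (coprime_monics P Q)"
    unfolding bij_betw_def
  proof
    show "inj_on \<phi> (crt_monics P Q)"
    proof (rule inj_onI)
      fix f g assume *: "f \<in> crt_monics P Q" "g \<in> crt_monics P Q" "\<phi> f = \<phi> g"
      define c where "c = lead_coeff f * inverse (lead_coeff g)"
      have "f = smult (lead_coeff f) (\<phi> f)" using V0[OF *(1)] by (simp add: \<phi>_def)
      also have "\<dots> = smult c g" by (simp add: *(3)) (simp add: \<phi>_def c_def)
      finally have fg: "f = smult c g" .
      hence "f mod P = smult c (g mod P)" by (simp add: mod_smult_left)
      hence "lead_coeff (f mod P) = c * lead_coeff (g mod P)" by simp
      hence "c = 1" using *(1,2) by (simp add: crt_monics_def monic_below_iff monic_polys_def)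
      thus "f = g" using fg by simp
    qed
    show "\<phi> ` crt_monics P Q = coprime_monics P Q"
    proof (intro equalityI subsetI)
      fix g assume "g \<in> \<phi> ` crt_monics P Q"
      then obtain f where f: "f \<in> crt_monics P Q" "g = \<phi> f" by auto
      have "f mod P \<noteq> 0" using f by (auto simp: crt_monics_def monic_below_iff monic_polys_nonzero)
      hence "\<not> P dvd f" by (simp add: mod_eq_0_iff_dvd)
      thus "g \<in> coprime_monics P Q"
        using f V0[OF f(1)]
        by (auto simp: coprime_monics_def crt_monics_def \<phi>_def monic_below_iff monic_polys_def
              polys_below_iff dvd_smult_iff)
    next
      fix g assume g: "g \<in> coprime_monics P Q"
      define c where "c = inverse (lead_coeff (g mod P))"
      have gP: "g mod P \<noteq> 0" using g by (simp add: coprime_monics_def mod_eq_0_iff_dvd)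
      hence c: "c \<noteq> 0" by (simp add: c_def)
      have "smult c g \<in> crt_monics P Q"
        using g c gP mod_in_polys_below[OF P0, of g]
        by (auto simp: crt_monics_def coprime_monics_def mod_smult_left polys_below_iff
            monic_below_iff monic_polys_def dvd_smult_iff c_def)
      moreover have "\<phi> (smult c g) = g"
        using g c by (simp add: \<phi>_def coprime_monics_def monic_below_iff monic_polys_def)
      ultimately show "g \<in> \<phi> ` crt_monics P Q" by (metis imageI)
    qed
  qed
  have "\<Prod>(crt_monics P Q) = (\<Prod>f\<in>crt_monics P Q. smult (lead_coeff f) (\<phi> f))"
    using V0 by (intro prod.cong refl) (simp add: \<phi>_def)
  also have "\<dots> = smult (\<Prod>f\<in>crt_monics P Q. lead_coeff f) (\<Prod>f\<in>crt_monics P Q. \<phi> f)"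
    by (rule prod_smult)
  also have "(\<Prod>f\<in>crt_monics P Q. \<phi> f) = \<Prod>(coprime_monics P Q)"
    by (rule prod.reindex_bij_betw[OF bij])
  finally show ?thesis
    using V0 fin by (intro that[of "\<Prod>f\<in>crt_monics P Q. lead_coeff f"]) (auto simp: prod_zero_iff)
qed

text \<open>Rousseau's proof: the units modulo \<open>P Q\<close> up to constants are represented both by the monic
  polynomials and by those whose residue modulo \<open>P\<close> is monic; compare the two products.\<close>

theorem quadratic_reciprocity_poly:
  fixes P Q :: "'a::{finite,field} poly"
  assumes odd: "odd CARD('a)" and P: "P \<in> monic_irreducibles" and Q: "Q \<in> monic_irreducibles"
    and PQ: "P \<noteq> Q"
  shows   "quadratic_symbol Q P =
             (-1) ^ (degree P * degree Q * ((CARD('a) - 1) div 2)) * quadratic_symbol P Q"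
proof -
  define a b H where "a = degree P" and "b = degree Q" and "H = (CARD('a) - 1) div 2"
  define \<sigma> where "\<sigma> = (\<lambda>n. \<Sum>i<n. CARD('a) ^ i)"
  define U where "U = \<Prod>(coprime_monics P Q)"
  have \<sigma>: "\<sigma> n * (CARD('a) - 1) = CARD('a) ^ n - 1" for n
    using geometric_sum_nat[of "CARD('a)" n] by (simp add: \<sigma>_def mult.commute)
  have H: "CARD('a) - 1 = 2 * H" using odd by (simp add: H_def)
  \<comment> \<open>The exponent in Euler's criterion. A congruence between \<open>c\<close> and a
    \<open>\<sigma>\<close>-th power of a prime therefore becomes a statement on symbols after
    raising it to the power \<open>H\<close>.\<close>
  have \<sigma>H: "(CARD('a) ^ n - 1) div 2 = \<sigma> n * H" for n
    using \<sigma>[of n, symmetric] unfolding H by simp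
  obtain c where c: "c \<noteq> 0" "\<Prod>(crt_monics P Q) = smult c U"
    using prod_crt_monics_eq_smult[OF P Q] unfolding U_def by blast
  have "coprime_monics P Q = coprime_monics Q P"
    by (auto simp: coprime_monics_def add.commute)
  hence U: "[U * Q ^ \<sigma> a = (-1) ^ b] (mod P)" "[U * P ^ \<sigma> b = (-1) ^ a] (mod Q)"
    using prod_coprime_monics[OF odd P Q PQ] prod_coprime_monics[OF odd Q P] PQ
    by (auto simp: U_def a_def b_def \<sigma>_def)
  have "[[:c:] * U = \<Prod>(monic_below a) ^ (CARD('a) ^ b - 1)] (mod P)"
    using prod_crt_monics(1)[OF P Q PQ] c by (simp add: a_def b_def)
  also have "\<Prod>(monic_below a) ^ (CARD('a) ^ b - 1) = (\<Prod>(monic_below a :: 'a poly set) ^ (CARD('a) - 1)) ^ \<sigma> b"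
    by (simp only: power_mult[symmetric] mult.commute[of "CARD('a) - 1"] \<sigma>)
  also have "[\<dots> = ((-1) ^ (a + 1)) ^ \<sigma> b] (mod P)"
    using prod_monic_below_power[OF odd P] unfolding a_def by (rule cong_pow)
  also have "((-1) ^ (a + 1)) ^ \<sigma> b = ((-1 :: 'a poly) ^ \<sigma> b) ^ (a + 1)"
    by (simp only: power_mult[symmetric] mult.commute)
  also have "(-1 :: 'a poly) ^ \<sigma> b = (-1) ^ b"
    unfolding \<sigma>_def by (rule minus_one_power_geometric_sum[OF odd])
  finally have cU: "[[:c:] * U = ((-1) ^ b) ^ (a + 1)] (mod P)" .
  have "[[:c:] * U = \<Prod>(polys_below b - {0}) ^ \<sigma> a] (mod Q)"
    using prod_crt_monics(2)[OF P Q PQ] c by (simp add: a_def b_def \<sigma>_def)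
  also have "[\<Prod>(polys_below b - {0}) ^ \<sigma> a = (-1) ^ \<sigma> a] (mod Q)"
    using wilson_monic_irreducible[OF odd Q] unfolding b_def by (rule cong_pow)
  also have "(-1 :: 'a poly) ^ \<sigma> a = (-1) ^ a"
    unfolding \<sigma>_def by (rule minus_one_power_geometric_sum[OF odd])
  finally have cU': "[[:c:] * U = (-1) ^ a] (mod Q)" .
  have sq: "((-1 :: 'a poly) ^ n) * (-1) ^ n = 1" for n by (simp flip: power_mult_distrib)
  \<comment> \<open>The unknown product \<open>U\<close> is eliminated: \<open>c * U\<close> is
    known from \<open>crt_monics\<close>, and \<open>U * Q ^ \<sigma> a\<close> from
    \<open>coprime_monics\<close>.\<close>
  have "[([:c:] * U) * Q ^ \<sigma> a * (-1) ^ b = ((-1) ^ b) ^ (a + 1) * Q ^ \<sigma> a * (-1) ^ b] (mod P)"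
    by (intro cong_mult cU cong_refl)
  moreover have "[[:c:] * (U * Q ^ \<sigma> a) * (-1) ^ b = [:c:] * (-1) ^ b * (-1) ^ b] (mod P)"
    by (intro cong_mult U cong_refl)
  ultimately have "[[:c:] = ((-1) ^ b) ^ a * Q ^ \<sigma> a] (mod P)"
    using sq[of b] by (simp add: mult_ac cong_def)
  hence "[[:c:] ^ H = (((-1) ^ b) ^ a * Q ^ \<sigma> a) ^ H] (mod P)" by (rule cong_pow)
  hence cP: "[[:c:] ^ H = (-1) ^ (a * b * H) * Q ^ (\<sigma> a * H)] (mod P)"
    by (simp add: power_mult_distrib mult_ac flip: power_mult)
  have "[([:c:] * U) * P ^ \<sigma> b * (-1) ^ a = (-1) ^ a * P ^ \<sigma> b * (-1) ^ a] (mod Q)"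
    by (intro cong_mult cU' cong_refl)
  moreover have "[[:c:] * (U * P ^ \<sigma> b) * (-1) ^ a = [:c:] * (-1) ^ a * (-1) ^ a] (mod Q)"
    by (intro cong_mult U cong_refl)
  ultimately have "[[:c:] = P ^ \<sigma> b] (mod Q)"
    using sq[of a] by (simp add: mult_ac cong_def)
  hence cQ: "[[:c:] ^ H = P ^ (\<sigma> b * H)] (mod Q)"
    using cong_pow[of "[:c:]" "P ^ \<sigma> b" Q H] by (simp flip: power_mult)
  have "[of_int (quadratic_symbol P Q) = [:c:] ^ H] (mod Q)"
    using euler_criterion_monic_irreducible[OF odd Q, of P] cQ \<sigma>H[of b] cong_sym cong_trans
    unfolding b_def by metis
  moreover have "[:c:] ^ H = [:c ^ H:]" by (induction H) (auto simp: one_pCons)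
  moreover have "degree Q > 0" using Q by (rule monic_irreducibles_degree_pos)
  hence "[:c ^ H:] \<in> polys_below (degree Q)" "(of_int (quadratic_symbol P Q) :: 'a poly) \<in> polys_below (degree Q)"
    using quadratic_symbol_range[of P Q] by (auto simp: polys_below_iff)
  \<comment> \<open>The power \<open>c^H\<close> is a constant, so its congruence modulo
    \<open>Q\<close> is an equality. It can then be inserted into the congruence modulo
    \<open>P\<close>.\<close>
  ultimately have c_eq: "[:c:] ^ H = of_int (quadratic_symbol P Q)"
    using polys_below_cong_eq[of "of_int (quadratic_symbol P Q)" Q "[:c ^ H:]"] by simp
  have "[of_int ((-1) ^ (a * b * H) * quadratic_symbol P Q) =
          (-1) ^ (a * b * H) * ((-1) ^ (a * b * H) * Q ^ (\<sigma> a * H))] (mod P)"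
    using cong_mult[OF cong_refl[of "(-1) ^ (a * b * H)"] cP] unfolding c_eq
    by (simp only: of_int_mult of_int_power of_int_minus of_int_1)
  hence "[of_int ((-1) ^ (a * b * H) * quadratic_symbol P Q) = Q ^ (\<sigma> a * H)] (mod P)"
    using sq[of "a * b * H"] by (simp flip: mult.assoc)
  hence "[of_int (quadratic_symbol Q P) = of_int ((-1) ^ (a * b * H) * quadratic_symbol P Q)] (mod P)"
    using euler_criterion_monic_irreducible[OF odd P, of Q] \<sigma>H[of a] cong_sym cong_trans
    unfolding a_def by metis
  moreover have "(-1) ^ (a * b * H) * quadratic_symbol P Q \<in> {-1, 0, 1}"
    using quadratic_symbol_range[of P Q] by (cases "even (a * b * H)") auto
  ultimately have "quadratic_symbol Q P = (-1) ^ (a * b * H) * quadratic_symbol P Q"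
    by (intro cong_of_int_sign[OF odd P quadratic_symbol_range])
  thus ?thesis by (simp add: a_def b_def H_def)
qed


section \<open>The L-polynomial in even degree\<close>

text \<open>Reciprocity at every prime of \<open>D\<close> produces the total sign with exponent
  \<open>degree p * degree D * H\<close>, which is even. Afterwards the modulus of the symbols is
  fixed and \<open>f\<close> is the variable.\<close>

lemma quadratic_char_eq_prod_flip:
  fixes D f :: "'a::{finite,field} poly"
  assumes odd: "odd CARD('a)" and D: "D \<in> monic_polys" "squarefree D" "even (degree D)"
    and f: "f \<in> monic_polys"
  shows   "quadratic_char D f = (\<Prod>P\<in>{P \<in> monic_irreducibles. P dvd D}. quadratic_symbol f P)"
proof -
  define T where "T = {P \<in> monic_irreducibles. P dvd D}"
  have D0: "D \<noteq> 0" using D monic_polys_nonzero by blast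
  have T: "finite T" "T \<subseteq> monic_irreducibles"
    using finite_monic_irreducible_divisors[OF D0] by (auto simp: T_def)
  have DT: "D = \<Prod>T" using squarefree_monic_eq_prod[OF D(1,2)] by (simp add: T_def)
  have degD: "degree D = (\<Sum>P\<in>T. degree P)" using degree_prod_irreducibles[OF T(2)] DT by simp
  have irr: "quadratic_symbol D p = (\<Prod>P\<in>T. quadratic_symbol p P)" if p: "p \<in> monic_irreducibles" for p
  proof (cases "p \<in> T")
    case True
    moreover from this have "p dvd D" by (simp add: T_def)
    moreover have "quadratic_symbol p p = 0" by (simp add: quadratic_symbol_eq_0_iff)
    moreover have "(\<Prod>P\<in>T. quadratic_symbol p P) = 0"
      by (rule prod_zero) (use T(1) calculation in auto)
    ultimately show ?thesis by (simp add: quadratic_symbol_eq_0_iff)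
  next
    case False
    define H where "H = (CARD('a) - 1) div 2"
    have "quadratic_symbol D p = (\<Prod>P\<in>T. quadratic_symbol P p)"
      by (subst DT) (rule quadratic_symbol_prod[OF odd p, of "\<lambda>x. x"])
    also have "\<dots> = (\<Prod>P\<in>T. (-1) ^ (degree p * degree P * H) * quadratic_symbol p P)"
    proof (rule prod.cong[OF refl])
      fix P assume "P \<in> T"
      hence "P \<in> monic_irreducibles" "p \<noteq> P" using T(2) False by auto
      thus "quadratic_symbol P p = (-1) ^ (degree p * degree P * H) * quadratic_symbol p P"
        using quadratic_reciprocity_poly[OF odd p, of P] by (simp add: H_def)
    qed
    also have "\<dots> = (\<Prod>P\<in>T. (-1) ^ (degree p * degree P * H)) * (\<Prod>P\<in>T. quadratic_symbol p P)"
      by (rule prod.distrib)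
    also have "(\<Prod>P\<in>T. (-1 :: int) ^ (degree p * degree P * H)) = (-1) ^ (degree p * degree D * H)"
      by (simp add: degD sum_distrib_left sum_distrib_right flip: power_sum)
    also have "\<dots> = 1" using D(3) by simp
    finally show ?thesis by simp
  qed
  have "quadratic_char D f = (\<Prod>P\<in>T. quadratic_symbol f P)"
    using f
  proof (induction f rule: monic_polys_induct)
    case one
    have "(\<Prod>P\<in>T. quadratic_symbol 1 P) = (\<Prod>P\<in>T. 1)"
      using T(2) by (intro prod.cong refl quadratic_symbol_1) auto
    thus ?case by simp
  next
    case (mult p g)
    have "(\<Prod>P\<in>T. quadratic_symbol (p * g) P) = (\<Prod>P\<in>T. quadratic_symbol p P * quadratic_symbol g P)"
      using T(2) by (intro prod.cong refl quadratic_symbol_mult[OF odd]) auto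
    thus ?case using mult
      by (simp add: prod.distrib quadratic_char_mult monic_irreducibles_monic
            quadratic_char_irreducible irr)
  qed
  thus ?thesis by (simp add: T_def)
qed

text \<open>After the flip this is a character sum with all exponents 1 over the primes of
  \<open>D\<close>, whose degrees add up to \<open>degree D\<close>. It is the reason why the series
  is a polynomial.\<close>

theorem degree_sum_quadratic_char_eq_0:
  fixes D :: "'a::{finite,field} poly"
  assumes odd: "odd CARD('a)" and D: "D \<in> monic_polys" "squarefree D" "even (degree D)" "degree D > 0"
    and m: "degree D \<le> m"
  shows   "degree_sum (quadratic_char D) m = 0"
proof -
  define T where "T = {P \<in> monic_irreducibles. P dvd D}"
  have D0: "D \<noteq> 0" using D monic_polys_nonzero by blast
  have T: "finite T" "T \<subseteq> monic_irreducibles"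
    using finite_monic_irreducible_divisors[OF D0] by (auto simp: T_def)
  have DT: "D = \<Prod>T" using squarefree_monic_eq_prod[OF D(1,2)] by (simp add: T_def)
  obtain P0 where "P0 \<in> T" using DT D(4) by fastforce
  moreover have "(\<Sum>P\<in>T. degree P) \<le> m" using degree_prod_irreducibles[OF T(2)] DT m by simp
  ultimately have "(\<Sum>f\<in>monic_of_degree m. \<Prod>P\<in>T. quadratic_symbol f P ^ 1) = 0"
    by (intro character_sum_vanishes[OF odd T]) auto
  moreover have "(\<Sum>f\<in>monic_of_degree m. \<Prod>P\<in>T. quadratic_symbol f P ^ 1) =
      (\<Sum>f\<in>monic_of_degree m. quadratic_char D f)"
    by (intro sum.cong refl)
       (simp add: quadratic_char_eq_prod_flip[OF odd D(1,2,3)] T_def monic_of_degree_def)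
  ultimately show ?thesis by (simp add: degree_sum_def)
qed

lemma sum_monic_of_degree_power:
  fixes x :: "'b::comm_ring_1"
  shows "(\<Sum>f\<in>(\<Union>i<n. monic_of_degree i). g f * x ^ degree f) =
           (\<Sum>i<n. (\<Sum>f\<in>monic_of_degree i. g f) * x ^ i)"
proof -
  have "(\<Sum>f\<in>(\<Union>i<n. monic_of_degree i). g f * x ^ degree f) =
        (\<Sum>i<n. \<Sum>f\<in>monic_of_degree i. g f * x ^ degree f)"
    by (rule sum.UNION_disjoint) (simp_all add: monic_of_degree_disjoint)
  also have "\<dots> = (\<Sum>i<n. \<Sum>f\<in>monic_of_degree i. g f * x ^ i)"
    by (intro sum.cong refl) (auto simp: monic_of_degree_def)
  finally show ?thesis by (simp add: sum_distrib_right)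
qed

lemma summable_on_monic_polys:
  fixes u :: complex and g :: "'a::{finite,field} poly \<Rightarrow> complex"
  assumes "norm u < 1 / real CARD('a)" "\<And>f. f \<in> monic_polys \<Longrightarrow> norm (g f) \<le> 1"
  shows   "(\<lambda>f. g f * u ^ degree f) summable_on monic_polys"
proof -
  define x where "x = real CARD('a) * norm u"
  have x: "0 \<le> x" "x < 1" using assms(1) by (auto simp: x_def field_simps)
  have "(\<lambda>f. norm (g f * u ^ degree f)) summable_on monic_polys"
  proof (rule nonneg_bdd_above_summable_on)
    show "bdd_above (sum (\<lambda>f. norm (g f * u ^ degree f)) ` {F. F \<subseteq> monic_polys \<and> finite F})"
    proof (rule bdd_aboveI2)
      fix F :: "'a poly set" assume F: "F \<in> {F. F \<subseteq> monic_polys \<and> finite F}"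
      define N where "N = Suc (Max (insert 0 (degree ` F)))"
      have "degree f < N" if "f \<in> F" for f
        using F that by (auto simp: N_def less_Suc_eq_le intro!: Max_ge)
      hence sub: "F \<subseteq> (\<Union>i<N. monic_of_degree i)"
        using F by (auto simp: monic_of_degree_def)
      have "(\<Sum>f\<in>F. norm (g f * u ^ degree f)) \<le> (\<Sum>f\<in>F. 1 * norm u ^ degree f)"
        using F unfolding norm_mult norm_power
        by (intro sum_mono mult_right_mono assms(2)) auto
      also have "\<dots> \<le> (\<Sum>f\<in>(\<Union>i<N. monic_of_degree i :: 'a poly set). 1 * norm u ^ degree f)"
        by (rule sum_mono2[OF _ sub]) auto
      also have "\<dots> = (\<Sum>i<N. x ^ i)"
        by (subst sum_monic_of_degree_power) (simp add: card_monic_of_degree x_def power_mult_distrib)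
      also have "\<dots> \<le> 1 / (1 - x)"
        using x by (simp add: sum_gp_strict divide_right_mono)
      finally show "(\<Sum>f\<in>F. norm (g f * u ^ degree f)) \<le> 1 / (1 - x)" .
    qed
  qed auto
  thus ?thesis by (rule abs_summable_summable)
qed

text \<open>Absolute convergence gives an unordered sum, whose value may be computed along the
  exhaustion of the monic polynomials by degree.\<close>

lemma has_sum_monic_polys:
  fixes u :: complex and g :: "'a::{finite,field} poly \<Rightarrow> complex"
  assumes "norm u < 1 / real CARD('a)" "\<And>f. f \<in> monic_polys \<Longrightarrow> norm (g f) \<le> 1"
    and "(\<lambda>i. (\<Sum>f\<in>monic_of_degree i. g f) * u ^ i) sums s"
  shows   "((\<lambda>f. g f * u ^ degree f) has_sum s) monic_polys"
proof -
  let ?F = "\<lambda>n. \<Union>i<n. monic_of_degree i :: 'a poly set"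
  define I where "I = infsum (\<lambda>f. g f * u ^ degree f) monic_polys"
  have I: "((\<lambda>f. g f * u ^ degree f) has_sum I) monic_polys"
    unfolding I_def using summable_on_monic_polys[OF assms(1,2)] by simp
  have "filterlim ?F (finite_subsets_at_top monic_polys) sequentially"
    unfolding filterlim_finite_subsets_at_top
  proof safe
    fix X :: "'a poly set" assume X: "finite X" "X \<subseteq> monic_polys"
    have "X \<subseteq> ?F n" if "n \<ge> Suc (Max (insert 0 (degree ` X)))" for n
    proof
      fix f assume "f \<in> X"
      hence "degree f \<le> Max (insert 0 (degree ` X))" using X by (intro Max_ge) auto
      hence "degree f < n" using that by linarith
      thus "f \<in> ?F n" using X \<open>f \<in> X\<close> by (auto simp: monic_of_degree_def)
    qed
    thus "\<forall>\<^sub>F n in sequentially. finite (?F n) \<and> X \<subseteq> ?F n \<and> ?F n \<subseteq> monic_polys"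
      by (intro eventually_sequentiallyI conjI) (simp, simp, auto simp: monic_of_degree_def)
  qed
  from filterlim_compose[OF I[unfolded has_sum_def] this]
  have "(\<lambda>n. \<Sum>f\<in>?F n. g f * u ^ degree f) \<longlonglongrightarrow> I" .
  hence "(\<lambda>n. \<Sum>i<n. (\<Sum>f\<in>monic_of_degree i. g f) * u ^ i) \<longlonglongrightarrow> I"
    by (simp add: sum_monic_of_degree_power)
  hence "I = s" using assms(3) unfolding sums_def by (rule LIMSEQ_unique)
  thus ?thesis using I by simp
qed

text \<open>Resolves the \<open>THE\<close> in \<open>L_poly\<close>. Existence is the vanishing of
  the degree sums from \<open>degree D\<close> on; uniqueness holds because two polynomials agreeing
  on a disc agree at infinitely many points.\<close>

theorem coeff_L_poly:
  fixes D :: "'a::{finite,field} poly"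
  assumes odd: "odd CARD('a)" and D: "D \<in> monic_polys" "squarefree D" "even (degree D)" "degree D > 0"
  shows   "coeff (L_poly D) m = of_int (degree_sum (quadratic_char D) m)"
proof -
  define A where "A = (\<lambda>m. degree_sum (quadratic_char D) m)"
  define p :: "complex poly" where "p = (\<Sum>i<degree D. monom (of_int (A i)) i)"
  have A0: "A m = 0" if "degree D \<le> m" for m
    unfolding A_def by (rule degree_sum_quadratic_char_eq_0[OF odd D that])
  have sum_p: "((\<lambda>f. of_int (quadratic_char D f) * u ^ degree f) has_sum poly p u) monic_polys"
    if u: "norm u < 1 / real CARD('a)" for u :: complex
  proof (rule has_sum_monic_polys[OF u])
    fix f :: "'a poly" assume "f \<in> monic_polys"
    from quadratic_char_abs_le[OF this, of D]
    have "of_int \<bar>quadratic_char D f\<bar> \<le> (1 :: real)" by linarith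
    thus "norm (of_int (quadratic_char D f) :: complex) \<le> 1" by simp
  next
    have "(\<lambda>i. of_int (A i) * u ^ i) sums (\<Sum>i<degree D. of_int (A i) * u ^ i)"
      by (rule sums_finite) (auto simp: A0)
    also have "(\<Sum>i<degree D. of_int (A i) * u ^ i) = poly p u"
      by (simp add: p_def poly_sum poly_monom)
    finally show "(\<lambda>i. (\<Sum>f\<in>monic_of_degree i. of_int (quadratic_char D f)) * u ^ i) sums poly p u"
      by (simp add: A_def degree_sum_def)
  qed
  have "L_poly D = p"
    unfolding L_poly_def
  proof (rule the_equality)
    fix r :: "complex poly"
    assume r: "\<forall>u. norm u < 1 / real CARD('a) \<longrightarrow>
      ((\<lambda>f. of_int (quadratic_char D f) * u ^ degree f) has_sum poly r u) monic_polys"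
    have "poly r u = poly p u" if "u \<in> ball 0 (1 / real CARD('a))" for u
    proof (rule has_sum_unique)
      show "((\<lambda>f. of_int (quadratic_char D f) * u ^ degree f) has_sum poly r u) monic_polys"
        using r that by auto
      show "((\<lambda>f. of_int (quadratic_char D f) * u ^ degree f) has_sum poly p u) monic_polys"
        using that by (intro sum_p) auto
    qed
    hence "ball 0 (1 / real CARD('a)) \<subseteq> {u. poly (r - p) u = 0}" by auto
    moreover have "infinite (ball (0::complex) (1 / real CARD('a)))"
      by (intro uncountable_infinite uncountable_ball) simp
    ultimately have "infinite {u. poly (r - p) u = 0}" using finite_subset by blast
    thus "r = p" using poly_roots_finite[of "r - p"] by auto
  qed (use sum_p in blast)
  hence "coeff (L_poly D) m = (\<Sum>i<degree D. if i = m then of_int (A i) else 0)"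
    by (simp add: p_def coeff_sum)
  also have "\<dots> = of_int (A m)" using A0[of m] by (auto simp: sum.delta)
  finally show ?thesis by (simp add: A_def)
qed

section \<open>Stepanov's method and the Riemann hypothesis\<close>

lemma fermat_constant:
  fixes c :: "'a::{finite,field}"
  shows "c ^ CARD('a) = c"
proof -
  let ?X = "[:0, 1:] :: 'a poly"
  have X: "?X \<in> monic_irreducibles"
    by (simp add: monic_irreducibles_def monic_polys_def irreducible_linear_field_poly)
  have pow: "[:c:] ^ n = [:c ^ n:]" for n by (induction n) (auto simp: one_pCons)
  have "[[:c:] ^ (CARD('a) ^ degree ?X) = [:c:]] (mod ?X)" by (rule fermat_monic_irreducible'[OF X])
  hence "[[:c ^ CARD('a):] = [:c:]] (mod ?X)" by (simp add: pow)
  hence "[:c ^ CARD('a):] = [:c:]"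
    by (rule polys_below_cong_eq[rotated 2]) (auto simp: polys_below_iff)
  thus ?thesis by simp
qed

text \<open>\<open>(X + 1)\<^sup>q - X\<^sup>q - 1\<close> has degree less than \<open>q\<close> and vanishes on the whole field.\<close>

lemma of_nat_choose_card_eq_0:
  assumes "0 < i" "i < CARD('a::{finite,field})"
  shows   "of_nat (CARD('a) choose i) = (0 :: 'a)"
proof -
  define q where "q = CARD('a)"
  define p :: "'a poly" where "p = [:1, 1:] ^ q - monom 1 q - 1"
  have q: "q > 0" using assms by (simp add: q_def)
  have "coeff p j = 0" if "j \<ge> q" for j
  proof (cases "j = q")
    case True
    thus ?thesis using q coeff_linear_poly_power[of q q 1 "1::'a"] by (simp add: p_def)
  next
    case False
    hence "j > q" using that by simp
    moreover have "degree ([:1, 1::'a:] ^ q) \<le> q" using degree_power_le[of "[:1,1::'a:]" q] by simp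
    ultimately show ?thesis by (simp add: p_def coeff_eq_0)
  qed
  hence "p \<in> polys_below q" by (simp add: polys_below_def)
  have "poly p x = 0" for x
  proof -
    have "poly p x = (x + 1) ^ q - x ^ q - 1" by (simp add: p_def poly_monom add.commute)
    thus ?thesis by (simp add: q_def fermat_constant)
  qed
  hence roots: "{x. poly p x = 0} = UNIV" by auto
  have "p = 0"
  proof (rule ccontr)
    assume "p \<noteq> 0"
    hence "q \<le> degree p" using card_poly_roots_bound[of p] roots by (simp add: q_def)
    thus False using \<open>p \<in> polys_below q\<close> \<open>p \<noteq> 0\<close> by (auto simp: polys_below_iff)
  qed
  hence "coeff p i = 0" by simp
  moreover have "coeff p i = of_nat (q choose i)"
    using assms coeff_linear_poly_power[of i q 1 "1::'a"] by (simp add: p_def q_def)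
  ultimately show ?thesis by (simp add: q_def)
qed

lemma frobenius_add:
  fixes f g :: "'a::{finite,field} poly"
  shows "(f + g) ^ CARD('a) = f ^ CARD('a) + g ^ CARD('a)"
proof -
  have "(f + g) ^ CARD('a) = (\<Sum>k\<le>CARD('a). of_nat (CARD('a) choose k) * f ^ k * g ^ (CARD('a) - k))"
    by (rule binomial_ring)
  also have "\<dots> = (\<Sum>k\<in>{0, CARD('a)}. of_nat (CARD('a) choose k) * f ^ k * g ^ (CARD('a) - k))"
  proof (intro sum.mono_neutral_right ballI)
    fix k assume "k \<in> {..CARD('a)} - {0, CARD('a)}"
    hence "of_nat (CARD('a) choose k) = (0 :: 'a)" by (intro of_nat_choose_card_eq_0) auto
    hence "of_nat (CARD('a) choose k) = (0 :: 'a poly)" by (simp add: of_nat_poly)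
    thus "of_nat (CARD('a) choose k) * f ^ k * g ^ (CARD('a) - k) = 0" by simp
  qed auto
  also have "\<dots> = f ^ CARD('a) + g ^ CARD('a)" by (simp add: add.commute)
  finally show ?thesis .
qed

lemma frobenius_power_add:
  fixes f g :: "'a::{finite,field} poly"
  shows "(f + g) ^ (CARD('a) ^ e) = f ^ (CARD('a) ^ e) + g ^ (CARD('a) ^ e)"
  by (induction e) (simp_all add: power_mult mult.commute[of "CARD('a)"] frobenius_add)

lemma frobenius_power_diff:
  fixes f g :: "'a::{finite,field} poly"
  shows "(f - g) ^ (CARD('a) ^ e) = f ^ (CARD('a) ^ e) - g ^ (CARD('a) ^ e)"
  using frobenius_power_add[of "f - g" g e] by (simp add: algebra_simps)

lemma frobenius_power_sum:
  fixes f :: "'b \<Rightarrow> 'a::{finite,field} poly"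
  shows "sum f A ^ (CARD('a) ^ e) = (\<Sum>x\<in>A. f x ^ (CARD('a) ^ e))"
  by (induction A rule: infinite_finite_induct) (simp_all add: frobenius_power_add)

text \<open>The coefficients are fixed by the Frobenius map. In Stepanov's method this reads the
  large power \<open>D^r\<close> as \<open>D\<close> evaluated at the second variable
  \<open>X^r\<close>.\<close>

lemma frobenius_eq_pcompose:
  fixes D :: "'a::{finite,field} poly"
  shows "D ^ (CARD('a) ^ e) = pcompose D (monom 1 (CARD('a) ^ e))"
proof (induction D)
  case (pCons c D)
  have pow: "[:c:] ^ n = [:c ^ n:]" for n by (induction n) (auto simp: one_pCons)
  have c: "c ^ (CARD('a) ^ e) = c"
    by (induction e) (simp_all add: power_mult mult.commute[of "CARD('a)"] fermat_constant)
  have "pCons c D = [:c:] + monom 1 1 * D" by (simp add: monom_altdef)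
  hence "pCons c D ^ (CARD('a) ^ e) = [:c:] ^ (CARD('a) ^ e) + (monom 1 1 * D) ^ (CARD('a) ^ e)"
    by (simp only: frobenius_power_add)
  also have "\<dots> = [:c:] + monom 1 (CARD('a) ^ e) * pcompose D (monom 1 (CARD('a) ^ e))"
    by (simp add: pow c power_mult_distrib monom_power pCons)
  finally show ?case by (simp add: pcompose_pCons)
qed simp

text \<open>An expansion in base \<open>X^r\<close> is unique when the digits have degree below
  \<open>r\<close>. Under this bound \<open>X\<close> and \<open>X^r\<close> behave like independent
  variables.\<close>

lemma poly_at_large_power_eq_0:
  fixes E :: "'a::{finite,field} poly poly"
  assumes "\<And>i. coeff E i \<in> polys_below r" "poly E (monom 1 r) = 0"
  shows   "E = 0"
  using assms
proof (induction E)
  case (pCons c E)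
  have c: "c \<in> polys_below r" using pCons.prems(1)[of 0] by simp
  have E: "coeff E i \<in> polys_below r" for i using pCons.prems(1)[of "Suc i"] by simp
  have eq: "c + monom 1 r * poly E (monom 1 r) = 0" using pCons.prems(2) by simp
  have "coeff c i = 0" for i
  proof (cases "i < r")
    case True
    have "coeff (c + monom 1 r * poly E (monom 1 r)) i = 0" using eq by simp
    thus ?thesis using True by (simp add: coeff_monom_mult)
  qed (use c in \<open>auto simp: polys_below_def\<close>)
  hence "c = 0" by (simp add: poly_eq_iff)
  hence "poly E (monom 1 r) = 0" using eq by simp
  thus ?case using pCons.IH[OF E] \<open>c = 0\<close> by simp
qed simp

lemma polys_below_mult:
  "f \<in> polys_below (Suc m) \<Longrightarrow> g \<in> polys_below (Suc n) \<Longrightarrow> f * g \<in> polys_below (Suc (m + n))"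
  using degree_mult_le[of f g] by (auto simp: polys_below_iff)

lemma coeff_mult_polys_below:
  fixes F G :: "'a::{finite,field} poly poly"
  assumes "\<And>i. coeff F i \<in> polys_below (Suc m)" "\<And>i. coeff G i \<in> polys_below (Suc n)"
  shows   "coeff (F * G) i \<in> polys_below (Suc (m + n))"
  unfolding coeff_mult by (intro polys_below_sum polys_below_mult assms)

text \<open>The hypothesis says that \<open>D(x) \<hat>D(Z)\<close> has odd valuation at \<open>P(x)\<close>, so it is no square.\<close>

lemma square_odd_valuation_imp_0:
  fixes B C F :: "'a::{finite,field} poly poly"
  assumes P: "P \<in> monic_irreducibles" "\<not> P dvd D1" and F: "\<not> [:P:] dvd F"
    and eq: "B ^ 2 = [:P * D1:] * F * C ^ 2"
  shows   "B = 0"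
  using eq
proof (induction "degree (lead_coeff B)" arbitrary: B C rule: less_induct)
  case less
  have prime: "prime_elem [:P:]"
    using monic_irreducibles_prime_elem[OF P(1)] by (simp add: prime_elem_const_poly_iff)
  have P0: "[:P:] \<noteq> 0" using prime by auto
  have ndvd: "\<not> [:P:] dvd [:D1:]" using P(2) by simp
  have fac: "[:P * D1:] = [:P:] * [:D1:]" by simp
  have "[:P:] dvd B ^ 2" unfolding less.prems fac by (simp only: mult.assoc dvd_triv_left)
  hence "[:P:] dvd B" using prime by (rule_tac prime_elem_dvd_power)
  then obtain B' where B': "B = [:P:] * B'" by auto
  have "[:P:] * ([:P:] * B' ^ 2) = [:P:] * ([:D1:] * F * C ^ 2)"
    using less.prems unfolding B' fac by (simp only: power2_eq_square mult_ac)
  hence eq1: "[:P:] * B' ^ 2 = [:D1:] * F * C ^ 2" unfolding mult_left_cancel[OF P0] .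
  hence "[:P:] dvd [:D1:] * F * C ^ 2" by (metis dvd_triv_left)
  hence "[:P:] dvd C ^ 2" using ndvd F by (simp only: prime_elem_dvd_mult_iff[OF prime] simp_thms)
  hence "[:P:] dvd C" using prime by (rule_tac prime_elem_dvd_power)
  then obtain C' where C': "C = [:P:] * C'" by auto
  have "[:P:] * B' ^ 2 = [:P:] * ([:P * D1:] * F * C' ^ 2)"
    using eq1 unfolding C' fac by (simp only: power2_eq_square mult_ac)
  hence eq2: "B' ^ 2 = [:P * D1:] * F * C' ^ 2" unfolding mult_left_cancel[OF P0] .
  show ?case
  proof (rule ccontr)
    assume "B \<noteq> 0"
    hence B'0: "B' \<noteq> 0" using B' by auto
    have "lead_coeff B = P * lead_coeff B'" unfolding B' by (simp add: lead_coeff_mult)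
    hence "degree (lead_coeff B') < degree (lead_coeff B)"
      using B'0 monic_irreducibles_degree_pos[OF P(1)] monic_irreducibles_nonzero[OF P(1)]
      by (simp add: degree_mult_eq)
    from less.hyps[OF this eq2] B'0 show False by simp
  qed
qed

section \<open>Stepanov's auxiliary polynomial\<close>

text \<open>With \<open>r = q^e\<close>, the roots of these \<open>P\<close> are the elements
  \<open>x\<close> of the field with \<open>r^2\<close> elements at which \<open>D(x)\<close> to the
  power \<open>(r^2 - 1) / 2\<close> equals \<open>s\<close>. The sum of the degrees counts
  them.\<close>

definition stepanov_primes :: "'a::{finite,field} poly \<Rightarrow> nat \<Rightarrow> 'a poly \<Rightarrow> 'a poly set" where
  "stepanov_primes D e s =
     {P \<in> monic_irreducibles. degree P dvd 2 * e \<and> [D ^ ((CARD('a) ^ (2 * e) - 1) div 2) = s] (mod P)}"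

lemma finite_stepanov_primes: "e > 0 \<Longrightarrow> finite (stepanov_primes D e s)"
  by (rule finite_subset[OF _ finite_irreducibles_degree_dvd[of "2 * e"]])
     (auto simp: stepanov_primes_def)

lemma degree_power_le':
  "degree f \<le> n \<Longrightarrow> degree (f ^ k) \<le> n * k"
  using degree_power_le[of f k] by (meson le_trans mult_le_mono1)

text \<open>The \<open>r\<close>-th power map is additive, so the condition is additive in the
  unknowns \<open>b j\<close>, \<open>c j\<close>, and two choices with the same image give a
  nontrivial solution by subtraction. The relation is the one that arises from taking the
  \<open>r\<close>-th power of the auxiliary polynomial at a root of \<open>P\<close>.\<close>

lemma stepanov_relation_exists:
  fixes D s :: "'a::{finite,field} poly"
  assumes deg: "degree D = 2 * d" "d > 0" and r: "CARD('a) ^ e = 4 * d + 2 * w + 1" and s: "degree s = 0"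
  obtains b c :: "nat \<Rightarrow> 'a poly"
  where "\<And>j. j < 4 * d + w \<Longrightarrow> b j \<in> polys_below (Suc (d + w))"
    "\<And>j. j < 4 * d + w \<Longrightarrow> c j \<in> polys_below (Suc (d + w))"
    "\<exists>j<4 * d + w. b j \<noteq> 0 \<or> c j \<noteq> 0"
    "(\<Sum>j<4 * d + w. (b j ^ (CARD('a) ^ e) + s * c j ^ (CARD('a) ^ e) * D ^ (2 * d + w + 1)) * monom 1 1 ^ j) = 0"
proof -
  define q where "q = CARD('a)"
  define r where "r = CARD('a) ^ e"
  define l where "l = Suc (d + w)"
  define m where "m = 4 * d + w"
  define h where "h = 2 * d + w + 1"
  define T where "T = (d + w) * r + 2 * d * h + m"
  have r_eq: "r = 4 * d + 2 * w + 1" using assms(3) by (simp add: r_def)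
  define \<Phi> where "\<Phi> = (\<lambda>(b, c). \<Sum>j<m. (b j ^ r + s * c j ^ r * D ^ h) * monom (1::'a) 1 ^ j)"
  define X where "X = (PiE {..<m} (\<lambda>_. polys_below l :: 'a poly set)) \<times> (PiE {..<m} (\<lambda>_. polys_below l :: 'a poly set))"
  have m0: "m > 0" using deg by (simp add: m_def)
  have sub: "\<Phi> ` X \<subseteq> polys_below T"
  proof safe
    fix b c :: "nat \<Rightarrow> 'a poly" assume bc: "(b, c) \<in> X"
    have "(b j ^ r + s * c j ^ r * D ^ h) * monom 1 1 ^ j \<in> polys_below T" if j: "j < m" for j
    proof -
      have "b j \<in> polys_below l" "c j \<in> polys_below l" using bc j by (auto simp: X_def)
      hence deg_bc: "degree (b j) \<le> d + w" "degree (c j) \<le> d + w" by (auto simp: polys_below_iff l_def)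
      have 1: "degree (b j ^ r) \<le> (d + w) * r" "degree (c j ^ r) \<le> (d + w) * r"
        using deg_bc by (auto intro: degree_power_le')
      have 2: "degree (D ^ h) \<le> 2 * d * h" using deg by (intro degree_power_le') auto
      have "degree (s * c j ^ r * D ^ h) \<le> degree s + degree (c j ^ r) + degree (D ^ h)"
        using degree_mult_le[of s "c j ^ r"] degree_mult_le[of "s * c j ^ r" "D ^ h"] by linarith
      hence "degree (s * c j ^ r * D ^ h) \<le> (d + w) * r + 2 * d * h" using 1 2 s by linarith
      hence "degree (b j ^ r + s * c j ^ r * D ^ h) \<le> (d + w) * r + 2 * d * h"
        using 1 by (intro degree_add_le) auto
      moreover have "degree (monom (1::'a) 1 ^ j) = j" by (simp add: monom_power degree_monom_eq)
      ultimately have "degree ((b j ^ r + s * c j ^ r * D ^ h) * monom 1 1 ^ j) < T"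
        using degree_mult_le[of "b j ^ r + s * c j ^ r * D ^ h" "monom 1 1 ^ j"] j
        unfolding T_def by linarith
      thus ?thesis by (simp add: polys_below_iff)
    qed
    thus "\<Phi> (b, c) \<in> polys_below T" by (auto simp: \<Phi>_def intro!: polys_below_sum)
  qed
  have fin: "finite X" by (auto simp: X_def intro!: finite_PiE)
  have "2 * l * m = l * m + l * m" by simp
  hence cardX: "card X = q ^ (2 * l * m)"
    by (simp only: X_def card_cartesian_product card_PiE[OF finite_lessThan] card_polys_below q_def
          prod_constant card_lessThan power_mult power_add)
  have q1: "q > 1"
  proof -
    have "card {0, 1 :: 'a} \<le> CARD('a)" by (intro card_mono) auto
    thus ?thesis by (simp add: q_def)
  qed
  \<comment> \<open>The pigeonhole count: the unknowns have \<open>2 * l * m\<close> free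
    coefficients, the image has fewer than \<open>T + 1\<close>, and the surplus
    \<open>d * (2 * w + 1)\<close> is positive.\<close>
  have "T + d * (2 * w + 1) = 2 * l * m"
    unfolding T_def r_eq l_def m_def h_def by (simp add: algebra_simps)
  hence "T < 2 * l * m" using deg(2) by (metis less_add_same_cancel1 nat_0_less_mult_iff add_gr_0 zero_less_one)
  hence "card (polys_below T :: 'a poly set) < card X"
    using q1 unfolding cardX card_polys_below q_def[symmetric] by (intro power_strict_increasing)
  hence "\<not> inj_on \<Phi> X"
    using card_inj_on_le[OF _ sub finite_polys_below] by (meson leD)
  then obtain b1 c1 b2 c2 where *: "(b1, c1) \<in> X" "(b2, c2) \<in> X" "\<Phi> (b1, c1) = \<Phi> (b2, c2)"
    "(b1, c1) \<noteq> (b2, c2)"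
    unfolding inj_on_def by (metis surj_pair)
  show ?thesis
  proof (rule that[of "\<lambda>j. b1 j - b2 j" "\<lambda>j. c1 j - c2 j"])
    show "b1 j - b2 j \<in> polys_below (Suc (d + w))" "c1 j - c2 j \<in> polys_below (Suc (d + w))"
      if "j < 4 * d + w" for j
      using *(1,2) that by (auto simp: X_def m_def l_def PiE_iff intro!: polys_below_diff)
    show "\<exists>j<4 * d + w. b1 j - b2 j \<noteq> 0 \<or> c1 j - c2 j \<noteq> 0"
    proof (rule ccontr)
      assume "\<not> ?thesis"
      hence eq: "b1 j = b2 j" "c1 j = c2 j" if "j \<in> {..<m}" for j using that by (auto simp: m_def)
      have mem: "b1 \<in> {..<m} \<rightarrow>\<^sub>E polys_below l" "b2 \<in> {..<m} \<rightarrow>\<^sub>E polys_below l"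
        "c1 \<in> {..<m} \<rightarrow>\<^sub>E polys_below l" "c2 \<in> {..<m} \<rightarrow>\<^sub>E polys_below l"
        using *(1,2) by (simp_all add: X_def)
      have "b1 = b2" "c1 = c2"
        by (rule PiE_ext[OF mem(1,2) eq(1)], assumption, rule PiE_ext[OF mem(3,4) eq(2)])
      thus False using *(4) by simp
    qed
    have "(\<Sum>j<m. ((b1 j - b2 j) ^ r + s * (c1 j - c2 j) ^ r * D ^ h) * monom 1 1 ^ j) =
            \<Phi> (b1, c1) - \<Phi> (b2, c2)"
      unfolding \<Phi>_def prod.case sum_subtractf[symmetric]
    proof (rule sum.cong[OF refl])
      fix j
      have alg: "((u1 - u2) + s * (v1 - v2) * E) * y = (u1 + s * v1 * E) * y - (u2 + s * v2 * E) * y"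
        for u1 u2 v1 v2 E y :: "'a poly" by (simp add: algebra_simps)
      show "((b1 j - b2 j) ^ r + s * (c1 j - c2 j) ^ r * D ^ h) * monom 1 1 ^ j =
          (b1 j ^ r + s * c1 j ^ r * D ^ h) * monom 1 1 ^ j - (b2 j ^ r + s * c2 j ^ r * D ^ h) * monom 1 1 ^ j"
        unfolding r_def frobenius_power_diff by (rule alg)
    qed
    thus "(\<Sum>j<4 * d + w. ((b1 j - b2 j) ^ (CARD('a) ^ e) + s * (c1 j - c2 j) ^ (CARD('a) ^ e) *
        D ^ (2 * d + w + 1)) * monom 1 1 ^ j) = 0"
      using *(3) by (simp add: r_def m_def h_def)
  qed
qed

text \<open>The auxiliary polynomial \<open>H\<close> vanishes at all roots counted by
  \<open>stepanov_primes\<close>: the relation gives \<open>H^r\<close> congruent to 0 modulo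
  \<open>P\<close>. So the count is at most \<open>degree H\<close>, about half of
  \<open>r^2\<close>. The delicate point is \<open>H\<close> being nonzero although the relation
  kills its \<open>r\<close>-th power modulo each \<open>P\<close>.\<close>

theorem stepanov_bound:
  fixes D s :: "'a::{finite,field} poly"
  assumes D: "D \<in> monic_polys" "squarefree D" and deg: "degree D = 2 * d" "d > 0"
    and r: "CARD('a) ^ e = 4 * d + 2 * w + 1" and s: "s = 1 \<or> s = -1"
  shows   "2 * (\<Sum>P\<in>stepanov_primes D e s. degree P) \<le>
             (CARD('a) ^ e) ^ 2 + 6 * d * CARD('a) ^ e"
proof -
  define r where "r = CARD('a) ^ e"
  define m where "m = 4 * d + w"
  define h where "h = 2 * d + w + 1"
  have r_eq: "r = 4 * d + 2 * w + 1" using assms(5) by (simp add: r_def)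
  have e: "e > 0" using r_eq deg by (cases e) (auto simp: r_def)
  have s0: "degree s = 0" using s by auto
  obtain b c where b: "\<And>j. j < m \<Longrightarrow> b j \<in> polys_below (Suc (d + w))"
    and c: "\<And>j. j < m \<Longrightarrow> c j \<in> polys_below (Suc (d + w))"
    and nz: "\<exists>j<m. b j \<noteq> 0 \<or> c j \<noteq> 0"
    and rel: "(\<Sum>j<m. (b j ^ r + s * c j ^ r * D ^ h) * monom 1 1 ^ j) = 0"
    by (rule stepanov_relation_exists[OF deg assms(5) s0, folded r_def m_def h_def]) (rule that)
  define H where "H = (\<Sum>j<m. (b j + c j * D ^ h) * monom 1 r ^ j)"
  have MI: "stepanov_primes D e s \<subseteq> monic_irreducibles" by (auto simp: stepanov_primes_def)
  have "P dvd H" if P: "P \<in> stepanov_primes D e s" for P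
  proof -
    have PM: "P \<in> monic_irreducibles" using P MI by blast
    have "CARD('a) ^ (2 * e) = r * r" by (simp add: r_def mult_2 power_add)
    hence mon: "[monom 1 1 ^ (r * r) = monom (1::'a) 1] (mod P)"
      using fermat_monic_irreducible_iterated[OF PM, of "2 * e" "monom 1 1"] P
      by (simp add: stepanov_primes_def)
    \<comment> \<open>This is why \<open>h = (r + 1) / 2\<close>: the powers \<open>D^(h r)\<close>
      and \<open>D^h\<close> differ by the factor \<open>D\<close> to the
      \<open>(r^2 - 1) / 2\<close>, which is \<open>s\<close> modulo \<open>P\<close>.\<close>
    have "2 * ((r * r - 1) div 2 + h) = 2 * (h * r)"
      unfolding r_eq h_def by (simp add: algebra_simps)
    hence hr: "h * r = (r * r - 1) div 2 + h" by simp
    have "[D ^ ((r * r - 1) div 2) * D ^ h = s * D ^ h] (mod P)"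
      using P \<open>CARD('a) ^ (2 * e) = r * r\<close> by (intro cong_mult cong_refl) (simp add: stepanov_primes_def)
    hence Dh: "[D ^ (h * r) = s * D ^ h] (mod P)" by (simp add: hr power_add)
    have "H ^ r = (\<Sum>j<m. (b j ^ r + c j ^ r * D ^ (h * r)) * (monom 1 1 ^ (r * r)) ^ j)"
    proof -
      have "H ^ r = (\<Sum>j<m. ((b j + c j * D ^ h) * monom 1 r ^ j) ^ r)"
        unfolding H_def r_def by (rule frobenius_power_sum)
      also have "\<dots> = (\<Sum>j<m. (b j ^ r + c j ^ r * D ^ (h * r)) * (monom 1 1 ^ (r * r)) ^ j)"
        unfolding power_mult_distrib
        by (simp add: r_def frobenius_power_add power_mult_distrib monom_power mult_ac flip: power_mult)
      finally show ?thesis .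
    qed
    also have "[\<dots> = (\<Sum>j<m. (b j ^ r + c j ^ r * (s * D ^ h)) * monom 1 1 ^ j)] (mod P)"
      by (intro cong_sum cong_mult cong_add cong_pow cong_refl Dh mon)
    also have "(\<Sum>j<m. (b j ^ r + c j ^ r * (s * D ^ h)) * monom 1 1 ^ j) = 0"
      using rel by (simp add: mult_ac)
    finally have "P dvd H ^ r" by (simp add: cong_0_iff)
    thus ?thesis using monic_irreducibles_dvd_power[OF PM] by blast
  qed
  hence dvd: "\<Prod>(stepanov_primes D e s) dvd H"
    using MI finite_stepanov_primes[OF e] by (intro prod_irreducibles_dvd) auto
  have "H \<noteq> 0"
  proof
    assume "H = 0"
    define x :: "'a poly" where "x = monom 1 r"
    define B where "B = (\<Sum>j<m. monom (b j) j)"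
    define C where "C = (\<Sum>j<m. monom (c j) j)"
    define F where "F = map_poly (\<lambda>a. [:a:]) D"
    have coeffB: "coeff B j = (if j < m then b j else 0)" for j
      by (simp add: B_def coeff_sum sum.delta)
    have coeffC: "coeff C j = (if j < m then c j else 0)" for j
      by (simp add: C_def coeff_sum sum.delta)
    have pB: "poly B x = (\<Sum>j<m. b j * x ^ j)" and pC: "poly C x = (\<Sum>j<m. c j * x ^ j)"
      by (simp_all add: B_def C_def poly_sum poly_monom)
    have pF: "poly F x = D ^ r"
      by (simp add: F_def x_def r_def frobenius_eq_pcompose pcompose_altdef)
    have "poly B x + D ^ h * poly C x = H"
      unfolding pB pC H_def x_def[symmetric]
      by (simp add: sum_distrib_left algebra_simps sum.distrib)
    hence "poly B x = - (D ^ h * poly C x)" using \<open>H = 0\<close> by (simp add: eq_neg_iff_add_eq_0)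
    hence "poly B x ^ 2 = D ^ (2 * h) * poly C x ^ 2"
      by (simp add: power_mult_distrib mult.commute flip: power_mult)
    \<comment> \<open>Squaring leaves \<open>D * D^r\<close>, and \<open>D^r\<close> is
      \<open>D\<close> at \<open>X^r\<close>. The high power of \<open>D\<close> is thus replaced by
      coefficients of small degree in the first variable.\<close>
    also have "2 * h = r + 1" by (simp add: h_def r_eq)
    finally have "poly (B ^ 2 - [:D:] * F * C ^ 2) x = 0" by (simp add: pF)
    moreover have "coeff (B ^ 2 - [:D:] * F * C ^ 2) i \<in> polys_below r" for i
    proof -
      have B': "coeff B i \<in> polys_below (Suc (d + w))" and C': "coeff C i \<in> polys_below (Suc (d + w))" for i
        using b c by (auto simp: coeffB coeffC)
      have D': "coeff [:D:] i \<in> polys_below (Suc (2 * d))" for i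
        using deg by (auto simp: coeff_pCons polys_below_iff split: nat.splits)
      have F': "coeff F i \<in> polys_below (Suc 0)" for i
        by (simp add: F_def coeff_map_poly polys_below_iff)
      have "coeff (B ^ 2) i \<in> polys_below (Suc ((d + w) + (d + w)))"
        unfolding power2_eq_square by (intro coeff_mult_polys_below B')
      \<comment> \<open>The degree in the first variable is at most
        \<open>2 d + 2 (d + w) = r - 1\<close>, just below \<open>r\<close>, so the identity at
        \<open>X^r\<close> lifts to two variables. There it contradicts the parity of the valuation
        at a prime of \<open>D\<close>.\<close>
      moreover have "coeff ([:D:] * F * C ^ 2) i \<in> polys_below (Suc ((2 * d + 0) + ((d + w) + (d + w))))"
        unfolding power2_eq_square by (intro coeff_mult_polys_below B' C' D' F')
      ultimately show ?thesis
        unfolding coeff_diff r_eq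
        by (intro polys_below_diff) (auto elim!: polys_below_mono)
    qed
    ultimately have "B ^ 2 - [:D:] * F * C ^ 2 = 0"
      unfolding x_def by (intro poly_at_large_power_eq_0[of _ r])
    hence eq: "B ^ 2 = [:D:] * F * C ^ 2" by simp
    obtain P where P: "P \<in> monic_irreducibles" "P dvd D"
      using monic_irreducible_divisor_exists[OF D(1)] deg by auto
    then obtain D1 where D1: "D = P * D1" by auto
    have "\<not> P dvd D1"
    proof
      assume "P dvd D1"
      hence "P ^ 2 dvd D" by (auto simp: D1 power2_eq_square)
      thus False using D(2) squarefreeD monic_irreducibles_not_unit[OF P(1)] by blast
    qed
    moreover have "\<not> [:P:] dvd F"
    proof
      assume "[:P:] dvd F"
      hence "P dvd coeff F (degree D)" by (simp add: const_poly_dvd_iff)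
      hence "P dvd 1" using D(1) by (simp add: F_def coeff_map_poly monic_polys_def one_pCons)
      thus False using monic_irreducibles_not_unit[OF P(1)] by blast
    qed
    ultimately have B0: "B = 0"
      using eq P(1) square_odd_valuation_imp_0[of P D1 F B C] unfolding D1 by blast
    have "D \<noteq> 0" using D(1) monic_polys_nonzero by blast
    moreover have "F \<noteq> 0" using \<open>\<not> [:P:] dvd F\<close> by auto
    ultimately have "C = 0" using eq B0 by simp
    have "b j = 0 \<and> c j = 0" if "j < m" for j
      using coeffB[of j] coeffC[of j] B0 \<open>C = 0\<close> that by simp
    thus False using nz by blast
  qed
  have "degree ((b j + c j * D ^ h) * monom 1 r ^ j) \<le> (d + w) + 2 * d * h + m * r" if j: "j < m" for j
  proof -
    have 1: "degree (b j) \<le> d + w" "degree (c j) \<le> d + w"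
      using b[OF j] c[OF j] by (auto simp: polys_below_iff)
    have 2: "degree (D ^ h) \<le> 2 * d * h" using deg by (intro degree_power_le') auto
    have "degree (c j * D ^ h) \<le> (d + w) + 2 * d * h"
      using degree_mult_le[of "c j" "D ^ h"] 1 2 by linarith
    hence "degree (b j + c j * D ^ h) \<le> (d + w) + 2 * d * h"
      using 1 by (intro degree_add_le) auto
    moreover have "degree (monom (1::'a) r ^ j) \<le> m * r"
      using j by (simp add: monom_power degree_monom_eq)
    ultimately show ?thesis
      using degree_mult_le[of "b j + c j * D ^ h" "monom 1 r ^ j"] by linarith
  qed
  hence "degree H \<le> (d + w) + 2 * d * h + m * r"
    unfolding H_def by (intro degree_sum_le) auto
  moreover have "(\<Sum>P\<in>stepanov_primes D e s. degree P) \<le> degree H"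
    using dvd_imp_degree_le[OF dvd \<open>H \<noteq> 0\<close>] degree_prod_irreducibles[OF MI] by simp
  moreover have "2 * ((d + w) + 2 * d * h + m * r) + 1 = r ^ 2 + 6 * d * r"
    unfolding h_def m_def r_eq by (simp add: algebra_simps power2_eq_square)
  moreover have "2 * s \<le> z" if "x \<le> y" "s \<le> x" "2 * y + 1 = z" for x y z s :: nat
    using that by linarith
  ultimately show ?thesis unfolding r_def[symmetric] by blast
qed


text \<open>The exponent for \<open>q^n\<close> is the Euler exponent for \<open>P\<close> times a
  sum of \<open>n div degree P\<close> odd powers. This sum has the parity of
  \<open>n div degree P\<close>, and only the parity matters for a sign.\<close>

lemma quadratic_symbol_power_cong:
  fixes P :: "'a::{finite,field} poly"
  assumes odd: "odd CARD('a)" and P: "P \<in> monic_irreducibles" "degree P dvd n" and n: "n > 0"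
    and D: "\<not> P dvd D"
  shows "[D ^ ((CARD('a) ^ n - 1) div 2) = of_int (quadratic_symbol D P ^ (n div degree P))] (mod P)"
proof -
  define k N where "k = degree P" and "N = n div k"
  have kN: "n = k * N" using P by (simp add: k_def N_def)
  define S where "S = (\<Sum>i<N. (CARD('a) ^ k) ^ i)"
  have "(CARD('a) ^ k - 1) * S = CARD('a) ^ n - 1"
    unfolding S_def geometric_sum_nat by (simp add: kN power_mult)
  moreover have "CARD('a) ^ k - 1 = 2 * ((CARD('a) ^ k - 1) div 2)"
    by (rule half_card_residues[OF odd, symmetric])
  ultimately have "2 * ((CARD('a) ^ k - 1) div 2 * S) = CARD('a) ^ n - 1" by (metis mult.assoc)
  hence half: "(CARD('a) ^ n - 1) div 2 = (CARD('a) ^ k - 1) div 2 * S" by linarith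
  have qs: "quadratic_symbol D P = 1 \<or> quadratic_symbol D P = -1"
    using quadratic_symbol_range[of D P] quadratic_symbol_eq_0_iff[of D P] D by auto
  have "odd (CARD('a) ^ k)" using odd by simp
  from minus_one_power_geometric_sum[OF this, where n = N and ?'b = int]
  have "quadratic_symbol D P ^ S = quadratic_symbol D P ^ N"
    using qs by (auto simp: S_def)
  moreover have "[of_int (quadratic_symbol D P) ^ S = (D ^ ((CARD('a) ^ k - 1) div 2)) ^ S] (mod P)"
    unfolding k_def by (intro cong_pow euler_criterion_monic_irreducible odd P)
  ultimately have "[of_int (quadratic_symbol D P ^ N) = D ^ ((CARD('a) ^ n - 1) div 2)] (mod P)"
    unfolding half power_mult by (metis of_int_power)
  thus ?thesis unfolding N_def k_def by (rule cong_sym)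
qed

text \<open>Stepanov bounds the counts for \<open>s = 1\<close> and \<open>s = -1\<close> from above
  by \<open>r^2 / 2 + 3 d r\<close> each. Together they make up \<open>r^2\<close> except for at
  most \<open>2 d\<close> coming from primes of \<open>D\<close>, so their difference is at most
  \<open>6 d r + 2 d\<close>.\<close>

theorem prime_power_sum_bound:
  fixes D :: "'a::{finite,field} poly"
  assumes odd: "odd CARD('a)" and D: "D \<in> monic_polys" "squarefree D" and deg: "degree D = 2 * d" "d > 0"
    and large: "CARD('a) ^ e > 4 * d"
  shows   "\<bar>prime_power_sum (quadratic_char D) (2 * e)\<bar> \<le> 8 * int d * int CARD('a) ^ e"
proof -
  define r where "r = CARD('a) ^ e"
  define Q where "Q = {P \<in> monic_irreducibles. degree (P :: 'a poly) dvd 2 * e}"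
  have "odd r" using odd by (simp add: r_def)
  \<comment> \<open>Both \<open>r\<close> odd and \<open>r > 4 * d\<close> enter here, to produce
    the parameter \<open>w\<close> of the auxiliary polynomial.\<close>
  hence "odd (r - 4 * d)" using large by (simp add: r_def)
  then obtain w where "r - 4 * d = 2 * w + 1" by (elim oddE)
  hence r: "CARD('a) ^ e = 4 * d + 2 * w + 1" using large by (simp add: r_def)
  have e: "e > 0" using large deg by (cases e) auto
  have finQ: "finite Q" unfolding Q_def by (rule finite_irreducibles_degree_dvd) (use e in auto)
  define T where "T = stepanov_primes D e"
  have T: "T 1 \<subseteq> Q" "T (-1) \<subseteq> Q" by (auto simp: T_def stepanov_primes_def Q_def)
  define T0 where "T0 = {P \<in> Q. P dvd D}"
  define c where "c = (\<lambda>P. quadratic_symbol D P ^ (2 * e div degree P))"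
  have D0: "D \<noteq> 0" using D monic_polys_nonzero by blast
  have c_eq: "c P = (if P \<in> T 1 then 1 else if P \<in> T (-1) then -1 else 0)"
    and in_T: "P \<in> T 1 \<or> P \<in> T (-1) \<or> P \<in> T0" and disj: "\<not> (P \<in> T 1 \<and> P \<in> T (-1))"
    if P: "P \<in> Q" for P
  proof -
    have PM: "P \<in> monic_irreducibles" and dvd: "degree P dvd 2 * e" using P by (auto simp: Q_def)
    show disj: "\<not> (P \<in> T 1 \<and> P \<in> T (-1))"
    proof
      assume "P \<in> T 1 \<and> P \<in> T (-1)"
      hence "[of_int 1 = of_int (-1)] (mod P)"
        unfolding T_def stepanov_primes_def using cong_sym cong_trans by fastforce
      from cong_of_int_sign[OF odd PM _ _ this] show False by simp
    qed
    show "c P = (if P \<in> T 1 then 1 else if P \<in> T (-1) then -1 else 0)"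
    proof (cases "P dvd D")
      case False
      have qs: "quadratic_symbol D P = 1 \<or> quadratic_symbol D P = -1"
        using quadratic_symbol_range[of D P] quadratic_symbol_eq_0_iff[of D P] False by auto
      hence "c P = 1 \<or> c P = -1" unfolding c_def using power_minus1_even by (metis minus_one_power_iff power_one)
      moreover have "[D ^ ((CARD('a) ^ (2 * e) - 1) div 2) = of_int (c P)] (mod P)"
        unfolding c_def using e by (intro quadratic_symbol_power_cong odd PM dvd False) auto
      ultimately show ?thesis using PM dvd disj by (auto simp: T_def stepanov_primes_def)
    next
      case True
      have "degree P \<le> 2 * e" using e dvd by (intro dvd_imp_le) auto
      hence "2 * e div degree P > 0" using monic_irreducibles_degree_pos[OF PM]
        by (simp add: div_greater_zero_iff)
      hence "c P = 0" using True quadratic_symbol_eq_0_iff[of D P] by (simp add: c_def)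
      moreover have "P \<notin> T s" if "s = 1 \<or> s = -1" for s
      proof
        assume "P \<in> T s"
        hence cong: "[D ^ ((CARD('a) ^ (2 * e) - 1) div 2) = s] (mod P)" by (simp add: T_def stepanov_primes_def)
        have "CARD('a) ^ (2 * e) - 1 \<ge> 2" using e by (intro card_nonzero_residues_ge odd) auto
        hence "(CARD('a) ^ (2 * e) - 1) div 2 > 0" by simp
        hence "P dvd D ^ ((CARD('a) ^ (2 * e) - 1) div 2)"
          using True by (intro dvd_trans[OF True dvd_power]) auto
        hence "[s = 0] (mod P)" using cong by (metis cong_0_iff cong_sym cong_trans)
        hence "P dvd 1" using that by (auto simp: cong_0_iff)
        thus False using monic_irreducibles_not_unit[OF PM] by blast
      qed
      ultimately show ?thesis by auto
    qed
    thus "P \<in> T 1 \<or> P \<in> T (-1) \<or> P \<in> T0"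
      using P quadratic_symbol_eq_0_iff[of D P] by (auto simp: T0_def c_def split: if_splits)
  qed
  define s1 s2 s0 where "s1 = (\<Sum>P\<in>T 1. degree P)" and "s2 = (\<Sum>P\<in>T (-1). degree P)"
    and "s0 = (\<Sum>P\<in>T0. degree P)"
  have fT: "finite (T 1)" "finite (T (-1))" "finite T0"
    using finQ T finite_subset by (auto simp: T0_def)
  have "prime_power_sum (quadratic_char D) (2 * e) = (\<Sum>P\<in>Q. int (degree P) * c P)"
    unfolding prime_power_sum_def Q_def
    by (intro sum.cong refl) (auto simp: c_def quadratic_char_irreducible)
  also have "\<dots> = (\<Sum>P\<in>Q. (if P \<in> T 1 then int (degree P) else 0) - (if P \<in> T (-1) then int (degree P) else 0))"
    using disj by (intro sum.cong refl) (auto simp: c_eq)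
  also have "\<dots> = (\<Sum>P\<in>{P\<in>Q. P \<in> T 1}. int (degree P)) - (\<Sum>P\<in>{P\<in>Q. P \<in> T (-1)}. int (degree P))"
    using finQ by (simp add: sum_subtractf sum.inter_filter)
  also have "{P\<in>Q. P \<in> T 1} = T 1" using T by auto
  also have "{P\<in>Q. P \<in> T (-1)} = T (-1)" using T by auto
  finally have psum: "prime_power_sum (quadratic_char D) (2 * e) = int s1 - int s2"
    by (simp add: s1_def s2_def)
  have "r ^ 2 = (\<Sum>P\<in>Q. degree P)"
    using sum_degree_irreducibles[of "2 * e", where ?'a = 'a] e
    by (simp add: Q_def r_def mult.commute flip: power_mult)
  also have "\<dots> \<le> (\<Sum>P\<in>T 1 \<union> T (-1) \<union> T0. degree P)"
    using in_T fT by (intro sum_mono2) auto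
  also have "\<dots> \<le> (\<Sum>P\<in>T 1 \<union> T (-1). degree P) + s0"
    unfolding s0_def using fT by (subst sum.union_inter[symmetric]) auto
  also have "(\<Sum>P\<in>T 1 \<union> T (-1). degree P) \<le> s1 + s2"
    unfolding s1_def s2_def using fT by (subst sum.union_inter[symmetric]) auto
  finally have total: "r ^ 2 \<le> s1 + s2 + s0" by simp
  have "s0 = degree (\<Prod>T0)"
    unfolding s0_def by (rule degree_prod_irreducibles[symmetric]) (auto simp: T0_def Q_def)
  also have "\<dots> \<le> degree D"
    by (intro dvd_imp_degree_le D0 prod_irreducibles_dvd) (use fT in \<open>auto simp: T0_def Q_def\<close>)
  finally have s0: "s0 \<le> 2 * d" using deg by simp
  have bounds: "2 * s1 \<le> r ^ 2 + 6 * d * r" "2 * s2 \<le> r ^ 2 + 6 * d * r"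
    unfolding s1_def s2_def T_def r_def by (intro stepanov_bound[OF D deg r]; simp)+
  have "d \<le> d * r" using r by (simp add: r_def)
  have arith: "\<bar>int x - int y\<bar> \<le> int (8 * u)"
    if "2 * x \<le> R + 6 * u" "2 * y \<le> R + 6 * u" "d \<le> u" "R \<le> x + y + s0" for x y u R
    using that s0 by linarith
  have "\<bar>int s1 - int s2\<bar> \<le> int (8 * (d * r))"
    by (rule arith[OF bounds[unfolded mult.assoc] \<open>d \<le> d * r\<close> total])
  thus ?thesis unfolding psum by (simp add: r_def mult.assoc)
qed


section \<open>From power sums to the size of the inverse roots\<close>

text \<open>The logarithmic derivative cleared of denominators; \<open>G a\<close> is the series of
  \<open>a X / (1 - a X)\<close>.\<close>

lemma fps_log_derivative_prod:
  fixes \<alpha> :: "nat \<Rightarrow> complex"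
  defines "G \<equiv> \<lambda>a. Abs_fps (\<lambda>k. if k = 0 then 0 else a ^ k)"
  shows "fps_X * fps_deriv (\<Prod>i<n. 1 - fps_const (\<alpha> i) * fps_X) =
           - (\<Sum>i<n. G (\<alpha> i)) * (\<Prod>i<n. 1 - fps_const (\<alpha> i) * fps_X)"
proof (induction n)
  case (Suc n)
  define F where "F = (\<Prod>i<n. 1 - fps_const (\<alpha> i) * fps_X)"
  define l where "l = 1 - fps_const (\<alpha> n) * fps_X"
  have l': "fps_deriv l = - fps_const (\<alpha> n)" by (simp add: l_def)
  have G: "G (\<alpha> n) * l = fps_const (\<alpha> n) * fps_X"
  proof (rule fps_ext)
    fix k
    have "fps_nth (G (\<alpha> n) * l) k = fps_nth (G (\<alpha> n)) k - fps_nth (fps_X * (fps_const (\<alpha> n) * G (\<alpha> n))) k"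
      by (simp add: l_def algebra_simps)
    also have "\<dots> = fps_nth (fps_const (\<alpha> n) * fps_X) k"
      by (cases k; cases "k = 1") (auto simp: G_def)
    finally show "fps_nth (G (\<alpha> n) * l) k = fps_nth (fps_const (\<alpha> n) * fps_X) k" .
  qed
  have IH: "fps_X * fps_deriv F = - (\<Sum>i<n. G (\<alpha> i)) * F" using Suc by (simp add: F_def)
  have "fps_X * fps_deriv (F * l) = (fps_X * fps_deriv F) * l - F * (fps_const (\<alpha> n) * fps_X)"
    by (simp add: l' algebra_simps fps_const_neg[symmetric] del: fps_const_neg)
  also have "\<dots> = - (\<Sum>i<n. G (\<alpha> i)) * F * l - F * (G (\<alpha> n) * l)"
    by (simp only: IH G)
  also have "\<dots> = - (\<Sum>i<Suc n. G (\<alpha> i)) * (F * l)" by (simp add: algebra_simps)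
  finally show ?case by (simp add: F_def l_def)
qed simp

text \<open>The shape matches \<open>degree_sum_recurrence\<close>, so comparing the two identifies
  prime power sums with negated power sums of inverse roots.\<close>

lemma newton_identity:
  fixes \<alpha> :: "nat \<Rightarrow> complex" and n :: nat
  defines "L \<equiv> \<Prod>i<n. [:1, - \<alpha> i:]"
  shows "of_nat m * coeff L m = - (\<Sum>k=1..m. (\<Sum>i<n. \<alpha> i ^ k) * coeff L (m - k))"
proof (cases "m = 0")
  case False
  have L: "fps_of_poly L = (\<Prod>i<n. 1 - fps_const (\<alpha> i) * fps_X)"
    by (simp add: L_def fps_of_poly_prod fps_of_poly_linear' fps_const_neg[symmetric] del: fps_const_neg)
  have "of_nat m * coeff L m = fps_nth (fps_X * fps_deriv (fps_of_poly L)) m"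
    using False by simp
  also have "\<dots> = - (\<Sum>k=0..m. fps_nth (\<Sum>i<n. Abs_fps (\<lambda>k. if k = 0 then 0 else \<alpha> i ^ k)) k * coeff L (m - k))"
    unfolding L fps_log_derivative_prod unfolding L[symmetric]
    by (simp add: fps_mult_nth sum_negf)
  also have "(\<Sum>k=0..m. fps_nth (\<Sum>i<n. Abs_fps (\<lambda>k. if k = 0 then 0 else \<alpha> i ^ k)) k * coeff L (m - k)) =
             (\<Sum>k=1..m. fps_nth (\<Sum>i<n. Abs_fps (\<lambda>k. if k = 0 then 0 else \<alpha> i ^ k)) k * coeff L (m - k))"
    by (rule sum.mono_neutral_right) (auto simp: fps_sum_nth)
  also have "\<dots> = (\<Sum>k=1..m. (\<Sum>i<n. \<alpha> i ^ k) * coeff L (m - k))"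
    by (intro sum.cong refl) (auto simp: fps_sum_nth)
  finally show ?thesis .
qed simp

text \<open>By simultaneous approximation some power \<open>\<beta>\<^sub>i\<^sup>e\<close> with \<open>e\<close> large makes all arguments at most \<open>\<pi>/3\<close>.\<close>

lemma power_sums_bounded_imp_bounded:
  fixes \<beta> :: "nat \<Rightarrow> complex"
  assumes bound: "\<And>e. e \<ge> e0 \<Longrightarrow> norm (\<Sum>i<n. \<beta> i ^ e) \<le> K * R ^ e" and R: "R > 0" and j: "j < n"
  shows   "norm (\<beta> j) \<le> R"
proof (rule ccontr)
  assume "\<not> norm (\<beta> j) \<le> R"
  hence gt: "norm (\<beta> j) / R > 1" using R by (simp add: field_simps)
  obtain M0 where M0: "(norm (\<beta> j) / R) ^ M0 > 2 * K" using real_arch_pow[OF gt] by blast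
  define M where "M = Max {M0, e0, 1}"
  have M: "M \<ge> M0" "M \<ge> e0" "M \<ge> 1" by (auto simp: M_def)
  \<comment> \<open>Approximating \<open>real M * Arg\<close> instead of \<open>Arg\<close> forces
    the final exponent \<open>nat k * M\<close> to be at least \<open>M\<close>. An error below 1/6
    of a full turn keeps the angle within \<open>pi / 3\<close>, where the cosine is at least
    1/2.\<close>
  obtain k p where k: "k > 0" "k \<le> int (6 ^ n)" and kp: "\<And>i. i < n \<Longrightarrow>
      \<bar>of_int k * (real M * Arg (\<beta> i) / (2 * pi)) - of_int (p i)\<bar> < 1 / real 6"
    by (rule Dirichlet_approx_simult[of 6 n "\<lambda>i. real M * Arg (\<beta> i) / (2 * pi)"]) (simp, rule that)
  define e where "e = nat k * M"
  have "1 * M \<le> nat k * M" using k by (intro mult_le_mono1) linarith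
  hence e: "e \<ge> M" by (simp add: e_def)
  have Re_ge: "Re (\<beta> i ^ e) \<ge> norm (\<beta> i) ^ e / 2" if i: "i < n" for i
  proof -
    define \<theta> where "\<theta> = of_int k * (real M * Arg (\<beta> i) / (2 * pi)) - of_int (p i)"
    have "real e * Arg (\<beta> i) = 2 * pi * \<theta> + 2 * pi * of_int (p i)"
      using k by (simp add: e_def \<theta>_def field_simps)
    hence "cos (real e * Arg (\<beta> i)) = cos (2 * pi * \<theta>)"
      using cos_int_2pin by (simp add: cos_add)
    also have "\<dots> = cos \<bar>2 * pi * \<theta>\<bar>" by simp
    also have "cos (pi / 3) \<le> \<dots>"
    proof (rule cos_monotone_0_pi_le)
      have "2 * pi * \<bar>\<theta>\<bar> \<le> 2 * pi * (1 / 6)"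
        using kp[OF i] unfolding \<theta>_def by (intro mult_left_mono) auto
      thus "\<bar>2 * pi * \<theta>\<bar> \<le> pi / 3" by (simp add: abs_mult)
    qed auto
    finally have "cos (real e * Arg (\<beta> i)) \<ge> 1 / 2" by (simp add: cos_60)
    hence "norm (\<beta> i) ^ e * (1 / 2) \<le> norm (\<beta> i) ^ e * cos (real e * Arg (\<beta> i))"
      by (intro mult_left_mono) auto
    also have "\<dots> = Re (rcis (norm (\<beta> i)) (Arg (\<beta> i)) ^ e)" by (simp add: DeMoivre2)
    also have "rcis (norm (\<beta> i)) (Arg (\<beta> i)) = \<beta> i" by (rule rcis_cmod_Arg)
    finally show ?thesis by simp
  qed
  have "norm (\<beta> j) ^ e / 2 \<le> (\<Sum>i\<in>{j}. Re (\<beta> i ^ e))" using Re_ge[OF j] by simp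
  also have "\<dots> \<le> (\<Sum>i<n. Re (\<beta> i ^ e))"
  proof (rule sum_mono2)
    fix i assume "i \<in> {..<n} - {j}"
    hence "norm (\<beta> i) ^ e / 2 \<le> Re (\<beta> i ^ e)" by (intro Re_ge) auto
    thus "0 \<le> Re (\<beta> i ^ e)" by (smt (verit) zero_le_power norm_ge_zero field_sum_of_halves)
  qed (use j in auto)
  also have "\<dots> = Re (\<Sum>i<n. \<beta> i ^ e)" by simp
  also have "\<dots> \<le> norm (\<Sum>i<n. \<beta> i ^ e)" by (rule complex_Re_le_cmod)
  also have "\<dots> \<le> K * R ^ e" using e M by (intro bound) auto
  finally have "(norm (\<beta> j) / R) ^ e \<le> 2 * K" using R by (simp add: power_divide field_simps)
  moreover have "(norm (\<beta> j) / R) ^ M0 \<le> (norm (\<beta> j) / R) ^ e"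
    using gt e M by (intro power_increasing) auto
  ultimately show False using M0 by linarith
qed

text \<open>The Riemann hypothesis for \<open>L(u, \<chi>\<^sub>D)\<close>, in the weak form \<open>\<bar>\<alpha>\<bar> \<le> \<surd>q\<close>.\<close>

theorem L_poly_factorization:
  fixes D :: "'a::{finite,field} poly"
  assumes odd: "odd CARD('a)" and D: "D \<in> monic_polys" "squarefree D" "even (degree D)" "degree D > 0"
  obtains N and \<alpha> :: "nat \<Rightarrow> complex"
  where "N < degree D" "L_poly D = (\<Prod>i<N. [:1, - \<alpha> i:])"
    "\<And>i. i < N \<Longrightarrow> norm (\<alpha> i) \<le> sqrt (real CARD('a))"
    "\<And>k. k > 0 \<Longrightarrow> of_int (prime_power_sum (quadratic_char D) k) = - (\<Sum>i<N. \<alpha> i ^ k)"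
proof -
  define L where "L = L_poly D"
  have coeffL: "coeff L m = of_int (degree_sum (quadratic_char D) m)" for m
    unfolding L_def by (rule coeff_L_poly[OF odd D])
  have L0: "coeff L 0 = 1" by (simp add: coeffL degree_sum_def monic_of_degree_0)
  hence Lnz: "L \<noteq> 0" by auto
  have "coeff L m = 0" if "m \<ge> degree D" for m
    using degree_sum_quadratic_char_eq_0[OF odd D that] by (simp add: coeffL)
  hence degL: "degree L < degree D" using D(4) by (metis leading_coeff_0_iff Lnz not_less)
  obtain N where N_def: "N = degree L" by blast
  \<comment> \<open>The inverse roots of \<open>L\<close> are the roots of the reversed polynomial,
    which is monic of the same degree because \<open>L\<close> has constant term 1.\<close>
  define R where "R = reflect_poly L"
  have degR: "degree R = N" using L0 by (simp add: R_def N_def)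
  have "lead_coeff R = 1" using L0 unfolding R_def by (simp add: coeff_reflect_poly)
  then obtain \<alpha> where \<alpha>: "R = (\<Prod>i<N. [:- \<alpha> i, 1:])"
    using complex_poly_decompose'[of R] degR by (metis smult_1_left)
  have L_prod: "L = (\<Prod>i<N. [:1, - \<alpha> i:])"
  proof -
    have "reflect_poly R = L" unfolding R_def using L0 by (intro reflect_poly_reflect_poly) simp
    moreover have "reflect_poly (\<Prod>i<N. [:- \<alpha> i, 1:]) = (\<Prod>i<N. reflect_poly [:- \<alpha> i, 1:])"
      by (rule reflect_poly_prod)
    moreover have "reflect_poly [:- a, 1:] = [:1, -a:]" for a :: complex
      by (cases "a = 0") (auto simp: reflect_poly_def)
    ultimately show ?thesis using \<alpha> by simp
  qed
  have rec: "of_nat m * coeff L m = (\<Sum>k=1..m. of_int (prime_power_sum (quadratic_char D) k) * coeff L (m - k))" for m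
  proof -
    have "of_nat m * degree_sum (quadratic_char D) m =
        (\<Sum>k=1..m. prime_power_sum (quadratic_char D) k * degree_sum (quadratic_char D) (m - k))"
      by (rule degree_sum_recurrence) (auto intro: quadratic_char_mult monic_irreducibles_monic)
    from arg_cong[OF this, of "of_int :: int \<Rightarrow> complex"] show ?thesis by (simp add: coeffL)
  qed
  \<comment> \<open>Both recurrences express their \<open>m\<close>-th power sum through earlier
    ones, with leading factor \<open>coeff L 0 = 1\<close>, so they have the same solution.\<close>
  have psum: "of_int (prime_power_sum (quadratic_char D) k) = - (\<Sum>i<N. \<alpha> i ^ k)" if "k > 0" for k
    using that
  proof (induction k rule: less_induct)
    case (less m)
    define s where "s = (\<lambda>k. - (\<Sum>i<N. \<alpha> i ^ k))"
    define c where "c = (\<lambda>k. of_int (prime_power_sum (quadratic_char D) k) :: complex)"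
    have ins: "{1..m} = insert m {1..<m}" using less.prems by auto
    have split: "(\<Sum>k=1..m. f k * coeff L (m - k)) = f m + (\<Sum>k=1..<m. f k * coeff L (m - k))" for f
      unfolding ins by (simp add: L0)
    have "(\<Sum>k=1..m. c k * coeff L (m - k)) = (\<Sum>k=1..m. s k * coeff L (m - k))"
      using rec[of m] newton_identity[where m = m and n = N and \<alpha> = \<alpha>] L_prod by (simp add: c_def s_def sum_negf)
    moreover have "(\<Sum>k=1..<m. c k * coeff L (m - k)) = (\<Sum>k=1..<m. s k * coeff L (m - k))"
      using less.IH by (intro sum.cong refl) (auto simp: c_def s_def)
    ultimately show ?case unfolding split by (simp add: c_def s_def)
  qed
  obtain d where d: "degree D = 2 * d" "d > 0" using D(3,4) by (elim evenE) auto
  define q where "q = CARD('a)"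
  have q: "q \<ge> 3" using card_field_ge_3[OF odd] by (simp add: q_def)
  \<comment> \<open>Stepanov's bound covers only even indices \<open>2 * e\<close>, so the growth
    lemma is applied to the squares of the inverse roots.\<close>
  have bound: "norm (\<Sum>i<N. (\<alpha> i ^ 2) ^ e) \<le> (8 * real d) * real q ^ e" if e: "e \<ge> 4 * d" for e
  proof -
    have "e < 2 ^ e" by (rule less_exp)
    also have "(2::nat) ^ e \<le> q ^ e" using q by (intro power_mono) auto
    finally have "e < q ^ e" .
    hence "4 * d < CARD('a) ^ e" using e by (simp add: q_def)
    from prime_power_sum_bound[OF odd D(1,2) d this]
    have "real_of_int \<bar>prime_power_sum (quadratic_char D) (2 * e)\<bar> \<le> of_int (8 * int d * int q ^ e)"
      unfolding q_def of_int_le_iff .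
    moreover have "norm (of_int (prime_power_sum (quadratic_char D) (2 * e)) :: complex) =
                     norm (\<Sum>i<N. (\<alpha> i ^ 2) ^ e)"
      using psum[of "2 * e"] d e by (simp add: power_mult norm_minus_cancel)
    ultimately show ?thesis by simp
  qed
  have rh: "norm (\<alpha> i) \<le> sqrt (real CARD('a))" if "i < N" for i
  proof -
    have "norm (\<alpha> i ^ 2) \<le> real q"
      by (rule power_sums_bounded_imp_bounded[where \<beta> = "\<lambda>i. \<alpha> i ^ 2", OF bound])
         (use q that in auto)
    thus ?thesis unfolding q_def norm_power by (rule real_le_rsqrt)
  qed
  show ?thesis
    by (rule that[OF degL[folded N_def] L_prod[unfolded L_def] rh psum])
qed

section \<open>A short prime sum bounding the central value\<close>

text \<open>Positivity of the Fejer kernel inside the closed disc, via the explicit identity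
  \<open>N + 2 Re \<Sum> (N - k) z\<^sup>k = \<bar>S\<^sub>N\<bar>\<^sup>2 + (1 - \<bar>z\<bar>\<^sup>2) \<Sum> \<bar>S\<^sub>n\<bar>\<^sup>2\<close> with \<open>S\<^sub>n = 1 + \<dots> + z\<^sup>n\<^sup>-\<^sup>1\<close>.\<close>

lemma fejer_identity:
  fixes z :: complex
  defines "S \<equiv> \<lambda>n. \<Sum>j<n. z ^ j"
  shows "real N + 2 * Re (\<Sum>k=1..<N. of_nat (N - k) * z ^ k) =
           norm (S N) ^ 2 + (1 - norm z ^ 2) * (\<Sum>n<N. norm (S n) ^ 2)"
proof (induction N)
  case (Suc N)
  have "(\<Sum>k=1..<Suc N. of_nat (Suc N - k) * z ^ k) =
        (\<Sum>k=1..<Suc N. of_nat (N - k) * z ^ k + z ^ k)"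
    by (intro sum.cong refl) (simp add: Suc_diff_le algebra_simps)
  also have "\<dots> = (\<Sum>k=1..<N. of_nat (N - k) * z ^ k) + (\<Sum>k=1..<Suc N. z ^ k)"
    by (cases "N = 0") (simp_all add: sum.distrib atLeastLessThanSuc add_ac)
  also have "(\<Sum>k=1..<Suc N. z ^ k) = S (Suc N) - 1"
    unfolding S_def lessThan_atLeast0 by (subst (2) sum.atLeast_Suc_lessThan) auto
  finally have lhs: "real (Suc N) + 2 * Re (\<Sum>k=1..<Suc N. of_nat (Suc N - k) * z ^ k) =
     real N + 2 * Re (\<Sum>k=1..<N. of_nat (N - k) * z ^ k) + (2 * Re (S (Suc N)) - 1)"
    by simp
  have "S (Suc N) = 1 + z * S N"
    unfolding S_def by (subst sum.lessThan_Suc_shift) (simp add: sum_distrib_left)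
  hence "norm (S (Suc N) - 1) ^ 2 = norm z ^ 2 * norm (S N) ^ 2"
    by (simp add: norm_mult power_mult_distrib)
  moreover have "norm (S (Suc N) - 1) ^ 2 = norm (S (Suc N)) ^ 2 - 2 * Re (S (Suc N)) + 1"
    unfolding cmod_power2 by (simp add: power2_eq_square algebra_simps)
  ultimately have "2 * Re (S (Suc N)) - 1 = norm (S (Suc N)) ^ 2 - norm z ^ 2 * norm (S N) ^ 2"
    by linarith
  thus ?case unfolding lhs Suc.IH by (simp add: algebra_simps)
qed (simp add: S_def)

lemma fejer_nonneg:
  fixes z :: complex
  assumes "norm z \<le> 1"
  shows "real N + 2 * Re (\<Sum>k=1..<N. of_nat (N - k) * z ^ k) \<ge> 0"
proof -
  have "norm z ^ 2 \<le> 1" using assms by (simp add: power_le_one)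
  thus ?thesis unfolding fejer_identity
    by (intro add_nonneg_nonneg mult_nonneg_nonneg sum_nonneg) auto
qed

section \<open>A smoothed truncated logarithm\<close>

text \<open>Chosen so that the increment from \<open>h\<close> to \<open>h + 1\<close> is
  \<open>2 k (h + 1 - k)\<close> divided by \<open>h (h + 1) (h + 2)\<close>. After division by
  \<open>k\<close> these increments are the coefficients of a Fejer kernel, whose real part is
  bounded below.\<close>

definition smoothing :: "nat \<Rightarrow> nat \<Rightarrow> real" where
  "smoothing h k = (1 - real k / real h) * (1 - real k / (real h + 1))"

lemma smoothing_nonneg: "k \<le> h \<Longrightarrow> 0 \<le> smoothing h k"
  unfolding smoothing_def by (intro mult_nonneg_nonneg) (auto simp: divide_le_eq)

lemma smoothing_le_1: "k \<le> h \<Longrightarrow> smoothing h k \<le> 1"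
  unfolding smoothing_def by (intro mult_le_one) (auto simp: divide_le_eq)

lemma smoothing_self [simp]: "h > 0 \<Longrightarrow> smoothing h h = 0"
  by (simp add: smoothing_def)

lemma smoothing_Suc_diff:
  assumes "h > 0"
  shows "smoothing (Suc h) k - smoothing h k =
           2 * real k * (real (Suc h) - real k) / (real h * real (Suc h) * (real h + 2))"
proof -
  have "(1 - k / (h + 1)) * (1 - k / (h + 2)) - (1 - k / h) * (1 - k / (h + 1)) =
          2 * k * (h + 1 - k) / (h * (h + 1) * (h + 2))" if "h > 0" for h k :: real
    using that by (simp add: divide_simps) (simp add: algebra_simps)
  from this[of "real h" "real k"] show ?thesis using assms by (simp add: smoothing_def algebra_simps)
qed

text \<open>A weighted truncation of the series of \<open>- log (1 - z)\<close>, real part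
  taken.\<close>

definition smoothed_log :: "nat \<Rightarrow> complex \<Rightarrow> real" where
  "smoothed_log h z = Re (\<Sum>k=1..h. of_real (smoothing h k / real k) * z ^ k)"

text \<open>Fejer positivity bounds the increment of \<open>smoothed_log\<close> from below by
  \<open>- 1 / (h (h + 2))\<close>. This is at least \<open>- 1 / (h (h + 1))\<close>, which
  telescopes and explains the correction \<open>1 / h\<close>.\<close>

lemma smoothed_log_Suc:
  assumes h: "h > 0" and z: "norm z \<le> 1"
  shows "smoothed_log h z - 1 / real h \<le> smoothed_log (Suc h) z - 1 / real (Suc h)"
proof -
  define c where "c = 1 / (real h * real (Suc h) * (real h + 2))"
  have c: "c > 0" using h by (simp add: c_def)
  have "smoothed_log (Suc h) z = Re (\<Sum>k=1..h. of_real (smoothing (Suc h) k / real k) * z ^ k)"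
    unfolding smoothed_log_def by simp
  hence "smoothed_log (Suc h) z - smoothed_log h z =
          Re (\<Sum>k=1..h. of_real ((smoothing (Suc h) k - smoothing h k) / real k) * z ^ k)"
    unfolding smoothed_log_def by (simp add: diff_divide_distrib left_diff_distrib sum_subtractf)
  also have "(\<Sum>k=1..h. of_real ((smoothing (Suc h) k - smoothing h k) / real k) * z ^ k) =
      (\<Sum>k=1..h. of_real (2 * c) * (of_nat (Suc h - k) * z ^ k))"
  proof (intro sum.cong refl)
    fix k assume k: "k \<in> {1..h}"
    have "(smoothing (Suc h) k - smoothing h k) / real k = 2 * c * real (Suc h - k)"
      unfolding smoothing_Suc_diff[OF h] c_def using k by (simp add: of_nat_diff)
    thus "of_real ((smoothing (Suc h) k - smoothing h k) / real k) * z ^ k =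
        of_real (2 * c) * (of_nat (Suc h - k) * z ^ k)"
      by (simp only:) simp
  qed
  also have "Re \<dots> = c * (2 * Re (\<Sum>k=1..<Suc h. of_nat (Suc h - k) * z ^ k))"
    by (simp only: sum_distrib_left[symmetric] atLeastLessThanSuc_atLeastAtMost) simp
  also have "\<dots> \<ge> c * (- real (Suc h))"
    using fejer_nonneg[OF z, of "Suc h"] c by (intro mult_left_mono) linarith+
  also have "c * (- real (Suc h)) = - 1 / (real h * (real h + 2))"
  proof -
    have "1 / (x * (x + 1) * (x + 2)) * (- (x + 1)) = - 1 / (x * (x + 2))" if "x > 0" for x :: real
      using that by (auto simp: divide_simps)
    from this[of "real h"] show ?thesis using h by (simp add: c_def add.commute)
  qed
  also have "- 1 / (real h * (real h + 2)) \<ge> - 1 / (real h * (real h + 1))"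
    using h by (simp add: frac_le mult_left_mono)
  also have "- 1 / (real h * (real h + 1)) = 1 / real (Suc h) - 1 / real h"
    using h by (simp add: field_simps)
  finally show ?thesis by linarith
qed

lemma smoothed_log_mono:
  assumes h: "h > 0" "h \<le> M" and z: "norm z \<le> 1"
  shows "smoothed_log h z - 1 / real h \<le> smoothed_log M z - 1 / real M"
  using h(2)
proof (induction M rule: dec_induct)
  case (step M)
  thus ?case using smoothed_log_Suc[of M z] h z by linarith
qed simp

text \<open>The weights differ from 1 by at most \<open>2 k / M\<close>, so the distance to the
  Taylor partial sum is at most \<open>2 / M\<close> times a convergent geometric sum.\<close>

lemma smoothed_log_tendsto:
  fixes z :: complex
  assumes z: "norm z < 1"
  shows "(\<lambda>M. smoothed_log M z) \<longlonglongrightarrow> - ln (norm (1 - z))"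
proof -
  define T where "T = (\<lambda>M. \<Sum>k<Suc M. z ^ k / of_nat k)"
  have "(\<lambda>n. (-1) ^ Suc n / of_nat n * (- z) ^ n) sums Ln (1 + (-z))"
    by (rule Ln_series) (use z in simp)
  hence "(\<lambda>n. - ((-1) ^ Suc n / of_nat n * (- z) ^ n)) sums - Ln (1 - z)"
    by (intro sums_minus) simp
  also have "(\<lambda>n. - ((-1) ^ Suc n / of_nat n * (- z) ^ n)) = (\<lambda>n. z ^ n / of_nat n)"
  proof
    fix n
    have "(-1) ^ n * (- z) ^ n = z ^ n" by (simp flip: power_mult_distrib)
    thus "- ((-1) ^ Suc n / of_nat n * (- z) ^ n) = z ^ n / of_nat n" by simp
  qed
  finally have "T \<longlonglongrightarrow> - Ln (1 - z)"
    unfolding sums_def T_def by (rule LIMSEQ_Suc)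
  hence "(\<lambda>M. Re (T M)) \<longlonglongrightarrow> Re (- Ln (1 - z))" by (rule tendsto_Re)
  moreover have "1 - z \<noteq> 0" using z by auto
  ultimately have lim: "(\<lambda>M. Re (T M)) \<longlonglongrightarrow> - ln (norm (1 - z))" by (simp add: Re_Ln)
  have "(\<lambda>M. smoothed_log M z - Re (T M)) \<longlonglongrightarrow> 0"
  proof (rule Lim_null_comparison)
    show "(\<lambda>M. 2 / (1 - norm z) / real M) \<longlonglongrightarrow> 0" by real_asymp
    show "\<forall>\<^sub>F M in sequentially. norm (smoothed_log M z - Re (T M)) \<le> 2 / (1 - norm z) / real M"
      using eventually_gt_at_top[of 0]
    proof eventually_elim
      case (elim M)
      have "T M = (\<Sum>k=1..M. z ^ k / of_nat k)"
        unfolding T_def lessThan_Suc_atMost atMost_atLeast0 by (subst sum.atLeast_Suc_atMost) auto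
      hence "smoothed_log M z - Re (T M) =
               Re (\<Sum>k=1..M. of_real (smoothing M k / real k) * z ^ k - z ^ k / of_nat k)"
        by (simp add: smoothed_log_def sum_subtractf)
      also have "norm \<dots> \<le> norm (\<Sum>k=1..M. of_real (smoothing M k / real k) * z ^ k - z ^ k / of_nat k)"
        unfolding real_norm_def by (rule abs_Re_le_cmod)
      also have "\<dots> \<le> (\<Sum>k=1..M. 2 / real M * norm z ^ k)"
      proof (rule sum_norm_le)
        fix k assume k: "k \<in> {1..M}"
        have "of_real (smoothing M k / real k) * z ^ k - z ^ k / of_nat k =
                of_real ((smoothing M k - 1) / real k) * z ^ k"
          using k by (simp add: field_simps)
        hence "norm (of_real (smoothing M k / real k) * z ^ k - z ^ k / of_nat k) =
                \<bar>smoothing M k - 1\<bar> / real k * norm z ^ k"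
          by (simp only: norm_mult norm_power norm_of_real abs_divide abs_of_nat)
        also have "\<bar>smoothing M k - 1\<bar> / real k \<le> 2 / real M"
        proof -
          have "1 - smoothing M k = real k / real M + real k / (real M + 1) * (1 - real k / real M)"
            by (simp add: smoothing_def algebra_simps)
          also have "\<dots> \<le> real k / real M + real k / real M * 1"
            using k elim by (intro add_mono mult_mono frac_le) (auto simp: divide_le_eq)
          finally have "1 - smoothing M k \<le> 2 / real M * real k" by simp
          moreover have "smoothing M k \<le> 1" using k by (intro smoothing_le_1) auto
          ultimately show ?thesis using k by (simp add: pos_divide_le_eq)
        qed
        finally show "norm (of_real (smoothing M k / real k) * z ^ k - z ^ k / of_nat k) \<le>
            2 / real M * norm z ^ k" by (simp add: mult_right_mono)
      qed
      also have "\<dots> = 2 / real M * (\<Sum>k=1..M. norm z ^ k)" by (simp add: sum_distrib_left)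
      also have "(\<Sum>k=1..M. norm z ^ k) \<le> (\<Sum>k<Suc M. norm z ^ k)"
        by (intro sum_mono2) auto
      also have "\<dots> \<le> 1 / (1 - norm z)"
        using z by (subst sum_gp_strict) (auto intro!: divide_right_mono)
      finally show ?case using elim by (simp add: mult_left_mono field_simps)
    qed
  qed
  from tendsto_add[OF this lim] show ?thesis by simp
qed

text \<open>Inside the disc the monotone sequence is compared with its limit; the boundary, where
  normalised inverse roots may lie, is reached along a radius. The exponential form remains
  meaningful at \<open>z = 1\<close>.\<close>

lemma norm_one_minus_le:
  fixes z :: complex
  assumes h: "h > 0" and z: "norm z \<le> 1"
  shows "norm (1 - z) \<le> exp (1 / real h - smoothed_log h z)"
proof -
  have open_disc: "norm (1 - w) \<le> exp (1 / real h - smoothed_log h w)" if w: "norm w < 1" for w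
  proof -
    have "smoothed_log h w - 1 / real h \<le> - ln (norm (1 - w))"
    proof (rule tendsto_lowerbound)
      have "(\<lambda>M. smoothed_log M w - 1 / real M) \<longlonglongrightarrow> - ln (norm (1 - w)) - 0"
        by (intro tendsto_diff smoothed_log_tendsto w lim_1_over_n)
      thus "(\<lambda>M. smoothed_log M w - 1 / real M) \<longlonglongrightarrow> - ln (norm (1 - w))" by simp
      show "\<forall>\<^sub>F M in sequentially. smoothed_log h w - 1 / real h \<le> smoothed_log M w - 1 / real M"
        using eventually_ge_at_top[of h] by eventually_elim (use smoothed_log_mono h w in auto)
    qed simp
    hence "ln (norm (1 - w)) \<le> 1 / real h - smoothed_log h w" by simp
    hence "exp (ln (norm (1 - w))) \<le> exp (1 / real h - smoothed_log h w)" by simp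
    moreover have "norm (1 - w) > 0" using w by auto
    ultimately show ?thesis by (simp only: exp_ln)
  qed
  define t where "t = (\<lambda>n. 1 - 1 / real (Suc n))"
  have t: "t \<longlonglongrightarrow> 1" unfolding t_def by real_asymp
  have "(\<lambda>n. of_real (t n) * z) \<longlonglongrightarrow> of_real 1 * z" by (intro tendsto_intros t)
  hence tz: "(\<lambda>n. of_real (t n) * z) \<longlonglongrightarrow> z" by simp
  show ?thesis
  proof (rule tendsto_le[OF sequentially_bot])
    show "(\<lambda>n. norm (1 - of_real (t n) * z)) \<longlonglongrightarrow> norm (1 - z)"
      by (intro tendsto_intros tz)
    show "(\<lambda>n. exp (1 / real h - smoothed_log h (of_real (t n) * z))) \<longlonglongrightarrow> exp (1 / real h - smoothed_log h z)"
      unfolding smoothed_log_def by (intro tendsto_intros tz)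
    show "\<forall>\<^sub>F n in sequentially. norm (1 - of_real (t n) * z) \<le>
            exp (1 / real h - smoothed_log h (of_real (t n) * z))"
    proof (intro always_eventually allI open_disc)
      fix n
      have "norm (of_real (t n) * z) \<le> \<bar>t n\<bar> * 1" unfolding norm_mult norm_of_real
        using z by (intro mult_left_mono) auto
      also have "\<bar>t n\<bar> < 1" by (simp add: t_def)
      finally show "norm (of_real (t n) * z) < 1" by simp
    qed
  qed
qed


text \<open>By the Riemann hypothesis every normalised inverse root lies in the closed unit disc.
  Each of the fewer than \<open>degree D\<close> linear factors costs \<open>1 / h\<close>, and the
  power sums of the roots turn into prime power sums.\<close>

lemma norm_L_fun_le:
  fixes D :: "'a::{finite,field} poly"
  assumes odd: "odd CARD('a)" and D: "D \<in> monic_polys" "squarefree D" "even (degree D)" "degree D > 0"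
    and h: "h > 0"
  defines "s \<equiv> real CARD('a) powr (-1 / 2)"
  shows "norm (L_fun (of_real s) D) \<le>
    exp (real (degree D) / real h + (\<Sum>k=1..h. smoothing h k / real k * s ^ k * of_int (prime_power_sum (quadratic_char D) k)))"
proof -
  obtain N \<alpha> where N: "N < degree D" and L: "L_poly D = (\<Prod>i<N. [:1, - \<alpha> i:])"
    and \<alpha>: "\<And>i. i < N \<Longrightarrow> norm (\<alpha> i) \<le> sqrt (real CARD('a))"
    and psum: "\<And>k. k > 0 \<Longrightarrow> of_int (prime_power_sum (quadratic_char D) k) = - (\<Sum>i<N. \<alpha> i ^ k)"
    by (rule L_poly_factorization[OF odd D]) (rule that)
  have s: "s > 0" "s * sqrt (real CARD('a)) = 1"
    by (simp_all add: s_def powr_minus powr_half_sqrt)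
  define \<beta> where "\<beta> = (\<lambda>i. of_real s * \<alpha> i)"
  have \<beta>: "norm (\<beta> i) \<le> 1" if "i < N" for i
  proof -
    have "norm (\<beta> i) = s * norm (\<alpha> i)" using s by (simp add: \<beta>_def norm_mult)
    also have "\<dots> \<le> s * sqrt (real CARD('a))" using \<alpha>[OF that] s by (intro mult_left_mono) auto
    finally show ?thesis using s by simp
  qed
  have "norm (L_fun (of_real s) D) = (\<Prod>i<N. norm (1 - \<beta> i))"
    by (simp add: L_fun_def L poly_prod prod_norm \<beta>_def)
  also have "\<dots> \<le> (\<Prod>i<N. exp (1 / real h - smoothed_log h (\<beta> i)))"
    using h \<beta> by (intro prod_mono conjI norm_one_minus_le) auto
  also have "\<dots> = exp (real N / real h - (\<Sum>i<N. smoothed_log h (\<beta> i)))"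
    by (simp add: exp_sum[symmetric] sum_subtractf)
  also have "(\<Sum>i<N. smoothed_log h (\<beta> i)) =
      Re (\<Sum>i<N. \<Sum>k=1..h. of_real (smoothing h k / real k) * \<beta> i ^ k)"
    unfolding smoothed_log_def Re_sum[symmetric] ..
  also have "(\<Sum>i<N. \<Sum>k=1..h. of_real (smoothing h k / real k) * \<beta> i ^ k) =
      (\<Sum>k=1..h. \<Sum>i<N. of_real (smoothing h k / real k) * \<beta> i ^ k)" by (rule sum.swap)
  also have "\<dots> = (\<Sum>k=1..h. of_real (- (smoothing h k / real k * s ^ k * of_int (prime_power_sum (quadratic_char D) k))))"
  proof (intro sum.cong refl)
    fix k assume "k \<in> {1..h}"
    hence k: "k > 0" by simp
    have "(\<Sum>i<N. of_real (smoothing h k / real k) * \<beta> i ^ k) =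
       of_real (smoothing h k / real k * s ^ k) * (\<Sum>i<N. \<alpha> i ^ k)"
      by (simp add: \<beta>_def power_mult_distrib sum_distrib_left sum_divide_distrib mult_ac)
    also have "(\<Sum>i<N. \<alpha> i ^ k) = - of_int (prime_power_sum (quadratic_char D) k)"
      using psum[OF k] by simp
    finally show "(\<Sum>i<N. of_real (smoothing h k / real k) * \<beta> i ^ k) =
      of_real (- (smoothing h k / real k * s ^ k * of_int (prime_power_sum (quadratic_char D) k)))"
      by simp
  qed
  also have "Re \<dots> = - (\<Sum>k=1..h. smoothing h k / real k * s ^ k * of_int (prime_power_sum (quadratic_char D) k))"
    by (simp only: of_real_sum[symmetric] Re_complex_of_real sum_negf)
  finally have "norm (L_fun (of_real s) D) \<le> exp (real N / real h +
      (\<Sum>k=1..h. smoothing h k / real k * s ^ k * of_int (prime_power_sum (quadratic_char D) k)))" by simp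
  also have "\<dots> \<le> exp (real (degree D) / real h +
      (\<Sum>k=1..h. smoothing h k / real k * s ^ k * of_int (prime_power_sum (quadratic_char D) k)))"
    using N by (simp add: divide_right_mono)
  finally show ?thesis .
qed

section \<open>From prime powers to primes\<close>

definition irreducibles_of_degree :: "nat \<Rightarrow> 'a::{finite,field} poly set" where
  "irreducibles_of_degree k = {P \<in> monic_irreducibles. degree P = k}"

lemma finite_irreducibles_of_degree [simp, intro]: "finite (irreducibles_of_degree k)"
  by (rule finite_subset[OF _ finite_monic_irreducibles_upto[of k]])
     (auto simp: irreducibles_of_degree_def monic_irreducibles_upto_def)

lemma sum_degree_irreducibles_of_degree:
  "(\<Sum>P\<in>irreducibles_of_degree k. real (degree (P :: 'a::{finite,field} poly))) \<le> real CARD('a) ^ k"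
proof -
  have "(\<Sum>P\<in>irreducibles_of_degree k. real (degree (P :: 'a poly))) = real (k * card (irreducibles_of_degree k :: 'a poly set))"
    by (simp add: irreducibles_of_degree_def)
  also have "\<dots> \<le> real (CARD('a) ^ k)"
    unfolding of_nat_le_iff irreducibles_of_degree_def by (rule card_irreducibles_of_degree)
  finally show ?thesis by simp
qed

text \<open>The exponent \<open>k div degree P\<close> is 1, 2 or at least 3. Squares of primes of
  degree \<open>k / 2\<close> may all contribute with sign +1 and are bounded by their full weight;
  the rest has degree at most \<open>k div 3\<close>, a geometric sum.\<close>

lemma prime_power_sum_le:
  fixes D :: "'a::{finite,field} poly"
  assumes odd: "odd CARD('a)" and k: "k > 0"
  shows "of_int (prime_power_sum (quadratic_char D) k) \<le>
    real k * (\<Sum>P\<in>irreducibles_of_degree k. of_int (quadratic_symbol D P)) +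
    (if even k then real CARD('a) ^ (k div 2) else 0) + 2 * real CARD('a) ^ (k div 3)"
proof -
  define q where "q = real CARD('a)"
  have q: "q \<ge> 3" using card_field_ge_3[OF odd] by (simp add: q_def)
  define Q where "Q = {P \<in> monic_irreducibles. degree (P :: 'a poly) dvd k}"
  define R where "R = (\<Union>j\<in>{..k div 3}. irreducibles_of_degree j :: 'a poly set)"
  define E where "E = (if even k then irreducibles_of_degree (k div 2) else ({} :: 'a poly set))"
  define c where "c = (\<lambda>P. real (degree P) * of_int (quadratic_symbol D P) ^ (k div degree P))"
  have fin: "finite (irreducibles_of_degree k)" "finite E" "finite R" by (auto simp: E_def R_def)
  have Q: "P \<in> irreducibles_of_degree k \<or> P \<in> E \<or> P \<in> R" if P: "P \<in> Q" for P
  proof -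
    obtain m where m: "k = degree P * m" using P by (auto simp: Q_def)
    consider "m = 1" | "m = 2" | "m \<ge> 3" using k m by fastforce
    thus ?thesis
    proof cases
      case 3
      have "degree P * 3 \<le> k" unfolding m using 3 by (intro mult_left_mono) auto
      hence "degree P \<le> k div 3" by linarith
      thus ?thesis using P by (auto simp: R_def Q_def irreducibles_of_degree_def)
    qed (use P m in \<open>auto simp: Q_def irreducibles_of_degree_def E_def\<close>)
  qed
  have c_le: "c P \<le> real (degree P)" for P
  proof -
    have "\<bar>of_int (quadratic_symbol D P) ^ (k div degree P)\<bar> \<le> (1::real)"
      unfolding power_abs using quadratic_symbol_range[of D P] by (intro power_le_one) auto
    hence "of_int (quadratic_symbol D P) ^ (k div degree P) \<le> (1::real)" by linarith
    from mult_left_mono[OF this, of "real (degree P)"] show ?thesis by (simp add: c_def)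
  qed
  have finQ: "finite Q" unfolding Q_def by (rule finite_irreducibles_degree_dvd[OF k])
  have subQ: "irreducibles_of_degree k \<subseteq> Q" by (auto simp: Q_def irreducibles_of_degree_def)
  have "of_int (prime_power_sum (quadratic_char D) k) = (\<Sum>P\<in>Q. c P)"
    by (simp add: prime_power_sum_def Q_def c_def quadratic_char_irreducible)
  also have "\<dots> = (\<Sum>P\<in>Q - irreducibles_of_degree k. c P) + (\<Sum>P\<in>irreducibles_of_degree k. c P)"
    by (rule sum.subset_diff[OF subQ finQ])
  also have "(\<Sum>P\<in>irreducibles_of_degree k. c P) =
      real k * (\<Sum>P\<in>irreducibles_of_degree k. of_int (quadratic_symbol D P))"
    unfolding sum_distrib_left using k
    by (intro sum.cong refl) (auto simp: c_def irreducibles_of_degree_def)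
  also have "(\<Sum>P\<in>Q - irreducibles_of_degree k. c P) \<le> (\<Sum>P\<in>Q - irreducibles_of_degree k. real (degree P))"
    by (intro sum_mono c_le)
  also have "\<dots> \<le> (\<Sum>P\<in>E \<union> R. real (degree P))"
    using Q fin by (intro sum_mono2) auto
  also have "\<dots> \<le> (\<Sum>P\<in>E. real (degree P)) + (\<Sum>P\<in>R. real (degree P))"
    using fin by (subst sum.union_inter[symmetric]) (auto intro!: sum_nonneg)
  also have "(\<Sum>P\<in>E. real (degree P)) \<le> (if even k then q ^ (k div 2) else 0)"
    using sum_degree_irreducibles_of_degree[of "k div 2", where ?'a = 'a] by (simp add: E_def q_def)
  also have "(\<Sum>P\<in>R. real (degree P)) = (\<Sum>j\<le>k div 3. \<Sum>P\<in>irreducibles_of_degree j. real (degree (P :: 'a poly)))"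
    unfolding R_def by (rule sum.UNION_disjoint) (simp_all, auto simp: irreducibles_of_degree_def)
  also have "\<dots> \<le> (\<Sum>j\<le>k div 3. q ^ j)"
    unfolding q_def by (intro sum_mono sum_degree_irreducibles_of_degree)
  also have "(\<Sum>j\<le>n. q ^ j) \<le> 2 * q ^ n" for n
  proof (induction n)
    case (Suc n)
    have "2 * q ^ n \<le> q * q ^ n" using q by (intro mult_right_mono) auto
    thus ?case using Suc by simp
  qed simp
  finally show ?thesis by (simp only: q_def add_ac)
qed

definition prime_sum :: "nat \<Rightarrow> 'a::{finite,field} poly \<Rightarrow> real" where
  "prime_sum h D = (\<Sum>P\<in>monic_irreducibles_upto h.
     smoothing h (degree P) * (real CARD('a) powr (-1 / 2)) ^ degree P * of_int (quadratic_symbol D P))"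

lemma sum_inverse_le_ln:
  assumes "h > 0" shows "(\<Sum>k=1..h. 1 / real k) \<le> 1 + ln (real h)"
  using assms
proof (induction h rule: nat_induct_non_zero)
  case (Suc n)
  have "ln (real n / real (Suc n)) \<le> real n / real (Suc n) - 1"
    using Suc by (intro ln_le_minus_one) auto
  also have "\<dots> = - 1 / real (Suc n)" by (simp add: field_simps)
  finally have "1 / real (Suc n) \<le> ln (real (Suc n)) - ln (real n)"
    using Suc by (simp add: ln_div)
  thus ?case using Suc by simp
qed simp

text \<open>After multiplication by \<open>s^k / k\<close>, squares of primes give
  \<open>1 / k\<close> for even \<open>k\<close>, hence half a harmonic sum. Cubes and higher powers
  decay geometrically and only affect the constant.\<close>

theorem ln_L_fun_bound:
  assumes odd: "odd CARD('a::{finite,field})"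
  obtains C where "\<And>(D :: 'a poly) h. D \<in> monic_polys \<Longrightarrow> squarefree D \<Longrightarrow> even (degree D) \<Longrightarrow>
    degree D > 0 \<Longrightarrow> h > 0 \<Longrightarrow> norm (L_fun (of_real (real CARD('a) powr (-1 / 2))) D) \<le>
      exp (real (degree D) / real h + prime_sum h D + ln (real h) / 2 + C)"
proof -
  define q where "q = real CARD('a)"
  define s where "s = q powr (-1 / 2)"
  have q: "q \<ge> 3" using card_field_ge_3[OF odd] by (simp add: q_def)
  have s: "s > 0" "s ^ 2 * q = 1"
  proof -
    show "s > 0" using q by (simp add: s_def)
    have "s ^ 2 = q powr (-1)" using q by (simp add: s_def powr_power)
    thus "s ^ 2 * q = 1" using q by (simp add: powr_minus)
  qed
  have s1: "s < 1"
  proof (rule ccontr)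
    assume "\<not> s < 1"
    hence "1 * 3 \<le> s ^ 2 * q" using q by (intro mult_mono) (auto simp: one_le_power)
    thus False using s by simp
  qed
  \<comment> \<open>Since \<open>s = q^(-1/2)\<close>, this is \<open>q^(-1/6)\<close>, the decay
    rate of \<open>s^k * q^(k / 3)\<close>.\<close>
  define t where "t = root 3 s"
  have t: "t > 0" "t < 1" "t ^ 3 = s" using s s1 by (auto simp: t_def)
  \<comment> \<open>\<open>1 / 2\<close> is half of the constant in the harmonic sum bound, and
    \<open>2 / (1 - t)\<close> bounds the contribution of cubes and higher powers.\<close>
  define C where "C = 1 / 2 + 2 / (1 - t)"
  show ?thesis
  proof (rule that[of C])
    fix D :: "'a poly" and h :: nat
    assume D: "D \<in> monic_polys" "squarefree D" "even (degree D)" "degree D > 0" and h: "h > 0"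
    let ?S = "\<lambda>k. \<Sum>P\<in>irreducibles_of_degree k. real_of_int (quadratic_symbol D P)"
    have term_le: "smoothing h k / real k * s ^ k * of_int (prime_power_sum (quadratic_char D) k) \<le>
        smoothing h k * s ^ k * ?S k + (if even k then 1 / real k else 0) + 2 * t ^ k"
      if k: "k \<in> {1..h}" for k
    proof -
      have w: "0 \<le> smoothing h k" "smoothing h k \<le> 1" using smoothing_nonneg smoothing_le_1 k by auto
      have w': "0 \<le> smoothing h k / real k" "smoothing h k / real k \<le> 1 / real k" "1 / real k \<le> 1"
        using w k by (auto simp: divide_right_mono)
      have "smoothing h k / real k * s ^ k * of_int (prime_power_sum (quadratic_char D) k) \<le>
        smoothing h k / real k * s ^ k * (real k * ?S k +
          (if even k then q ^ (k div 2) else 0) + 2 * q ^ (k div 3))"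
      proof (rule mult_left_mono)
        show "real_of_int (prime_power_sum (quadratic_char D) k) \<le>
            real k * ?S k + (if even k then q ^ (k div 2) else 0) + 2 * q ^ (k div 3)"
          unfolding q_def by (rule prime_power_sum_le[OF odd]) (use k in simp)
        show "0 \<le> smoothing h k / real k * s ^ k"
          using w'(1) s(1) by (intro mult_nonneg_nonneg zero_le_power) linarith+
      qed
      also have "\<dots> = smoothing h k * s ^ k * ?S k +
          smoothing h k / real k * (if even k then s ^ k * q ^ (k div 2) else 0) +
          2 * (smoothing h k / real k * (s ^ k * q ^ (k div 3)))"
        using k by (simp add: algebra_simps)
      also have "(if even k then s ^ k * q ^ (k div 2) else 0) = (if even k then 1 else 0)"
      proof (cases "even k")
        case True
        then obtain i where "k = 2 * i" by auto
        thus ?thesis using s by (simp add: power_mult flip: power_mult_distrib)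
      qed auto
      also have "smoothing h k / real k * (if even k then 1 else 0) \<le> (if even k then 1 / real k else 0)"
        using w' by auto
      also have "s ^ k * q ^ (k div 3) \<le> t ^ k"
      proof -
        define j where "j = k div 3"
        have j: "3 * j \<le> k" by (simp add: j_def)
        have "s ^ k = s ^ (k - 2 * j) * (s ^ 2) ^ j"
          using j by (simp flip: power_mult power_add)
        hence "s ^ k * q ^ j = s ^ (k - 2 * j) * (s ^ 2 * q) ^ j" by (simp add: power_mult_distrib)
        also have "\<dots> = t ^ (3 * (k - 2 * j))" using s t by (simp add: power_mult)
        also have "\<dots> \<le> t ^ k" using t j by (intro power_decreasing) auto
        finally show ?thesis by (simp add: j_def)
      qed
      hence "2 * (smoothing h k / real k * (s ^ k * q ^ (k div 3))) \<le> 2 * (1 * t ^ k)"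
        using w' s q by (intro mult_left_mono mult_mono) auto
      finally show ?thesis by simp
    qed
    have "(\<Sum>k=1..h. smoothing h k / real k * s ^ k * of_int (prime_power_sum (quadratic_char D) k)) \<le>
      (\<Sum>k=1..h. smoothing h k * s ^ k * ?S k + (if even k then 1 / real k else 0) + 2 * t ^ k)"
      by (intro sum_mono term_le)
    also have "\<dots> = (\<Sum>k=1..h. smoothing h k * s ^ k * ?S k) + (\<Sum>k=1..h. if even k then 1 / real k else 0)
        + 2 * (\<Sum>k=1..h. t ^ k)"
      by (simp add: sum.distrib sum_distrib_left)
    also have "(\<Sum>k=1..h. smoothing h k * s ^ k * ?S k) = prime_sum h D"
    proof -
      have "prime_sum h D = (\<Sum>P\<in>(\<Union>k\<in>{1..h}. irreducibles_of_degree k). smoothing h (degree P) * s ^ degree P * of_int (quadratic_symbol D P))"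
        unfolding prime_sum_def s_def q_def
        by (intro sum.cong refl)
           (auto simp: monic_irreducibles_upto_def irreducibles_of_degree_def Suc_le_eq monic_irreducibles_degree_pos)
      also have "\<dots> = (\<Sum>k=1..h. \<Sum>P\<in>irreducibles_of_degree k. smoothing h (degree P) * s ^ degree P * of_int (quadratic_symbol D P))"
        by (rule sum.UNION_disjoint) (simp_all, auto simp: irreducibles_of_degree_def)
      also have "\<dots> = (\<Sum>k=1..h. smoothing h k * s ^ k * ?S k)"
        unfolding sum_distrib_left by (intro sum.cong refl) (auto simp: irreducibles_of_degree_def)
      finally show ?thesis by simp
    qed
    also have "(\<Sum>k=1..h. if even k then 1 / real k else 0) \<le> (1 + ln (real h)) / 2"
    proof -
      have "(\<Sum>k=1..h. if even k then 1 / real k else 0) = (\<Sum>k\<in>{k\<in>{1..h}. even k}. 1 / real k)"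
        by (rule sum.inter_filter[symmetric]) simp
      also have "\<dots> = (\<Sum>i\<in>{1..h div 2}. 1 / real (2 * i))"
        by (rule sum.reindex_bij_witness[of _ "\<lambda>i. 2 * i" "\<lambda>k. k div 2"]) auto
      also have "\<dots> \<le> (\<Sum>i\<in>{1..h}. 1 / real (2 * i))" by (intro sum_mono2) auto
      also have "\<dots> = (\<Sum>i\<in>{1..h}. 1 / real i) / 2"
        by (simp add: sum_divide_distrib mult.commute)
      also have "\<dots> \<le> (1 + ln (real h)) / 2" using sum_inverse_le_ln[OF h] by simp
      finally show ?thesis .
    qed
    also have "(\<Sum>k=1..h. t ^ k) \<le> (\<Sum>k<Suc h. t ^ k)" using t by (intro sum_mono2) auto
    also have "(\<Sum>k<Suc h. t ^ k) \<le> 1 / (1 - t)"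
      using t by (subst sum_gp_strict) (auto intro!: divide_right_mono)
    finally have "(\<Sum>k=1..h. smoothing h k / real k * s ^ k * of_int (prime_power_sum (quadratic_char D) k)) \<le>
        prime_sum h D + ln (real h) / 2 + C" by (simp add: C_def field_simps)
    hence "exp (real (degree D) / real h +
          (\<Sum>k=1..h. smoothing h k / real k * s ^ k * of_int (prime_power_sum (quadratic_char D) k)))
        \<le> exp (real (degree D) / real h + prime_sum h D + ln (real h) / 2 + C)"
      by (subst exp_le_cancel_iff) linarith
    moreover have "norm (L_fun (of_real s) D) \<le> exp (real (degree D) / real h +
        (\<Sum>k=1..h. smoothing h k / real k * s ^ k * of_int (prime_power_sum (quadratic_char D) k)))"
      unfolding s_def q_def by (rule norm_L_fun_le[OF odd D h])
    ultimately show "norm (L_fun (of_real (real CARD('a) powr (-1 / 2))) D) \<le>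
      exp (real (degree D) / real h + prime_sum h D + ln (real h) / 2 + C)"
      unfolding s_def q_def by (rule order.trans[rotated])
  qed
qed

section \<open>Moments of prime sums\<close>

lemma power_sum_expand:
  fixes x :: "'b \<Rightarrow> 'c::comm_ring_1" and m :: nat
  assumes "finite T"
  shows "(\<Sum>P\<in>T. x P) ^ m = (\<Sum>g\<in>{..<m} \<rightarrow>\<^sub>E T. \<Prod>i<m. x (g i))"
  using prod_sum_PiE[of "{..<m}" "\<lambda>_. T" "\<lambda>_. x"] assms by simp

lemma prod_tuple_eq_prod_fibres:
  fixes x :: "'b \<Rightarrow> 'c::comm_monoid_mult" and m :: nat
  assumes "finite T" "g \<in> {..<m} \<rightarrow>\<^sub>E T"
  shows "(\<Prod>i<m. x (g i)) = (\<Prod>P\<in>T. x P ^ card {i \<in> {..<m}. g i = P})"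
proof -
  have "(\<Prod>i<m. x (g i)) = (\<Prod>P\<in>T. \<Prod>i\<in>{i \<in> {..<m}. g i = P}. x (g i))"
    by (rule prod.group[symmetric]) (use assms in auto)
  also have "\<dots> = (\<Prod>P\<in>T. x P ^ card {i \<in> {..<m}. g i = P})"
  proof (rule prod.cong[OF refl])
    fix P
    have "(\<Prod>i\<in>{i \<in> {..<m}. g i = P}. x (g i)) = (\<Prod>i\<in>{i \<in> {..<m}. g i = P}. x P)"
      by (rule prod.cong) auto
    thus "(\<Prod>i\<in>{i \<in> {..<m}. g i = P}. x (g i)) = x P ^ card {i \<in> {..<m}. g i = P}" by simp
  qed
  finally show ?thesis .
qed

text \<open>The subsets \<open>B\<close> of \<open>T\<close>, equally weighted, serve as the
  probability space of independent uniform signs.\<close>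

definition sign_of :: "'b set \<Rightarrow> 'b \<Rightarrow> real" where
  "sign_of B P = (if P \<in> B then 1 else -1)"

text \<open>Independence of the signs: expanding the product on the right chooses the subset
  \<open>B\<close> where the sign is +1.\<close>

lemma sum_prod_sign_of:
  assumes "finite T"
  shows "(\<Sum>B\<in>Pow T. \<Prod>P\<in>T. f (sign_of B P) P) = (\<Prod>P\<in>T. f 1 P + (f (-1) P :: real))"
proof -
  have "(\<Prod>P\<in>T. f (sign_of B P) P) = (\<Prod>P\<in>B. f 1 P) * (\<Prod>P\<in>T - B. f (-1) P)" if "B \<in> Pow T" for B
  proof -
    have "(\<Prod>P\<in>T. f (sign_of B P) P) = (\<Prod>P\<in>T - B. f (sign_of B P) P) * (\<Prod>P\<in>B. f (sign_of B P) P)"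
      by (rule prod.subset_diff) (use that assms in auto)
    also have "(\<Prod>P\<in>T - B. f (sign_of B P) P) = (\<Prod>P\<in>T - B. f (-1) P)"
      by (rule prod.cong) (auto simp: sign_of_def)
    also have "(\<Prod>P\<in>B. f (sign_of B P) P) = (\<Prod>P\<in>B. f 1 P)"
      by (rule prod.cong) (auto simp: sign_of_def)
    finally show ?thesis by (simp only: mult.commute)
  qed
  hence "(\<Sum>B\<in>Pow T. \<Prod>P\<in>T. f (sign_of B P) P) =
         (\<Sum>B\<in>Pow T. (\<Prod>P\<in>B. f 1 P) * (\<Prod>P\<in>T - B. f (-1) P))"
    by (rule sum.cong[OF refl])
  also have "\<dots> = (\<Prod>P\<in>T. f 1 P + f (-1) P)" by (rule prod_add[OF assms, symmetric])
  finally show ?thesis .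
qed

text \<open>The \<open>m\<close>-th moment of a sum of independent random signs with weights
  \<open>a P\<close>.\<close>

definition sign_moment :: "'b set \<Rightarrow> ('b \<Rightarrow> real) \<Rightarrow> nat \<Rightarrow> real" where
  "sign_moment T a m = (\<Sum>B\<in>Pow T. (\<Sum>P\<in>T. a P * sign_of B P) ^ m) / 2 ^ card T"

text \<open>Both sides are expanded into monomials with nonnegative coefficients. If all exponents
  are even, the sign average is 1 and the symbols are at most 1, possibly 0 when \<open>P\<close>
  divides \<open>D\<close>. If some exponent is odd, the symbol sum vanishes, because
  \<open>m * z \<le> n\<close> keeps the modulus of degree at most \<open>n\<close>.\<close>

theorem quadratic_symbol_moment_le:
  fixes T :: "'a::{finite,field} poly set"
  assumes odd: "odd CARD('a)" and T: "finite T" "T \<subseteq> monic_irreducibles"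
    and deg: "\<And>P. P \<in> T \<Longrightarrow> degree P \<le> z" and a: "\<And>P. P \<in> T \<Longrightarrow> a P \<ge> 0" and mz: "m * z \<le> n"
  shows "(\<Sum>D\<in>monic_of_degree n. (\<Sum>P\<in>T. a P * of_int (quadratic_symbol D P)) ^ m) \<le>
           real CARD('a) ^ n * sign_moment T a m"
proof -
  define G where "G = ({..<m} \<rightarrow>\<^sub>E T)"
  define A where "A = (\<lambda>g. \<Prod>i<m. a (g i))"
  have A: "A g \<ge> 0" if "g \<in> G" for g
    unfolding A_def using a that by (intro prod_nonneg) (auto simp: G_def)
  have key: "(\<Sum>D\<in>monic_of_degree n. \<Prod>i<m. real_of_int (quadratic_symbol D (g i))) \<le>
      real CARD('a) ^ n * ((\<Sum>B\<in>Pow T. \<Prod>i<m. sign_of B (g i)) / 2 ^ card T)" if g: "g \<in> G" for g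
  proof -
    define e where "e = (\<lambda>P. card {i \<in> {..<m}. g i = P})"
    have fib: "(\<Prod>i<m. x (g i)) = (\<Prod>P\<in>T. x P ^ e P)" for x :: "'a poly \<Rightarrow> real"
      using prod_tuple_eq_prod_fibres[OF T(1), of g m x] g by (simp add: G_def e_def)
    have signs: "(\<Sum>B\<in>Pow T. \<Prod>i<m. sign_of B (g i)) = (\<Prod>P\<in>T. 1 + (-1) ^ e P)"
      unfolding fib using sum_prod_sign_of[OF T(1), of "\<lambda>s P. s ^ e P"] by simp
    show ?thesis
    proof (cases "\<forall>P\<in>T. even (e P)")
      case True
      have "(\<Sum>D\<in>monic_of_degree n. \<Prod>i<m. real_of_int (quadratic_symbol D (g i))) \<le>
            (\<Sum>D\<in>(monic_of_degree n :: 'a poly set). 1)"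
      proof (rule sum_mono)
        fix D :: "'a poly"
        have "\<bar>real_of_int (quadratic_symbol D P)\<bar> \<le> 1" for P
          using quadratic_symbol_range[of D P] by auto
        hence "\<bar>\<Prod>i<m. real_of_int (quadratic_symbol D (g i))\<bar> \<le> 1"
          unfolding abs_prod by (intro prod_le_1) auto
        thus "(\<Prod>i<m. real_of_int (quadratic_symbol D (g i))) \<le> 1" by linarith
      qed
      also have "\<dots> = real CARD('a) ^ n" by (simp add: card_monic_of_degree)
      also have "(\<Prod>P\<in>T. 1 + (-1) ^ e P) = (2::real) ^ card T" using True by simp
      hence "real CARD('a) ^ n = real CARD('a) ^ n * ((\<Sum>B\<in>Pow T. \<Prod>i<m. sign_of B (g i)) / 2 ^ card T)"
        unfolding signs by simp
      finally show ?thesis .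
    next
      case False
      then obtain P0 where P0: "P0 \<in> T" "odd (e P0)" by auto
      \<comment> \<open>The total degree of \<open>T\<close> may far exceed \<open>n\<close>. Only
        the at most \<open>m\<close> primes that occur in the monomial may enter the
        modulus.\<close>
      define T' where "T' = {P \<in> T. e P > 0}"
      have T': "finite T'" "T' \<subseteq> monic_irreducibles" "P0 \<in> T'"
        using T P0 by (auto simp: T'_def intro: Nat.gr0I)
      have "(\<Sum>P\<in>T'. degree P) \<le> (\<Sum>P\<in>T'. degree P * e P)"
        by (intro sum_mono) (auto simp: T'_def)
      also have "\<dots> \<le> (\<Sum>P\<in>T. degree P * e P)"
        using T by (intro sum_mono2) (auto simp: T'_def)
      also have "\<dots> = (\<Sum>P\<in>T. \<Sum>i\<in>{i \<in> {..<m}. g i = P}. degree (g i))"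
        by (intro sum.cong refl) (simp add: e_def)
      also have "\<dots> = (\<Sum>i<m. degree (g i))"
        by (rule sum.group) (use T g in \<open>auto simp: G_def\<close>)
      also have "\<dots> \<le> (\<Sum>i<m. z)" using g deg by (intro sum_mono) (auto simp: G_def)
      also have "\<dots> \<le> n" using mz by simp
      finally have le: "(\<Sum>P\<in>T'. degree P) \<le> n" .
      have "(\<Sum>D\<in>monic_of_degree n. \<Prod>i<m. real_of_int (quadratic_symbol D (g i))) =
            (\<Sum>D\<in>monic_of_degree n. \<Prod>P\<in>T. real_of_int (quadratic_symbol D P) ^ e P)"
        by (intro sum.cong refl fib)
      also have "\<dots> = (\<Sum>D\<in>monic_of_degree n. \<Prod>P\<in>T'. real_of_int (quadratic_symbol D P) ^ e P)"
        using T by (intro sum.cong refl prod.mono_neutral_right) (auto simp: T'_def)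
      also have "\<dots> = of_int (\<Sum>D\<in>monic_of_degree n. \<Prod>P\<in>T'. quadratic_symbol D P ^ e P)" by simp
      also have "\<dots> = 0"
        using character_sum_vanishes[where e = e, OF odd T'(1,2,3) P0(2) le] by simp
      also have "0 \<le> real CARD('a) ^ n * ((\<Sum>B\<in>Pow T. \<Prod>i<m. sign_of B (g i)) / 2 ^ card T)"
        unfolding signs by (intro mult_nonneg_nonneg divide_nonneg_nonneg prod_nonneg)
          (auto simp: minus_one_power_iff)
      finally show ?thesis .
    qed
  qed
  have expand: "(\<Sum>P\<in>T. a P * x P) ^ m = (\<Sum>g\<in>G. A g * (\<Prod>i<m. x (g i)))" for x
    unfolding power_sum_expand[OF T(1)] G_def A_def by (simp add: prod.distrib)
  have "(\<Sum>D\<in>monic_of_degree n. (\<Sum>P\<in>T. a P * of_int (quadratic_symbol D P)) ^ m) =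
        (\<Sum>g\<in>G. A g * (\<Sum>D\<in>monic_of_degree n. \<Prod>i<m. real_of_int (quadratic_symbol D (g i))))"
    unfolding expand sum_distrib_left by (rule sum.swap)
  also have "\<dots> \<le> (\<Sum>g\<in>G. A g * (real CARD('a) ^ n * ((\<Sum>B\<in>Pow T. \<Prod>i<m. sign_of B (g i)) / 2 ^ card T)))"
    by (intro sum_mono mult_left_mono key A)
  also have "\<dots> = real CARD('a) ^ n * ((\<Sum>g\<in>G. A g * (\<Sum>B\<in>Pow T. \<Prod>i<m. sign_of B (g i))) / 2 ^ card T)"
    by (simp add: sum_distrib_left sum_divide_distrib mult_ac)
  also have "(\<Sum>g\<in>G. A g * (\<Sum>B\<in>Pow T. \<Prod>i<m. sign_of B (g i))) =
      (\<Sum>B\<in>Pow T. (\<Sum>P\<in>T. a P * sign_of B P) ^ m)"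
    unfolding expand sum_distrib_left by (rule sum.swap)
  finally show ?thesis by (simp add: sign_moment_def)
qed

section \<open>Truncated hyperbolic cosine and large deviations\<close>

lemma cosh_even_sums: "(\<lambda>j. x ^ (2 * j) / fact (2 * j)) sums cosh (x :: real)"
proof -
  have "strict_mono (\<lambda>j::nat. 2 * j)" by (auto intro: strict_monoI)
  moreover have "(if even n then x ^ n /\<^sub>R fact n else 0) = 0" if "n \<notin> range (\<lambda>j::nat. 2 * j)" for n
    using that by (auto elim!: evenE)
  ultimately have "(\<lambda>j. if even (2 * j) then x ^ (2 * j) /\<^sub>R fact (2 * j) else 0) sums cosh x"
    using sums_mono_reindex[of "\<lambda>j. 2 * j" "\<lambda>n. if even n then x ^ n /\<^sub>R fact n else 0" "cosh x"]
      cosh_converges[of x] by blast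
  thus ?thesis by (simp add: field_simps scaleR_conv_of_real)
qed

text \<open>Even powers keep the truncation nonnegative, nonnegative coefficients let moment
  inequalities pass through it, and only moments of order up to \<open>2 * J\<close> occur.\<close>

definition cosh_trunc :: "nat \<Rightarrow> real \<Rightarrow> real" where
  "cosh_trunc J x = (\<Sum>j\<le>J. x ^ (2 * j) / fact (2 * j))"

lemma cosh_trunc_le_cosh: "cosh_trunc J x \<le> cosh x"
  unfolding cosh_trunc_def sums_unique[OF cosh_even_sums]
  by (rule sum_le_suminf) (auto intro: sums_summable[OF cosh_even_sums] simp: zero_le_even_power)

lemma two_power_fact_le: "2 ^ j * fact j \<le> (fact (2 * j) :: real)"
proof (induction j)
  case (Suc j)
  have "2 ^ Suc j * fact (Suc j) = (2 * real (Suc j)) * (2 ^ j * fact j)" by simp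
  also have "\<dots> \<le> (2 * real (Suc j)) * fact (2 * j)" by (intro mult_left_mono Suc) auto
  also have "\<dots> \<le> (2 * real (Suc j)) * (real (2 * j + 1) * fact (2 * j))"
    by (intro mult_left_mono) auto
  also have "\<dots> = fact (2 * Suc j)" by (simp add: algebra_simps)
  finally show ?case .
qed simp

text \<open>Termwise comparison of the series; this is the sub-Gaussian bound for one random
  sign.\<close>

lemma cosh_le_exp_square: "cosh x \<le> exp (x ^ 2 / 2 :: real)"
proof (rule sums_le[OF _ cosh_even_sums exp_converges])
  fix j
  have "x ^ (2 * j) / fact (2 * j) \<le> x ^ (2 * j) / (2 ^ j * fact j)"
    by (intro divide_left_mono two_power_fact_le) (auto simp: zero_le_even_power)
  also have "\<dots> = (x ^ 2 / 2) ^ j /\<^sub>R fact j"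
    by (simp add: power_divide field_simps flip: power_mult)
  finally show "x ^ (2 * j) / fact (2 * j) \<le> (x ^ 2 / 2) ^ j /\<^sub>R fact j" .
qed

text \<open>Replacing \<open>x\<close> by \<open>e x\<close> multiplies the terms beyond \<open>J\<close> by at least \<open>e\<^sup>2\<^sup>J\<close>.\<close>

lemma cosh_le_cosh_trunc:
  assumes "exp 1 * \<bar>x\<bar> \<le> 2 * real J"
  shows "cosh x \<le> 2 * cosh_trunc J x"
proof -
  let ?f = "\<lambda>y j. y ^ (2 * j) / fact (2 * j) :: real"
  have summ: "summable (?f y)" for y by (rule sums_summable[OF cosh_even_sums])
  have nonneg: "0 \<le> ?f y j" for y j by (intro divide_nonneg_nonneg) (simp_all add: power_mult)
  have "cosh x = (\<Sum>j. ?f x (j + Suc J)) + (\<Sum>j<Suc J. ?f x j)"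
    unfolding sums_unique[OF cosh_even_sums] by (rule suminf_split_initial_segment[OF summ])
  moreover have "(\<Sum>j. ?f x (j + Suc J)) \<le> exp (- (2 * real J)) * cosh (exp 1 * x)"
  proof -
    have "(\<Sum>j. ?f x (j + Suc J)) \<le> (\<Sum>j. exp (- (2 * real J)) * ?f (exp 1 * x) (j + Suc J))"
    proof (rule suminf_le)
      fix j
      have "exp (- (2 * real J)) * exp 1 ^ (2 * (j + Suc J)) \<ge> 1"
        by (simp flip: exp_of_nat_mult exp_add)
      hence "1 * ?f x (j + Suc J) \<le> (exp (- (2 * real J)) * exp 1 ^ (2 * (j + Suc J))) * ?f x (j + Suc J)"
        by (intro mult_right_mono nonneg)
      thus "?f x (j + Suc J) \<le> exp (- (2 * real J)) * ?f (exp 1 * x) (j + Suc J)"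
        by (simp only: power_mult_distrib mult_1_left times_divide_eq_right mult.assoc)
    next
      show "summable (\<lambda>j. ?f x (j + Suc J))" by (rule summable_ignore_initial_segment[OF summ])
      show "summable (\<lambda>j. exp (- (2 * real J)) * ?f (exp 1 * x) (j + Suc J))"
        by (rule summable_mult[OF summable_ignore_initial_segment[OF summ]])
    qed
    also have "\<dots> = exp (- (2 * real J)) * (\<Sum>j. ?f (exp 1 * x) (j + Suc J))"
      by (rule suminf_mult[OF summable_ignore_initial_segment[OF summ]])
    also have "(\<Sum>j. ?f (exp 1 * x) (j + Suc J)) \<le> (\<Sum>j. ?f (exp 1 * x) (j + Suc J)) + (\<Sum>j<Suc J. ?f (exp 1 * x) j)"
      by (intro add_increasing2 sum_nonneg) (auto simp: zero_le_even_power)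
    also have "\<dots> = cosh (exp 1 * x)"
      unfolding sums_unique[OF cosh_even_sums] by (rule suminf_split_initial_segment[OF summ, symmetric])
    finally show ?thesis by simp
  qed
  moreover have "cosh (exp 1 * x) \<le> exp (exp 1 * \<bar>x\<bar>)"
  proof -
    have "cosh (exp 1 * x) = cosh \<bar>exp 1 * x\<bar>" by simp
    also have "\<dots> \<le> exp \<bar>exp 1 * x\<bar>" by (simp add: cosh_field_def)
    finally show ?thesis by (simp add: abs_mult)
  qed
  hence "exp (- (2 * real J)) * cosh (exp 1 * x) \<le> exp (- (2 * real J)) * exp (exp 1 * \<bar>x\<bar>)"
    by (rule mult_left_mono) simp
  moreover have "exp (- (2 * real J)) * exp (exp 1 * \<bar>x\<bar>) \<le> 1"
    using assms by (simp flip: exp_add)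
  ultimately have "cosh x \<le> 1 + (\<Sum>j<Suc J. ?f x j)" by linarith
  also have "(\<Sum>j<Suc J. ?f x j) = cosh_trunc J x" by (simp add: cosh_trunc_def lessThan_Suc_atMost)
  also have "1 \<le> cosh_trunc J x"
  proof -
    have "(\<Sum>j\<in>{0}. ?f x j) \<le> cosh_trunc J x"
      unfolding cosh_trunc_def by (intro sum_mono2) (auto simp: zero_le_even_power)
    thus ?thesis by simp
  qed
  finally show ?thesis by simp
qed

text \<open>The moment generating function of independent signs factorises, and each factor is at
  most \<open>exp (c^2 a^2 / 2)\<close>.\<close>

lemma sign_average_cosh_le:
  assumes T: "finite T"
  shows "(\<Sum>B\<in>Pow T. cosh (l * (\<Sum>P\<in>T. a P * sign_of B P))) / 2 ^ card T \<le>
           exp (l ^ 2 * (\<Sum>P\<in>T. a P ^ 2) / 2)"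
proof -
  have E: "(\<Sum>B\<in>Pow T. exp (c * (\<Sum>P\<in>T. a P * sign_of B P))) \<le> 2 ^ card T * exp (c ^ 2 * (\<Sum>P\<in>T. a P ^ 2) / 2)" for c
  proof -
    have "(\<Sum>B\<in>Pow T. exp (c * (\<Sum>P\<in>T. a P * sign_of B P))) =
          (\<Sum>B\<in>Pow T. \<Prod>P\<in>T. exp (c * (a P * sign_of B P)))"
      by (simp add: sum_distrib_left exp_sum[OF T])
    also have "\<dots> = (\<Prod>P\<in>T. exp (c * (a P * 1)) + exp (c * (a P * (-1))))"
      by (rule sum_prod_sign_of[OF T, of "\<lambda>s P. exp (c * (a P * s))"])
    also have "\<dots> = (\<Prod>P\<in>T. 2 * cosh (c * a P))"
      by (intro prod.cong refl) (simp add: cosh_field_def)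
    also have "\<dots> \<le> (\<Prod>P\<in>T. 2 * exp ((c * a P) ^ 2 / 2))"
      by (intro prod_mono conjI mult_left_mono cosh_le_exp_square) auto
    also have "\<dots> = 2 ^ card T * exp (c ^ 2 * (\<Sum>P\<in>T. a P ^ 2) / 2)"
      by (simp add: prod.distrib exp_sum[OF T, symmetric] power_mult_distrib sum_distrib_left sum_divide_distrib)
    finally show ?thesis .
  qed
  have "(\<Sum>B\<in>Pow T. cosh (l * (\<Sum>P\<in>T. a P * sign_of B P))) =
        ((\<Sum>B\<in>Pow T. exp (l * (\<Sum>P\<in>T. a P * sign_of B P))) +
         (\<Sum>B\<in>Pow T. exp ((-l) * (\<Sum>P\<in>T. a P * sign_of B P)))) / 2"
    by (simp add: cosh_field_def sum.distrib sum_divide_distrib add_divide_distrib)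
  also have "\<dots> \<le> 2 ^ card T * exp (l ^ 2 * (\<Sum>P\<in>T. a P ^ 2) / 2)"
    using E[of l] E[of "-l"] by simp
  finally show ?thesis by (simp add: pos_divide_le_eq mult.commute)
qed

text \<open>\<open>2 * J * z \<le> n\<close> permits the comparison of all moments that occur. On
  the side of the random signs there is no restriction on the order, so the truncation may then be
  dropped and the full \<open>cosh\<close> averaged.\<close>

theorem sum_cosh_trunc_le:
  fixes T :: "'a::{finite,field} poly set"
  assumes odd: "odd CARD('a)" and T: "finite T" "T \<subseteq> monic_irreducibles"
    and deg: "\<And>P. P \<in> T \<Longrightarrow> degree P \<le> z" and a: "\<And>P. P \<in> T \<Longrightarrow> a P \<ge> 0" and Jz: "2 * J * z \<le> n"
  shows "(\<Sum>D\<in>monic_of_degree n. cosh_trunc J (l * (\<Sum>P\<in>T. a P * of_int (quadratic_symbol D P)))) \<le>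
           real CARD('a) ^ n * exp (l ^ 2 * (\<Sum>P\<in>T. a P ^ 2) / 2)"
proof -
  let ?S = "\<lambda>D. \<Sum>P\<in>T. a P * of_int (quadratic_symbol D P)"
  let ?X = "\<lambda>B. \<Sum>P\<in>T. a P * sign_of B P"
  have "(\<Sum>D\<in>monic_of_degree n. cosh_trunc J (l * ?S D)) =
        (\<Sum>j\<le>J. l ^ (2 * j) / fact (2 * j) * (\<Sum>D\<in>monic_of_degree n. ?S D ^ (2 * j)))"
  proof -
    have "cosh_trunc J (l * x) = (\<Sum>j\<le>J. l ^ (2 * j) / fact (2 * j) * x ^ (2 * j))" for x
      unfolding cosh_trunc_def by (intro sum.cong refl) (simp add: power_mult_distrib)
    hence "(\<Sum>D\<in>monic_of_degree n. cosh_trunc J (l * ?S D)) =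
        (\<Sum>D\<in>monic_of_degree n. \<Sum>j\<le>J. l ^ (2 * j) / fact (2 * j) * ?S D ^ (2 * j))" by simp
    also have "\<dots> = (\<Sum>j\<le>J. \<Sum>D\<in>monic_of_degree n. l ^ (2 * j) / fact (2 * j) * ?S D ^ (2 * j))"
      by (rule sum.swap)
    finally show ?thesis by (simp only: sum_distrib_left)
  qed
  also have "\<dots> \<le> (\<Sum>j\<le>J. l ^ (2 * j) / fact (2 * j) * (real CARD('a) ^ n * sign_moment T a (2 * j)))"
  proof (intro sum_mono mult_left_mono quadratic_symbol_moment_le[where z = z] odd T deg a)
    fix j assume "j \<in> {..J}"
    hence "2 * j * z \<le> 2 * J * z" by (intro mult_right_mono) auto
    thus "2 * j * z \<le> n" using Jz by linarith
  qed (auto simp: zero_le_even_power)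
  also have "\<dots> = real CARD('a) ^ n * ((\<Sum>j\<le>J. \<Sum>B\<in>Pow T. (l * ?X B) ^ (2 * j) / fact (2 * j)) / 2 ^ card T)"
  proof -
    have "l ^ (2 * j) / fact (2 * j) * (real CARD('a) ^ n * sign_moment T a (2 * j)) =
        real CARD('a) ^ n * ((\<Sum>B\<in>Pow T. (l * ?X B) ^ (2 * j) / fact (2 * j)) / 2 ^ card T)" for j
    proof -
      have "(\<Sum>B\<in>Pow T. (l * ?X B) ^ (2 * j) / fact (2 * j)) =
            l ^ (2 * j) / fact (2 * j) * (\<Sum>B\<in>Pow T. ?X B ^ (2 * j))"
        by (subst sum_distrib_left) (simp only: power_mult_distrib times_divide_eq_left)
      thus ?thesis by (simp add: sign_moment_def)
    qed
    thus ?thesis by (simp only: sum_distrib_left sum_divide_distrib)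
  qed
  also have "(\<Sum>j\<le>J. \<Sum>B\<in>Pow T. (l * ?X B) ^ (2 * j) / fact (2 * j)) = (\<Sum>B\<in>Pow T. cosh_trunc J (l * ?X B))"
    unfolding cosh_trunc_def by (rule sum.swap)
  also have "\<dots> \<le> (\<Sum>B\<in>Pow T. cosh (l * ?X B))" by (intro sum_mono cosh_trunc_le_cosh)
  also have "real CARD('a) ^ n * ((\<Sum>B\<in>Pow T. cosh (l * ?X B)) / 2 ^ card T) \<le>
      real CARD('a) ^ n * exp (l ^ 2 * (\<Sum>P\<in>T. a P ^ 2) / 2)"
    by (intro mult_left_mono sign_average_cosh_le T) auto
  finally show ?thesis by (simp add: divide_right_mono mult_left_mono)
qed

text \<open>Markov's inequality for the moment of order \<open>2J \<approx> V\<close>.\<close>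

theorem large_deviation:
  fixes T :: "'a::{finite,field} poly set"
  assumes odd: "odd CARD('a)" and T: "finite T" "T \<subseteq> monic_irreducibles"
    and deg: "\<And>P. P \<in> T \<Longrightarrow> degree P \<le> z" and a: "\<And>P. P \<in> T \<Longrightarrow> a P \<ge> 0"
    and W: "(\<Sum>P\<in>T. a P ^ 2) \<le> W" "W > 0" and V: "V \<ge> 4" "V * real z \<le> real n"
    and c: "c \<ge> 0" "exp 1 * W / V \<le> exp (- 4 * c)"
  shows "real (card {D \<in> monic_of_degree n. \<bar>\<Sum>P\<in>T. a P * of_int (quadratic_symbol D P)\<bar> > V}) \<le>
           real CARD('a) ^ n * exp (- c * V)"
proof -
  let ?S = "\<lambda>D. \<Sum>P\<in>T. a P * of_int (quadratic_symbol D P)"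
  \<comment> \<open>From \<open>V \<ge> 4\<close> follows \<open>V / 4 \<le> J \<le> V / 2\<close>:
    the upper bound keeps the order of the moment admissible, the lower one yields the decay in
    \<open>V\<close>.\<close>
  define J where "J = nat \<lfloor>V / 2\<rfloor>"
  have J: "real J \<le> V / 2" "real J \<ge> V / 4" "real J \<ge> 1"
    using V(1) unfolding J_def by linarith+
  have "2 * real J * real z \<le> V * real z" using J by (intro mult_right_mono) auto
  hence "real (2 * J * z) \<le> real n" using V(2) by simp
  hence Jz: "2 * J * z \<le> n" by linarith
  \<comment> \<open>This \<open>l\<close> minimises \<open>exp (l^2 W / 2)\<close> divided by the
    \<open>2 J\<close>-th power of \<open>l\<close>; the exponential becomes
    \<open>exp J\<close>.\<close>
  define l where "l = sqrt (2 * real J / W)"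
  have l: "l ^ 2 = 2 * real J / W" "l > 0" using J W by (simp_all add: l_def)
  define B where "B = {D \<in> monic_of_degree n. \<bar>?S D\<bar> > V}"
  define X where "X = (l ^ 2 * V ^ 2) ^ J / fact (2 * J)"
  have X: "X > 0" using l V J W(2) by (auto simp: X_def intro!: divide_pos_pos zero_less_power mult_pos_pos)
  have "real (card B) * X = (\<Sum>D\<in>B. X)" by simp
  also have "\<dots> \<le> (\<Sum>D\<in>B. cosh_trunc J (l * ?S D))"
  proof (rule sum_mono)
    fix D assume D: "D \<in> B"
    have "V ^ 2 \<le> \<bar>?S D\<bar> ^ 2" using D V by (intro power_mono) (auto simp: B_def)
    hence "V ^ 2 \<le> ?S D ^ 2" by (simp only: power2_abs)
    hence "l ^ 2 * V ^ 2 \<le> l ^ 2 * ?S D ^ 2" by (rule mult_left_mono) simp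
    hence "(l ^ 2 * V ^ 2) ^ J \<le> (l ^ 2 * ?S D ^ 2) ^ J" by (rule power_mono) simp
    also have "\<dots> = (l * ?S D) ^ (2 * J)" by (simp add: power_mult power_mult_distrib)
    finally have "X \<le> (\<Sum>j\<in>{J}. (l * ?S D) ^ (2 * j) / fact (2 * j))"
      by (simp add: X_def divide_right_mono)
    also have "\<dots> \<le> cosh_trunc J (l * ?S D)"
      unfolding cosh_trunc_def by (intro sum_mono2) (auto simp: zero_le_even_power)
    finally show "X \<le> cosh_trunc J (l * ?S D)" .
  qed
  also have "\<dots> \<le> (\<Sum>D\<in>monic_of_degree n. cosh_trunc J (l * ?S D))"
    by (intro sum_mono2) (auto simp: B_def cosh_trunc_def zero_le_even_power intro!: sum_nonneg)
  also have "\<dots> \<le> real CARD('a) ^ n * exp (l ^ 2 * (\<Sum>P\<in>T. a P ^ 2) / 2)"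
    by (rule sum_cosh_trunc_le[OF odd T deg a Jz])
  also have "\<dots> \<le> real CARD('a) ^ n * exp (real J)"
  proof -
    have "l ^ 2 * (\<Sum>P\<in>T. a P ^ 2) \<le> l ^ 2 * W" using W by (intro mult_left_mono) auto
    also have "\<dots> = 2 * real J" using l W by simp
    finally show ?thesis by (intro mult_left_mono) auto
  qed
  finally have "real (card B) \<le> real CARD('a) ^ n * (exp (real J) / X)"
    using X by (simp add: pos_le_divide_eq)
  also have "exp (real J) / X \<le> exp (- c * V)"
  proof -
    have "exp (real J) / X = exp 1 ^ J * fact (2 * J) / (l ^ 2 * V ^ 2) ^ J"
      by (simp add: X_def flip: exp_of_nat_mult)
    also have "\<dots> \<le> exp 1 ^ J * real ((2 * J) ^ (2 * J)) / (l ^ 2 * V ^ 2) ^ J"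
      using fact_le_power[of "2 * J", where ?'a = real]
      by (intro divide_right_mono mult_left_mono) (auto simp: fact_le_power)
    also have "\<dots> = (exp 1 * (2 * real J) ^ 2 / (l ^ 2 * V ^ 2)) ^ J"
      by (simp add: power_mult power_mult_distrib power_divide)
    also have "exp 1 * (2 * real J) ^ 2 / (l ^ 2 * V ^ 2) = exp 1 * W / V * (2 * real J / V)"
      unfolding l(1) using J W V by (simp add: field_simps power2_eq_square)
    also have "\<dots> \<le> exp (- 4 * c) * 1"
      using c J W V by (intro mult_mono) (auto simp: divide_le_eq)
    hence "(exp 1 * W / V * (2 * real J / V)) ^ J \<le> exp (- 4 * c) ^ J"
      using J W V by (intro power_mono) (auto intro!: mult_nonneg_nonneg divide_nonneg_nonneg)
    also have "\<dots> = exp (- (4 * c * real J))" by (simp flip: exp_of_nat_mult add: mult_ac)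
    also have "\<dots> \<le> exp (- c * V)"
    proof -
      have "c * V \<le> c * (4 * real J)" using J c by (intro mult_left_mono) auto
      thus ?thesis by simp
    qed
    finally show ?thesis .
  qed
  finally show ?thesis by (simp add: B_def mult_left_mono)
qed

section \<open>Moments of central values\<close>

text \<open>The degrees are cut to \<open>y < degree P \<le> z\<close>, while \<open>h\<close> stays
  the smoothing parameter of the whole sum, so that adjacent ranges add up to
  \<open>prime_sum h\<close>.\<close>

definition prime_sum_range :: "nat \<Rightarrow> nat \<Rightarrow> nat \<Rightarrow> 'a::{finite,field} poly \<Rightarrow> real" where
  "prime_sum_range y z h D = (\<Sum>P\<in>{P \<in> monic_irreducibles_upto z. y < degree P}.
     smoothing h (degree P) * (real CARD('a) powr (-1 / 2)) ^ degree P * of_int (quadratic_symbol D P))"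

lemma prime_sum_eq_range: "prime_sum h D = prime_sum_range 0 h h D"
proof -
  have "{P \<in> monic_irreducibles_upto h. 0 < degree P} = (monic_irreducibles_upto h :: 'a poly set)"
    using monic_irreducibles_degree_pos by (auto simp: monic_irreducibles_upto_def)
  thus ?thesis by (simp add: prime_sum_def prime_sum_range_def)
qed

lemma prime_sum_split:
  fixes D :: "'a::{finite,field} poly"
  assumes "z \<le> h"
  shows "prime_sum h D = prime_sum_range 0 z h D + prime_sum_range z h h D"
proof -
  have "{P \<in> monic_irreducibles_upto h. 0 < degree (P :: 'a poly)} =
        {P \<in> monic_irreducibles_upto z. 0 < degree P} \<union> {P \<in> monic_irreducibles_upto h. z < degree P}"
    using assms by (auto simp: monic_irreducibles_upto_def)
  thus ?thesis unfolding prime_sum_eq_range prime_sum_range_def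
    by (simp only:) (rule sum.union_disjoint, simp, simp, auto simp: monic_irreducibles_upto_def)
qed

text \<open>Linear primes get weight 0 for \<open>h = 1\<close>. In the crude moment bound this
  makes \<open>h = 1\<close> admissible for every \<open>D\<close>.\<close>

lemma prime_sum_1 [simp]: "prime_sum (Suc 0) D = 0"
proof -
  have "smoothing (Suc 0) (degree P) = 0" if "P \<in> monic_irreducibles_upto (Suc 0)" for P :: "'a poly"
  proof -
    have "degree P = Suc 0" using that monic_irreducibles_degree_pos[of P]
      by (simp add: monic_irreducibles_upto_def)
    thus ?thesis by (simp add: smoothing_def)
  qed
  thus ?thesis by (simp add: prime_sum_def)
qed

text \<open>There are at most \<open>q^k / k\<close> irreducibles of degree \<open>k\<close>, each
  with squared weight at most \<open>q^(-k)\<close>.\<close>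

lemma variance_le:
  assumes odd: "odd CARD('a::{finite,field})" and zh: "z \<le> h"
  shows "(\<Sum>P\<in>{P \<in> monic_irreducibles_upto z. y < degree (P :: 'a poly)}.
           (smoothing h (degree P) * (real CARD('a) powr (-1 / 2)) ^ degree P) ^ 2) \<le> (\<Sum>k\<in>{y<..z}. 1 / real k)"
proof -
  define q where "q = real CARD('a)"
  define s where "s = q powr (-1 / 2)"
  have q: "q \<ge> 3" using card_field_ge_3[OF odd] by (simp add: q_def)
  have "s ^ 2 = q powr (-1)" using q by (simp add: s_def powr_power)
  hence s2: "s ^ 2 = 1 / q" using q by (simp add: powr_minus_divide)
  have eq: "{P \<in> monic_irreducibles_upto z. y < degree (P :: 'a poly)} = (\<Union>k\<in>{y<..z}. irreducibles_of_degree k)"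
    by (auto simp: monic_irreducibles_upto_def irreducibles_of_degree_def)
  have "(\<Sum>P\<in>{P \<in> monic_irreducibles_upto z. y < degree (P :: 'a poly)}. (smoothing h (degree P) * s ^ degree P) ^ 2) =
        (\<Sum>k\<in>{y<..z}. \<Sum>P\<in>irreducibles_of_degree k. (smoothing h (degree (P :: 'a poly)) * s ^ degree P) ^ 2)"
    unfolding eq by (rule sum.UNION_disjoint) (simp_all, auto simp: irreducibles_of_degree_def)
  also have "\<dots> \<le> (\<Sum>k\<in>{y<..z}. 1 / real k)"
  proof (rule sum_mono)
    fix k assume k: "k \<in> {y<..z}"
    have "(\<Sum>P\<in>irreducibles_of_degree k. (smoothing h (degree (P :: 'a poly)) * s ^ degree P) ^ 2) =
          (\<Sum>P\<in>(irreducibles_of_degree k :: 'a poly set). (smoothing h k) ^ 2 * (s ^ 2) ^ k)"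
      by (intro sum.cong refl) (auto simp: irreducibles_of_degree_def power_mult_distrib mult.commute simp flip: power_mult)
    also have "\<dots> = real (card (irreducibles_of_degree k :: 'a poly set)) * ((smoothing h k) ^ 2 * (1 / q ^ k))"
      by (simp add: s2 power_divide)
    also have "\<dots> \<le> real (card (irreducibles_of_degree k :: 'a poly set)) * (1 * (1 / q ^ k))"
      using q k zh smoothing_nonneg[of k h] smoothing_le_1[of k h]
      by (intro mult_left_mono mult_right_mono power_le_one) auto
    also have "\<dots> \<le> 1 / real k"
    proof -
      have "real (k * card (irreducibles_of_degree k :: 'a poly set)) \<le> real (CARD('a) ^ k)"
        unfolding of_nat_le_iff irreducibles_of_degree_def by (rule card_irreducibles_of_degree)
      hence "real k * real (card (irreducibles_of_degree k :: 'a poly set)) \<le> q ^ k" by (simp add: q_def)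
      thus ?thesis using k q by (simp add: field_simps)
    qed
    finally show "(\<Sum>P\<in>irreducibles_of_degree k. (smoothing h (degree (P :: 'a poly)) * s ^ degree P) ^ 2) \<le> 1 / real k" .
  qed
  finally show ?thesis by (simp add: s_def q_def)
qed

lemma sum_inverse_range_le_ln:
  assumes "1 \<le> y" "y \<le> z"
  shows "(\<Sum>k\<in>{y<..z}. 1 / real k) \<le> ln (real z) - ln (real y)"
  using assms(2)
proof (induction z rule: dec_induct)
  case (step n)
  have "ln (real n / real (Suc n)) \<le> real n / real (Suc n) - 1"
    using step assms by (intro ln_le_minus_one) auto
  also have "\<dots> = - 1 / real (Suc n)" by (simp add: field_simps)
  finally have "1 / real (Suc n) \<le> ln (real (Suc n)) - ln (real n)"
    using step assms by (simp add: ln_div)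
  moreover have "{y<..Suc n} = insert (Suc n) {y<..n}" using step by auto
  ultimately show ?case using step by simp
qed simp

lemma prime_sum_range_deviation:
  assumes odd: "odd CARD('a::{finite,field})" and zh: "z \<le> h"
    and W: "(\<Sum>k\<in>{y<..z}. 1 / real k) \<le> W" "W > 0" and V: "V \<ge> 4" "V * real z \<le> real n"
    and c: "c \<ge> 0" "exp 1 * W / V \<le> exp (- 4 * c)"
  shows "real (card {D \<in> monic_of_degree n. \<bar>prime_sum_range y z h (D :: 'a poly)\<bar> > V}) \<le>
           real CARD('a) ^ n * exp (- c * V)"
  unfolding prime_sum_range_def
proof (rule large_deviation[OF odd _ _ _ _ _ W(2) V c])
  show "(\<Sum>P\<in>{P \<in> monic_irreducibles_upto z. y < degree (P :: 'a poly)}.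
           (smoothing h (degree P) * (real CARD('a) powr (-1 / 2)) ^ degree P) ^ 2) \<le> W"
    using variance_le[OF odd zh, of y] W(1) by linarith
  fix P :: "'a poly" assume "P \<in> {P \<in> monic_irreducibles_upto z. y < degree P}"
  thus "0 \<le> smoothing h (degree P) * (real CARD('a) powr (-1 / 2)) ^ degree P" "degree P \<le> z"
    using zh by (auto simp: monic_irreducibles_upto_def intro!: mult_nonneg_nonneg smoothing_nonneg)
qed (simp, auto simp: monic_irreducibles_upto_def)

lemma prime_sum_range_cosh_trunc:
  assumes odd: "odd CARD('a::{finite,field})" and zh: "z \<le> h"
    and W: "(\<Sum>k\<in>{y<..z}. 1 / real k) \<le> W" and J: "2 * J * z \<le> n"
  shows "(\<Sum>D\<in>monic_of_degree n. cosh_trunc J (l * prime_sum_range y z h (D :: 'a poly))) \<le>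
           real CARD('a) ^ n * exp (l ^ 2 * W / 2)"
proof -
  let ?T = "{P \<in> monic_irreducibles_upto z. y < degree (P :: 'a poly)}"
  let ?a = "\<lambda>P :: 'a poly. smoothing h (degree P) * (real CARD('a) powr (-1 / 2)) ^ degree P"
  have "(\<Sum>D\<in>monic_of_degree n. cosh_trunc J (l * (\<Sum>P\<in>?T. ?a P * of_int (quadratic_symbol D P)))) \<le>
           real CARD('a) ^ n * exp (l ^ 2 * (\<Sum>P\<in>?T. ?a P ^ 2) / 2)"
  proof (rule sum_cosh_trunc_le[OF odd _ _ _ _ J])
    fix P :: "'a poly" assume "P \<in> ?T"
    thus "0 \<le> ?a P" "degree P \<le> z"
      using zh by (auto simp: monic_irreducibles_upto_def intro!: mult_nonneg_nonneg smoothing_nonneg)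
  qed (simp, auto simp: monic_irreducibles_upto_def)
  also have "\<dots> \<le> real CARD('a) ^ n * exp (l ^ 2 * W / 2)"
    using variance_le[OF odd zh, of y] W
    by (intro mult_left_mono iffD2[OF exp_le_cancel_iff] divide_right_mono) auto
  finally show ?thesis by (simp add: prime_sum_range_def)
qed

section \<open>Density of square-free polynomials\<close>

lemma monic_squarefree_subset: "monic_squarefree n \<subseteq> monic_of_degree n"
  by (auto simp: monic_squarefree_def monic_of_degree_def)

lemma finite_monic_squarefree [simp, intro]: "finite (monic_squarefree n)"
  by (rule finite_subset[OF monic_squarefree_subset finite_monic_of_degree])

text \<open>Non-square-free polynomials are of the form \<open>A^2 g\<close> with \<open>A\<close>
  monic of some degree \<open>a \<ge> 1\<close>, at most \<open>q^(n - a)\<close> for each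
  \<open>a\<close>. Since \<open>q \<ge> 3\<close>, these numbers add up to at most half of
  \<open>q^n\<close>.\<close>

lemma card_monic_squarefree_ge:
  assumes odd: "odd CARD('a::{finite,field})"
  shows "real CARD('a) ^ n \<le> 2 * real (card (monic_squarefree n :: 'a poly set))"
proof -
  define q where "q = CARD('a)"
  have q: "q \<ge> 3" using card_field_ge_3[OF odd] by (simp add: q_def)
  define X where "X = (\<Union>a\<in>{1..n div 2}. (\<lambda>(A, g). A ^ 2 * g) ` (monic_of_degree a \<times> (monic_of_degree (n - 2 * a) :: 'a poly set)))"
  have sub: "monic_of_degree n - monic_squarefree n \<subseteq> X"
  proof
    fix f :: "'a poly" assume f: "f \<in> monic_of_degree n - monic_squarefree n"
    hence fm: "f \<in> monic_polys" "degree f = n" "f \<noteq> 0" "\<not> squarefree f"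
      by (auto simp: monic_of_degree_def monic_squarefree_def monic_polys_nonzero)
    then obtain x where x: "x ^ 2 dvd f" "\<not> x dvd 1" unfolding squarefree_def by blast
    have x0: "x \<noteq> 0" using x fm by auto
    obtain A where A: "A \<in> monic_polys" "A dvd x" "degree A = degree x"
      using monic_associate_exists[OF x0] by metis
    have "A ^ 2 dvd f" by (rule dvd_trans[OF dvd_power_same[OF A(2)] x(1)])
    then obtain g where g: "f = A ^ 2 * g" by auto
    have gm: "g \<in> monic_polys" using fm g A monic_polys_power monic_polys_multD by blast
    have "degree A \<ge> 1" using A x x0 poly_unit_iff_degree_0[OF x0] by simp
    moreover have "n = 2 * degree A + degree g"
      using g fm A gm monic_polys_nonzero
      by (auto simp: degree_mult_eq degree_power_eq power2_eq_square)
    ultimately show "f \<in> X"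
      unfolding X_def using A gm g
      by (intro UN_I[of "degree A"] image_eqI[of _ _ "(A, g)"]) (auto simp: monic_of_degree_def)
  qed
  have "card X \<le> (\<Sum>a\<in>{1..n div 2}. card ((\<lambda>(A, g). A ^ 2 * g) ` (monic_of_degree a \<times> (monic_of_degree (n - 2 * a) :: 'a poly set))))"
    unfolding X_def by (rule card_UN_le) simp
  also have "\<dots> \<le> (\<Sum>a\<in>{1..n div 2}. q ^ (n - a))"
  proof (rule sum_mono)
    fix a assume a: "a \<in> {1..n div 2}"
    have "card ((\<lambda>(A, g). A ^ 2 * g) ` (monic_of_degree a \<times> (monic_of_degree (n - 2 * a) :: 'a poly set))) \<le>
          card ((monic_of_degree a :: 'a poly set) \<times> (monic_of_degree (n - 2 * a) :: 'a poly set))"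
      by (rule card_image_le) simp
    also have "\<dots> = q ^ a * q ^ (n - 2 * a)"
      by (simp add: card_cartesian_product card_monic_of_degree q_def)
    also have "\<dots> = q ^ (a + (n - 2 * a))" by (rule power_add[symmetric])
    also have "a + (n - 2 * a) = n - a" using a by auto
    finally show "card ((\<lambda>(A, g). A ^ 2 * g) ` (monic_of_degree a \<times> (monic_of_degree (n - 2 * a) :: 'a poly set))) \<le> q ^ (n - a)" .
  qed
  \<comment> \<open>The extra term \<open>q ^ (n - m)\<close> strengthens the claim so that the
    induction closes with \<open>3 * q ^ (n - Suc m) \<le> q ^ (n - m)\<close>.\<close>
  also have "2 * (\<Sum>a\<in>{1..m}. q ^ (n - a)) + q ^ (n - m) \<le> q ^ n" if "m \<le> n" for m
    using that
  proof (induction m)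
    case (Suc m)
    have "n - m = Suc (n - Suc m)" using Suc.prems by simp
    hence "3 * q ^ (n - Suc m) \<le> q ^ (n - m)" using q by simp
    thus ?case using Suc by simp
  qed simp
  from this[of "n div 2"] have "2 * (\<Sum>a\<in>{1..n div 2}. q ^ (n - a)) \<le> q ^ n" by simp
  finally have "2 * card X \<le> q ^ n" by simp
  moreover have "card (monic_of_degree n - monic_squarefree n :: 'a poly set) \<le> card X"
    by (rule card_mono[OF _ sub]) (auto simp: X_def)
  moreover have "card (monic_of_degree n - monic_squarefree n :: 'a poly set) = q ^ n - card (monic_squarefree n :: 'a poly set)"
    using monic_squarefree_subset by (subst card_Diff_subset) (auto simp: card_monic_of_degree q_def)
  ultimately have "q ^ n \<le> 2 * card (monic_squarefree n :: 'a poly set)" by linarith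
  hence "real (q ^ n) \<le> real (2 * card (monic_squarefree n :: 'a poly set))" by (rule of_nat_mono)
  thus ?thesis by (simp add: q_def)
qed

section \<open>Averages of central values\<close>

definition central_value :: "'a::{finite,field} poly \<Rightarrow> real" where
  "central_value D = norm (L_fun (of_real (real CARD('a) powr (- 1 / 2))) D)"

lemma central_value_nonneg [simp]: "central_value D \<ge> 0"
  by (simp add: central_value_def)

lemma central_value_bound:
  assumes odd: "odd CARD('a::{finite,field})"
  obtains C where "C \<ge> 0" "\<And>(D :: 'a poly) n h. D \<in> monic_squarefree n \<Longrightarrow> even n \<Longrightarrow> n > 0 \<Longrightarrow> h > 0 \<Longrightarrow> h \<le> n \<Longrightarrow>
    central_value D \<le> exp (real n / real h + prime_sum h D + ln (real n) / 2 + C)"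
proof -
  obtain C where C: "\<And>(D :: 'a poly) h. D \<in> monic_polys \<Longrightarrow> squarefree D \<Longrightarrow> even (degree D) \<Longrightarrow>
    degree D > 0 \<Longrightarrow> h > 0 \<Longrightarrow> norm (L_fun (of_real (real CARD('a) powr (- 1 / 2))) D) \<le>
      exp (real (degree D) / real h + prime_sum h D + ln (real h) / 2 + C)"
    by (rule ln_L_fun_bound[OF odd]) (rule that)
  show ?thesis
  proof (rule that[of "\<bar>C\<bar>"])
    fix D :: "'a poly" and n h
    assume *: "D \<in> monic_squarefree n" "even n" "n > 0" "h > 0" "h \<le> n"
    have "central_value D \<le> exp (real n / real h + prime_sum h D + ln (real h) / 2 + C)"
      using C[of D h] * by (auto simp: monic_squarefree_def central_value_def)
    also have "ln (real h) \<le> ln (real n)" using * by simp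
    hence "exp (real n / real h + prime_sum h D + ln (real h) / 2 + C) \<le>
           exp (real n / real h + prime_sum h D + ln (real n) / 2 + \<bar>C\<bar>)"
      unfolding exp_le_cancel_iff using abs_ge_self[of C] by linarith
    finally show "central_value D \<le> exp (real n / real h + prime_sum h D + ln (real n) / 2 + \<bar>C\<bar>)" .
  qed simp
qed

lemma sum_indicator_subset:
  assumes "finite A" "X \<subseteq> A"
  shows "(\<Sum>x\<in>A. indicator X x) = real (card X)"
proof -
  have "(\<Sum>x\<in>A. indicator X x) = (\<Sum>x\<in>X. indicator X x :: real)"
    by (rule sum.mono_neutral_right) (use assms in auto)
  thus ?thesis by simp
qed

lemma exp_mult_power: "exp x ^ k = exp (real k * x)"
  by (rule exp_of_nat_mult[symmetric])

text \<open>For each \<open>D\<close> the longest admissible prime sum is used.\<close>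

lemma crude_moment_bound:
  fixes K :: nat
  assumes odd: "odd CARD('a::{finite,field})"
  obtains A where "A \<ge> 0" "\<forall>\<^sub>F n in sequentially. even n \<longrightarrow>
    (\<Sum>D\<in>(monic_squarefree n :: 'a poly set). central_value D ^ K) \<le> real CARD('a) ^ n * exp (A * ln (real n))"
proof -
  define q where "q = real CARD('a)"
  have q: "q > 0" by (simp add: q_def)
  obtain C where C: "C \<ge> 0" "\<And>(D :: 'a poly) n h. D \<in> monic_squarefree n \<Longrightarrow> even n \<Longrightarrow> n > 0 \<Longrightarrow> h > 0 \<Longrightarrow> h \<le> n \<Longrightarrow>
    central_value D \<le> exp (real n / real h + prime_sum h D + ln (real n) / 2 + C)"
    by (rule central_value_bound[OF odd]) (rule that)
  \<comment> \<open>On a bad set the value is at most \<open>exp (6 K V)\<close>; density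
    \<open>exp (- c V)\<close> then leaves \<open>exp (- V)\<close>.\<close>
  define c where "c = 6 * real K + 1"
  \<comment> \<open>Makes \<open>exp 1 * W / V\<close> at most \<open>exp (- 4 * c)\<close> for
    variance \<open>W = 2 log n\<close> and threshold \<open>V \<ge> lam log n\<close>.\<close>
  define lam where "lam = 2 * exp 1 * exp (4 * c)"
  have c: "c \<ge> 1" by (simp add: c_def)
  have "1 * 1 * 1 \<le> lam" unfolding lam_def using c by (intro mult_mono) auto
  hence lam: "lam \<ge> 1" by simp
  \<comment> \<open>\<open>4 * lam\<close> comes from \<open>2 n / h0\<close>, and
    \<open>3 / 2\<close> from \<open>log n / 2\<close> together with \<open>C \<le> log n\<close>.
    The final \<open>+ 1\<close> absorbs the factor 2 lost in adding the bad sets.\<close>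
  define A where "A = real K * (4 * lam + 3 / 2) + 1"
  have A: "A \<ge> 0" using lam by (simp add: A_def)
  have ev: "\<forall>\<^sub>F n in sequentially. ln (real n) \<ge> 4 \<and> ln (real n) \<ge> C \<and> real n \<ge> 2 * lam * ln (real n) \<and> n > 0"
  proof (intro eventually_conj)
    show "\<forall>\<^sub>F n in sequentially. ln (real n) \<ge> 4" by real_asymp
    show "\<forall>\<^sub>F n in sequentially. ln (real n) \<ge> C" by real_asymp
    show "\<forall>\<^sub>F n in sequentially. real n \<ge> 2 * lam * ln (real n)" using lam by real_asymp
    show "\<forall>\<^sub>F n in sequentially. n > (0::nat)" by (rule eventually_gt_at_top)
  qed
  have "\<forall>\<^sub>F n in sequentially. even n \<longrightarrow>
    (\<Sum>D\<in>(monic_squarefree n :: 'a poly set). central_value D ^ K) \<le> q ^ n * exp (A * ln (real n))"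
    using ev
  proof eventually_elim
    case (elim n)
    define lg where "lg = ln (real n)"
    have l: "lg \<ge> 4" "lg \<ge> C" "real n \<ge> 2 * lam * lg" "n > 0" using elim by (auto simp: lg_def)
    \<comment> \<open>The largest length for which the threshold \<open>n / h\<close> stays above
      \<open>lam log n\<close>, so that the deviation estimate applies.\<close>
    define x where "x = real n / (lam * lg)"
    have ll: "lam * lg \<ge> lg" using lam l mult_right_mono[of 1 lam lg] by simp
    have x: "x \<ge> 2" using l ll by (simp add: x_def pos_le_divide_eq mult_ac)
    define h0 where "h0 = nat \<lfloor>x\<rfloor>"
    have h0: "real h0 \<le> x" "real h0 \<ge> x / 2" "h0 \<ge> 1" using x unfolding h0_def by linarith+
    have "lam * lg \<ge> 1" using l ll by linarith
    hence "x \<le> real n / 1" unfolding x_def by (intro divide_left_mono) auto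
    hence "x \<le> real n" by simp
    hence h0n: "h0 \<le> n" using h0 by linarith
    have nh0: "real n / real h0 \<le> 2 * (lam * lg)"
    proof -
      have "real n = x * (lam * lg)" using l ll by (simp add: x_def)
      also have "\<dots> \<le> (2 * real h0) * (lam * lg)" using h0 l ll by (intro mult_right_mono) auto
      finally show ?thesis using h0 by (simp add: pos_divide_le_eq mult_ac)
    qed
    have V: "real n / real h \<ge> lam * lg" if h: "1 \<le> h" "h \<le> h0" for h
    proof -
      have "real h * (lam * lg) \<le> x * (lam * lg)" using h h0 l ll by (intro mult_right_mono) auto
      also have "\<dots> = real n" using l ll by (simp add: x_def)
      finally show ?thesis using h by (simp add: pos_le_divide_eq mult_ac)
    qed
    define E0 where "E0 = exp (real K * (4 * (lam * lg) + lg / 2 + C))"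
    define bad where "bad = (\<lambda>h. {D \<in> monic_of_degree n. \<bar>prime_sum_range 0 h h (D :: 'a poly)\<bar> > real n / real h})"
    have pointwise: "central_value D ^ K \<le> E0 + (\<Sum>h\<in>{2..h0}. exp (6 * real K * (real n / real h)) * indicator (bad h) D)"
      if D: "D \<in> monic_squarefree n" and n: "even n" for D :: "'a poly"
    proof -
      \<comment> \<open>At the maximal good \<open>h\<close>, either \<open>h = h0\<close> and the
        bound is polynomial in \<open>n\<close>, or \<open>h + 1\<close> is bad, which happens
        rarely while \<open>n / h\<close> is at most twice \<open>n / (h + 1)\<close>.\<close>
      define good where "good = {h \<in> {1..h0}. \<bar>prime_sum h D\<bar> \<le> real n / real h}"
      have "1 \<in> good" using h0 by (auto simp: good_def)
      hence "finite good" "good \<noteq> {}" by (auto simp: good_def)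
      define h where "h = Max good"
      have "h \<in> good" unfolding h_def by (rule Max_in) fact+
      hence h: "1 \<le> h" "h \<le> h0" "\<bar>prime_sum h D\<bar> \<le> real n / real h" by (auto simp: good_def)
      have nonneg: "0 \<le> (\<Sum>h\<in>{2..h0}. exp (6 * real K * (real n / real h)) * indicator (bad h) D :: real)"
        by (intro sum_nonneg) auto
      have "central_value D \<le> exp (real n / real h + prime_sum h D + lg / 2 + C)"
        unfolding lg_def using h h0n l by (intro C(2) D n) auto
      also have "\<dots> \<le> exp (2 * (real n / real h) + lg / 2 + C)" using h by simp
      finally have "central_value D ^ K \<le> exp (2 * (real n / real h) + lg / 2 + C) ^ K"
        by (rule power_mono) simp
      hence bound: "central_value D ^ K \<le> exp (real K * (2 * (real n / real h) + lg / 2 + C))"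
        by (simp only: exp_mult_power)
      show ?thesis
      proof (cases "h = h0")
        case True
        have "real K * (2 * (real n / real h) + lg / 2 + C) \<le> real K * (4 * (lam * lg) + lg / 2 + C)"
          using nh0 True by (intro mult_left_mono) auto
        hence "central_value D ^ K \<le> E0" using bound unfolding E0_def by (meson exp_le_cancel_iff order_trans)
        thus ?thesis using nonneg by linarith
      next
        case False
        define h' where "h' = Suc h"
        have h': "h' \<in> {2..h0}" using h False by (auto simp: h'_def)
        have "h' \<notin> good" using Max_ge[OF \<open>finite good\<close>, of h'] by (auto simp: h_def h'_def)
        hence "D \<in> bad h'" using h' D monic_squarefree_subset
          by (auto simp: good_def bad_def prime_sum_eq_range)
        have "real n / real h \<le> 2 * (real n / real h')"
        proof -
          have "real n / (2 * real h) \<le> real n / real h'"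
            using h by (intro divide_left_mono) (auto simp: h'_def)
          thus ?thesis by simp
        qed
        moreover have "real n / real h' \<ge> lg" using V[of h'] h' ll by auto
        \<comment> \<open>Four units come from \<open>2 (n / h) \<le> 4 (n / h')\<close>, the other
          two cover \<open>lg / 2 + C\<close>, since both \<open>C\<close> and \<open>lg\<close> are
          controlled by \<open>n / h'\<close>.\<close>
        ultimately have "2 * (real n / real h) + lg / 2 + C \<le> 6 * (real n / real h')" using l by linarith
        hence "real K * (2 * (real n / real h) + lg / 2 + C) \<le> real K * (6 * (real n / real h'))"
          by (rule mult_left_mono) simp
        hence "exp (real K * (2 * (real n / real h) + lg / 2 + C)) \<le> exp (6 * real K * (real n / real h'))"
          by (simp add: mult_ac)
        hence "central_value D ^ K \<le> exp (6 * real K * (real n / real h')) * indicator (bad h') D"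
          using order_trans[OF bound] \<open>D \<in> bad h'\<close> by simp
        also have "\<dots> = (\<Sum>h\<in>{h'}. exp (6 * real K * (real n / real h)) * indicator (bad h) D)"
          by (simp only: sum.insert[OF finite.emptyI] sum.empty empty_iff not_False_eq_True add_0_right)
        also have "\<dots> \<le> (\<Sum>h\<in>{2..h0}. exp (6 * real K * (real n / real h)) * indicator (bad h) D)"
          using h' by (intro sum_mono2) auto
        finally show ?thesis by (simp add: E0_def add_increasing)
      qed
    qed
    have card_bad: "exp (6 * real K * (real n / real h)) * real (card (bad h)) \<le> q ^ n * exp (- lg)"
      if h: "h \<in> {2..h0}" for h
    proof -
      define V where "V = real n / real h"
      have V1: "V \<ge> lam * lg" unfolding V_def using h by (intro V) auto
      have "real (card (bad h)) \<le> q ^ n * exp (- c * V)"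
        unfolding bad_def q_def V_def[symmetric]
      proof (rule prime_sum_range_deviation[OF odd order.refl])
        have "{0<..h} = {1..h}" by auto
        moreover have "ln (real h) \<le> lg" unfolding lg_def using h h0n by simp
        ultimately show "(\<Sum>k\<in>{0<..h}. 1 / real k) \<le> 2 * lg"
          using sum_inverse_le_ln[of h] h l by simp
        show "V \<ge> 4" using V1 ll l by linarith
        show "V * real h \<le> real n" using h by (simp add: V_def)
        have pos: "lam * lg > 0" "V > 0" using V1 ll l by linarith+
        have "exp 1 * (2 * lg) / V \<le> exp 1 * (2 * lg) / (lam * lg)"
          by (rule divide_left_mono[OF V1 _ mult_pos_pos[OF pos(2,1)]]) (use l in simp)
        also have "\<dots> = 2 * exp 1 / lam" using l by simp
        also have "\<dots> = exp (- 4 * c)" by (simp add: lam_def exp_minus field_simps)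
        finally show "exp 1 * (2 * lg) / V \<le> exp (- 4 * c)" .
      qed (use l c in auto)
      hence "exp (6 * real K * V) * real (card (bad h)) \<le> exp (6 * real K * V) * (q ^ n * exp (- c * V))"
        by (rule mult_left_mono) simp
      also have "\<dots> = q ^ n * exp (6 * real K * V + - c * V)" by (simp only: exp_add mult_ac)
      also have "6 * real K * V + - c * V = - V" by (simp add: c_def algebra_simps)
      also have "q ^ n * exp (- V) \<le> q ^ n * exp (- lg)" using V1 ll q by (intro mult_left_mono) auto
      finally show ?thesis by (simp add: V_def)
    qed
    show ?case
    proof
      assume n: "even n"
      have "(\<Sum>D\<in>(monic_squarefree n :: 'a poly set). central_value D ^ K) \<le>
        (\<Sum>D\<in>(monic_squarefree n :: 'a poly set). E0 + (\<Sum>h\<in>{2..h0}. exp (6 * real K * (real n / real h)) * indicator (bad h) D))"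
        by (intro sum_mono pointwise n)
      also have "\<dots> \<le> (\<Sum>D\<in>(monic_of_degree n :: 'a poly set). E0 + (\<Sum>h\<in>{2..h0}. exp (6 * real K * (real n / real h)) * indicator (bad h) D))"
        by (intro sum_mono2 monic_squarefree_subset) (auto simp: E0_def intro!: add_nonneg_nonneg sum_nonneg)
      also have "\<dots> = q ^ n * E0 + (\<Sum>D\<in>(monic_of_degree n :: 'a poly set). \<Sum>h\<in>{2..h0}. exp (6 * real K * (real n / real h)) * indicator (bad h) D)"
        by (simp add: sum.distrib card_monic_of_degree q_def)
      also have "(\<Sum>D\<in>(monic_of_degree n :: 'a poly set). \<Sum>h\<in>{2..h0}. exp (6 * real K * (real n / real h)) * indicator (bad h) D) =
        (\<Sum>h\<in>{2..h0}. \<Sum>D\<in>(monic_of_degree n :: 'a poly set). exp (6 * real K * (real n / real h)) * indicator (bad h) D)"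
        by (rule sum.swap)
      also have "\<dots> = (\<Sum>h\<in>{2..h0}. exp (6 * real K * (real n / real h)) * real (card (bad h)))"
      proof (rule sum.cong[OF refl])
        fix h
        have "bad h \<subseteq> monic_of_degree n" by (auto simp: bad_def)
        thus "(\<Sum>D\<in>(monic_of_degree n :: 'a poly set). exp (6 * real K * (real n / real h)) * indicator (bad h) D) =
            exp (6 * real K * (real n / real h)) * real (card (bad h))"
          by (simp only: sum_distrib_left[symmetric] sum_indicator_subset[OF finite_monic_of_degree])
      qed
      also have "\<dots> \<le> (\<Sum>h\<in>{2..h0}. q ^ n * exp (- lg))" by (intro sum_mono card_bad)
      \<comment> \<open>There are at most \<open>n\<close> bad sets, and each contributes at most
        \<open>q^n / n\<close>.\<close>
      also have "\<dots> \<le> q ^ n * 1"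
      proof -
        have "real (card {2..h0}) \<le> real n" using h0n by simp
        hence "real (card {2..h0}) * exp (- lg) \<le> real n * exp (- lg)" by (rule mult_right_mono) simp
        also have "\<dots> = 1" using l by (simp add: lg_def exp_minus)
        finally have "q ^ n * (real (card {2..h0}) * exp (- lg)) \<le> q ^ n * 1"
          using q by (intro mult_left_mono) auto
        thus ?thesis by (simp add: mult_ac)
      qed
      also have "q ^ n * E0 + q ^ n * 1 = q ^ n * (E0 + 1)" by (simp add: algebra_simps)
      also have "E0 + 1 \<le> exp (A * lg)"
      proof -
        have "real K * (4 * (lam * lg) + lg / 2 + C) \<le> real K * (4 * (lam * lg) + lg / 2 + lg)"
          using l by (intro mult_left_mono) auto
        also have "\<dots> = (A - 1) * lg" by (simp add: A_def algebra_simps)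
        finally have "E0 \<le> exp ((A - 1) * lg)" by (simp add: E0_def)
        moreover have "1 \<le> exp ((A - 1) * lg)" using l lam by (simp add: A_def)
        moreover have "2 \<le> exp lg" using l exp_ge_add_one_self[of lg] by linarith
        hence "2 * exp ((A - 1) * lg) \<le> exp lg * exp ((A - 1) * lg)" by (rule mult_right_mono) simp
        moreover have "exp lg * exp ((A - 1) * lg) = exp (A * lg)"
          by (simp add: algebra_simps flip: exp_add)
        ultimately show ?thesis by linarith
      qed
      finally show "(\<Sum>D\<in>(monic_squarefree n :: 'a poly set). central_value D ^ K) \<le> q ^ n * exp (A * ln (real n))"
        using q by (simp add: lg_def mult_left_mono)
    qed
  qed
  thus ?thesis using that A unfolding q_def by blast
qed


text \<open>AM-GM in additive form, a pointwise substitute for Cauchy-Schwarz: it trades a value on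
  a rare set for its square with a small weight \<open>t\<close>.\<close>

lemma power_le_square_plus:
  fixes x t :: real
  assumes "x \<ge> 0" "t > 0"
  shows "x \<le> x ^ 2 * t + 1 / t"
proof -
  have "0 \<le> (x * t - 1) ^ 2 + x * t" using assms by simp
  hence "x * t \<le> (x ^ 2 * t + 1 / t) * t"
    using assms by (simp add: power2_eq_square algebra_simps)
  thus ?thesis using assms by (simp only: mult_le_cancel_right_pos)
qed

text \<open>Off two exceptional sets the short sum is at most \<open>B log n\<close>, so
  \<open>exp\<close> may be replaced by \<open>4 * cosh_trunc\<close>, whose average is Gaussian;
  the long sum is at most \<open>delta log n\<close> and joins the error. On the exceptional sets,
  of density \<open>n^(-A)\<close>, the crude bound \<open>n^A\<close> for the \<open>2 k\<close>-th
  moment suffices.\<close>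

theorem moment_bound:
  fixes k :: nat and \<epsilon> :: real
  assumes odd: "odd CARD('a::{finite,field})" and \<epsilon>: "\<epsilon> > 0"
  obtains M where "M \<ge> 0" "\<forall>\<^sub>F n in sequentially. even n \<longrightarrow>
    (\<Sum>D\<in>(monic_squarefree n :: 'a poly set). central_value D ^ k) \<le>
      real CARD('a) ^ n * (M * exp ((real k * (real k + 1) / 2 + \<epsilon>) * ln (real n)))"
proof -
  define q where "q = real CARD('a)"
  have q: "q > 0" by (simp add: q_def)
  obtain C where C: "C \<ge> 0" "\<And>(D :: 'a poly) n h. D \<in> monic_squarefree n \<Longrightarrow> even n \<Longrightarrow> n > 0 \<Longrightarrow> h > 0 \<Longrightarrow> h \<le> n \<Longrightarrow>
    central_value D \<le> exp (real n / real h + prime_sum h D + ln (real n) / 2 + C)"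
    by (rule central_value_bound[OF odd]) (rule that)
  obtain A where A: "A \<ge> 0" and crude: "\<forall>\<^sub>F n in sequentially. even n \<longrightarrow>
    (\<Sum>D\<in>(monic_squarefree n :: 'a poly set). central_value D ^ (2 * k)) \<le> q ^ n * exp (A * ln (real n))"
    by (rule crude_moment_bound[OF odd, of "2 * k", folded q_def]) (rule that)
  \<comment> \<open>The losses are \<open>n / h \<le> 2 \<delta> log n\<close> and
    \<open>\<delta> log n\<close> from the long primes; \<open>k\<close> times their sum must stay
    below \<open>\<epsilon> log n\<close>.\<close>
  define \<delta> where "\<delta> = \<epsilon> / (3 * real k + 3)"
  have \<delta>: "\<delta> > 0" using \<epsilon> by (simp add: \<delta>_def)
  have k\<delta>: "3 * real k * \<delta> \<le> \<epsilon>" using \<epsilon> by (simp add: \<delta>_def field_simps)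
  \<comment> \<open>Gives the short sum the deviation rate \<open>A\<close> for variance at most
    \<open>2 log n\<close> and threshold \<open>B log n\<close>.\<close>
  define B where "B = 2 * exp 1 * exp (4 * A)"
  have "1 * 1 * 1 \<le> B" unfolding B_def using A by (intro mult_mono) auto
  hence B: "B \<ge> 1" by simp
  \<comment> \<open>The 4 comes from \<open>exp x \<le> 2 * cosh x \<le> 4 * cosh_trunc J x\<close>,
    the \<open>k^2 / 2\<close> from the constant 1 in the variance \<open>1 + log n\<close>, and the
    3 from the crude term and the two exceptional sets.\<close>
  define M where "M = 4 * exp (real k * C + real k ^ 2 / 2) + 3"
  define r where "r = real k * (real k + 1) / 2 + \<epsilon>"
  have r: "r > 0" using \<epsilon> by (simp add: r_def add_nonneg_pos)
  \<comment> \<open>The condition with \<open>(ln n)^2 - 2\<close> validates the truncation of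
    \<open>cosh\<close> at order \<open>2 J\<close>. The one with
    \<open>ln (2 ln n / \<delta>)\<close> is the deviation condition for the primes between
    \<open>z\<close> and \<open>h\<close>, and it holds because \<open>log log n\<close> is small
    against \<open>log n\<close>.\<close>
  have ev: "\<forall>\<^sub>F n in sequentially. ln (real n) \<ge> 4 \<and> ln (real n) \<ge> \<delta> \<and> ln (real n) \<ge> B \<and>
      \<delta> * ln (real n) \<ge> 4 \<and> real n / (ln (real n)) ^ 2 \<ge> 2 \<and> real n / (\<delta> * ln (real n)) \<ge> 2 \<and>
      (ln (real n)) ^ 2 - 2 \<ge> exp 1 * (real k * (B * ln (real n))) \<and>
      exp 1 * ln (2 * ln (real n) / \<delta>) / (\<delta> * ln (real n)) \<le> exp (- 4 * (A / \<delta>)) \<and> n > 0"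
  proof (intro eventually_conj)
    show "\<forall>\<^sub>F n in sequentially. ln (real n) \<ge> 4" by real_asymp
    show "\<forall>\<^sub>F n in sequentially. ln (real n) \<ge> \<delta>" by real_asymp
    show "\<forall>\<^sub>F n in sequentially. ln (real n) \<ge> B" by real_asymp
    show "\<forall>\<^sub>F n in sequentially. \<delta> * ln (real n) \<ge> 4" using \<delta> by real_asymp
    show "\<forall>\<^sub>F n in sequentially. real n / (ln (real n)) ^ 2 \<ge> 2" by real_asymp
    show "\<forall>\<^sub>F n in sequentially. real n / (\<delta> * ln (real n)) \<ge> 2" using \<delta> by real_asymp
    define b where "b = exp 1 * (real k * B)"
    have "\<forall>\<^sub>F n in sequentially. (ln (real n)) ^ 2 - 2 \<ge> b * ln (real n)" by real_asymp
    thus "\<forall>\<^sub>F n in sequentially. (ln (real n)) ^ 2 - 2 \<ge> exp 1 * (real k * (B * ln (real n)))"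
      by (simp add: b_def mult_ac)
    have "(\<lambda>n::nat. exp 1 * ln (2 * ln (real n) / \<delta>) / (\<delta> * ln (real n))) \<longlonglongrightarrow> 0"
      using \<delta> by real_asymp
    hence "\<forall>\<^sub>F n in sequentially. exp 1 * ln (2 * ln (real n) / \<delta>) / (\<delta> * ln (real n)) < exp (- 4 * (A / \<delta>))"
      by (rule order_tendstoD) simp
    thus "\<forall>\<^sub>F n in sequentially. exp 1 * ln (2 * ln (real n) / \<delta>) / (\<delta> * ln (real n)) \<le> exp (- 4 * (A / \<delta>))"
      by (rule eventually_mono) simp
    show "\<forall>\<^sub>F n in sequentially. n > (0::nat)" by (rule eventually_gt_at_top)
  qed
  have "\<forall>\<^sub>F n in sequentially. even n \<longrightarrow>
    (\<Sum>D\<in>(monic_squarefree n :: 'a poly set). central_value D ^ k) \<le> q ^ n * (M * exp (r * ln (real n)))"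
    using ev crude
  proof eventually_elim
    case (elim n)
    define lg where "lg = ln (real n)"
    have l: "lg \<ge> 4" "lg \<ge> \<delta>" "lg \<ge> B" "\<delta> * lg \<ge> 4" "real n / lg ^ 2 \<ge> 2" "real n / (\<delta> * lg) \<ge> 2"
      "lg ^ 2 - 2 \<ge> exp 1 * (real k * (B * lg))"
      "exp 1 * ln (2 * lg / \<delta>) / (\<delta> * lg) \<le> exp (- 4 * (A / \<delta>))" "n > 0"
      using elim(1) by (simp_all add: lg_def)
    \<comment> \<open>\<open>z\<close> and \<open>J\<close> are tied by
      \<open>2 * J * z \<le> n\<close>. The quotient \<open>h / z\<close> is of size
      \<open>log n\<close>, so the variance between \<open>z\<close> and \<open>h\<close> is only
      \<open>log log n\<close>.\<close>
    define h z J where "h = nat \<lfloor>real n / (\<delta> * lg)\<rfloor>" and "z = nat \<lfloor>real n / lg ^ 2\<rfloor>" and "J = nat \<lfloor>lg ^ 2 / 2\<rfloor>"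
    have floor: "real (nat \<lfloor>y\<rfloor>) \<le> y" "real (nat \<lfloor>y\<rfloor>) \<ge> y / 2" "nat \<lfloor>y\<rfloor> \<ge> 1" if "y \<ge> 2" for y :: real
      using that by linarith+
    have h: "real h \<le> real n / (\<delta> * lg)" "real h \<ge> real n / (\<delta> * lg) / 2" "h \<ge> 1"
      using floor[OF l(6)] by (simp_all only: h_def)
    have z: "real z \<le> real n / lg ^ 2" "real z \<ge> real n / lg ^ 2 / 2" "z \<ge> 1"
      using floor[OF l(5)] by (simp_all only: z_def)
    have J: "2 * real J \<le> lg ^ 2" "2 * real J \<ge> lg ^ 2 - 2"
      using l(1) zero_le_power2[of lg] unfolding J_def by linarith+
    have zh: "z \<le> h"
    proof -
      have "real n / lg ^ 2 \<le> real n / (\<delta> * lg)"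
        using l \<delta> by (intro divide_left_mono) (auto simp: power2_eq_square intro!: mult_pos_pos)
      thus ?thesis unfolding z_def h_def by (intro nat_mono floor_mono)
    qed
    have hn: "h \<le> n"
    proof -
      have "real n * 1 \<le> real n * (\<delta> * lg)" using l by (intro mult_left_mono) auto
      hence "real n / (\<delta> * lg) \<le> real n" using l by (simp add: pos_divide_le_eq)
      thus ?thesis using h(1) by linarith
    qed
    have hV: "\<delta> * lg * real h \<le> real n" and nh: "real n / real h \<le> 2 * (\<delta> * lg)"
    proof -
      have "\<delta> * lg * real h \<le> \<delta> * lg * (real n / (\<delta> * lg))" using h l by (intro mult_left_mono) auto
      also have "\<dots> = real n" using l \<delta> by simp
      finally show "\<delta> * lg * real h \<le> real n" .
      have "real n = (real n / (\<delta> * lg)) * (\<delta> * lg)" using l \<delta> by simp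
      also have "\<dots> \<le> (2 * real h) * (\<delta> * lg)" using h l by (intro mult_right_mono) auto
      finally show "real n / real h \<le> 2 * (\<delta> * lg)" using h by (simp add: pos_divide_le_eq mult_ac)
    qed
    have zV: "lg ^ 2 * real z \<le> real n"
    proof -
      have "lg ^ 2 * real z \<le> lg ^ 2 * (real n / lg ^ 2)" using z by (intro mult_left_mono) auto
      also have "\<dots> = real n" using l by simp
      finally show ?thesis .
    qed
    have W1: "(\<Sum>j\<in>{0<..z}. 1 / real j) \<le> 1 + lg"
    proof -
      have "{0<..z} = {1..z}" by auto
      moreover have "ln (real z) \<le> lg" unfolding lg_def using z zh hn by simp
      ultimately show ?thesis using sum_inverse_le_ln[of z] z by simp
    qed
    have W2: "(\<Sum>j\<in>{z<..h}. 1 / real j) \<le> ln (2 * lg / \<delta>)"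
    proof -
      have "(\<Sum>j\<in>{z<..h}. 1 / real j) \<le> ln (real h) - ln (real z)"
        by (rule sum_inverse_range_le_ln[OF z(3) zh])
      also have "\<dots> = ln (real h / real z)" using h z by (simp add: ln_div)
      also have "\<dots> \<le> ln (2 * lg / \<delta>)"
      proof (rule ln_mono)
        have "real h / real z \<le> (real n / (\<delta> * lg)) / (real n / lg ^ 2 / 2)"
          using h z l by (intro frac_le) auto
        also have "\<dots> = 2 * lg / \<delta>" using l \<delta> by (simp add: field_simps power2_eq_square)
        finally show "real h / real z \<le> 2 * lg / \<delta>" .
        show "0 < real h / real z" using h z by simp
      qed
      finally show ?thesis .
    qed
    let ?S1 = "\<lambda>D :: 'a poly. prime_sum_range 0 z h D"
    let ?S2 = "\<lambda>D :: 'a poly. prime_sum_range z h h D"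
    define B1 where "B1 = {D \<in> monic_of_degree n. \<bar>?S1 D\<bar> > B * lg}"
    define B2 where "B2 = {D \<in> monic_of_degree n. \<bar>?S2 D\<bar> > \<delta> * lg}"
    have cB1: "real (card B1) \<le> q ^ n * exp (- (A * lg))"
    proof -
      have "real (card B1) \<le> q ^ n * exp (- A * (B * lg))"
        unfolding B1_def q_def
      proof (rule prime_sum_range_deviation[OF odd zh])
        show "(\<Sum>j\<in>{0<..z}. 1 / real j) \<le> 2 * lg" using W1 l by linarith
        have "1 * lg \<le> B * lg" using B l by (intro mult_right_mono) auto
        thus "B * lg \<ge> 4" using l by linarith
        have "B * lg * real z \<le> lg ^ 2 * real z"
          unfolding power2_eq_square using l by (intro mult_right_mono) auto
        thus "B * lg * real z \<le> real n" using zV by linarith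
        show "exp 1 * (2 * lg) / (B * lg) \<le> exp (- 4 * A)"
          using l by (simp add: B_def exp_minus field_simps)
      qed (use l A in auto)
      also have "\<dots> \<le> q ^ n * exp (- (A * lg))"
      proof -
        have "A * (1 * lg) \<le> A * (B * lg)" using A B l by (intro mult_left_mono mult_right_mono) auto
        thus ?thesis using q by (intro mult_left_mono) auto
      qed
      finally show ?thesis .
    qed
    have cB2: "real (card B2) \<le> q ^ n * exp (- (A * lg))"
    proof -
      have "real (card B2) \<le> q ^ n * exp (- (A / \<delta>) * (\<delta> * lg))"
        unfolding B2_def q_def
      proof (rule prime_sum_range_deviation[OF odd order.refl W2])
        have "2 * lg / \<delta> > 1" using l \<delta> by (simp add: field_simps)
        thus "0 < ln (2 * lg / \<delta>)" by (rule ln_gt_zero)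
      qed (use l hV \<delta> A in auto)
      also have "- (A / \<delta>) * (\<delta> * lg) = - (A * lg)" using \<delta> by simp
      finally show ?thesis .
    qed
    define G where "G = exp (real k * (3 * (\<delta> * lg) + lg / 2 + C))"
    have trunc0: "cosh_trunc J x \<ge> 0" for x
      unfolding cosh_trunc_def by (intro sum_nonneg divide_nonneg_nonneg) (simp_all add: power_mult)
    have pointwise: "central_value D ^ k \<le> 4 * G * cosh_trunc J (real k * ?S1 D) +
        central_value D ^ (2 * k) * exp (- (A * lg)) + exp (A * lg) * indicator B1 D + exp (A * lg) * indicator B2 D"
      if D: "D \<in> monic_squarefree n" and n: "even n" for D :: "'a poly"
    proof (cases "D \<in> B1 \<union> B2")
      case True
      \<comment> \<open>The weight \<open>exp (- A lg)\<close> cancels the crude bound for the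
        \<open>2 k\<close>-th moment, and its inverse cancels the density of the exceptional
        sets.\<close>
      have "central_value D ^ k \<le> (central_value D ^ k) ^ 2 * exp (- (A * lg)) + 1 / exp (- (A * lg))"
        by (rule power_le_square_plus) auto
      also have "1 / exp (- (A * lg)) = exp (A * lg)" by (simp add: exp_minus inverse_eq_divide)
      also have "\<dots> \<le> exp (A * lg) * indicator B1 D + exp (A * lg) * indicator B2 D"
        using True by (auto simp: indicator_def)
      also have "(central_value D ^ k) ^ 2 = central_value D ^ (2 * k)"
        by (simp add: mult.commute flip: power_mult)
      finally have "central_value D ^ k \<le> central_value D ^ (2 * k) * exp (- (A * lg)) +
          (exp (A * lg) * indicator B1 D + exp (A * lg) * indicator B2 D)" by simp
      moreover have "0 \<le> 4 * G * cosh_trunc J (real k * ?S1 D)"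
        using trunc0[of "real k * ?S1 D"] by (intro mult_nonneg_nonneg) (simp_all add: G_def)
      ultimately show ?thesis by linarith
    next
      case False
      have D': "D \<in> monic_of_degree n" using D monic_squarefree_subset by blast
      have S: "\<bar>?S1 D\<bar> \<le> B * lg" "\<bar>?S2 D\<bar> \<le> \<delta> * lg" using False D' by (auto simp: B1_def B2_def)
      have "central_value D \<le> exp (real n / real h + prime_sum h D + lg / 2 + C)"
        unfolding lg_def using h hn l by (intro C(2) D n) auto
      also have "\<dots> \<le> exp ((3 * (\<delta> * lg) + lg / 2 + C) + ?S1 D)"
        unfolding prime_sum_split[OF zh] exp_le_cancel_iff using nh S(2) by linarith
      finally have "central_value D ^ k \<le> exp ((3 * (\<delta> * lg) + lg / 2 + C) + ?S1 D) ^ k"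
        by (rule power_mono) simp
      also have "\<dots> = G * exp (real k * ?S1 D)"
        unfolding exp_mult_power G_def by (simp only: distrib_left[of "real k" _ "?S1 D"] exp_add)
      also have "exp (real k * ?S1 D) \<le> 4 * cosh_trunc J (real k * ?S1 D)"
      proof -
        have "exp (real k * ?S1 D) \<le> 2 * cosh (real k * ?S1 D)" by (simp add: cosh_field_def)
        moreover have "cosh (real k * ?S1 D) \<le> 2 * cosh_trunc J (real k * ?S1 D)"
        proof (rule cosh_le_cosh_trunc)
          have "exp 1 * \<bar>real k * ?S1 D\<bar> \<le> exp 1 * (real k * (B * lg))"
            using S(1) by (simp add: abs_mult mult_left_mono)
          thus "exp 1 * \<bar>real k * ?S1 D\<bar> \<le> 2 * real J" using l(7) J(2) by linarith
        qed
        ultimately show ?thesis by linarith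
      qed
      hence "G * exp (real k * ?S1 D) \<le> G * (4 * cosh_trunc J (real k * ?S1 D))"
        by (rule mult_left_mono) (simp add: G_def)
      finally have "central_value D ^ k \<le> 4 * G * cosh_trunc J (real k * ?S1 D)" by simp
      moreover have "0 \<le> central_value D ^ (2 * k) * exp (- (A * lg))" by simp
      moreover have "0 \<le> exp (A * lg) * indicator B1 D" "0 \<le> exp (A * lg) * indicator B2 D" by simp_all
      ultimately show ?thesis by linarith
    qed
    have ind: "(\<Sum>D\<in>monic_squarefree n. exp (A * lg) * indicator X D) \<le> q ^ n"
      if X: "X \<subseteq> monic_of_degree n" "real (card X) \<le> q ^ n * exp (- (A * lg))" for X :: "'a poly set"
    proof -
      have "(\<Sum>D\<in>monic_squarefree n. exp (A * lg) * indicator X D) \<le>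
            (\<Sum>D\<in>monic_of_degree n. exp (A * lg) * indicator X D)"
        by (intro sum_mono2 monic_squarefree_subset) auto
      also have "\<dots> = exp (A * lg) * (\<Sum>D\<in>monic_of_degree n. indicator X D)"
        by (rule sum_distrib_left[symmetric])
      also have "(\<Sum>D\<in>monic_of_degree n. indicator X D) = real (card X)"
        by (rule sum_indicator_subset[OF finite_monic_of_degree X(1)])
      also have "exp (A * lg) * real (card X) \<le> exp (A * lg) * (q ^ n * exp (- (A * lg)))"
        by (intro mult_left_mono X) simp
      also have "\<dots> = q ^ n" by (simp add: exp_minus)
      finally show ?thesis .
    qed
    show ?case
    proof
      assume n: "even n"
      have "(\<Sum>D\<in>(monic_squarefree n :: 'a poly set). central_value D ^ k) \<le>
        (\<Sum>D\<in>(monic_squarefree n :: 'a poly set). 4 * G * cosh_trunc J (real k * ?S1 D) +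
          central_value D ^ (2 * k) * exp (- (A * lg)) + exp (A * lg) * indicator B1 D + exp (A * lg) * indicator B2 D)"
        by (intro sum_mono pointwise n)
      also have "\<dots> = 4 * G * (\<Sum>D\<in>(monic_squarefree n :: 'a poly set). cosh_trunc J (real k * ?S1 D)) +
          (\<Sum>D\<in>(monic_squarefree n :: 'a poly set). central_value D ^ (2 * k)) * exp (- (A * lg)) +
          (\<Sum>D\<in>monic_squarefree n. exp (A * lg) * indicator B1 D) +
          (\<Sum>D\<in>monic_squarefree n. exp (A * lg) * indicator B2 D)"
        by (simp only: sum.distrib sum_distrib_left sum_distrib_right)
      also have "\<dots> \<le> 4 * G * (q ^ n * exp (real k ^ 2 * (1 + lg) / 2)) + q ^ n + q ^ n + q ^ n"
      proof (intro add_mono)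
        have "(\<Sum>D\<in>(monic_squarefree n :: 'a poly set). cosh_trunc J (real k * ?S1 D)) \<le>
              (\<Sum>D\<in>(monic_of_degree n :: 'a poly set). cosh_trunc J (real k * ?S1 D))"
          by (intro sum_mono2 monic_squarefree_subset trunc0) auto
        also have "\<dots> \<le> q ^ n * exp (real k ^ 2 * (1 + lg) / 2)"
          unfolding q_def
        proof (rule prime_sum_range_cosh_trunc[OF odd zh W1])
          have "2 * real J * real z \<le> lg ^ 2 * real z" using J by (intro mult_right_mono) auto
          hence "real (2 * J * z) \<le> real n" using zV by simp
          thus "2 * J * z \<le> n" by linarith
        qed
        finally show "4 * G * (\<Sum>D\<in>(monic_squarefree n :: 'a poly set). cosh_trunc J (real k * ?S1 D)) \<le>
            4 * G * (q ^ n * exp (real k ^ 2 * (1 + lg) / 2))"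
          by (rule mult_left_mono) (simp add: G_def)
        have "(\<Sum>D\<in>(monic_squarefree n :: 'a poly set). central_value D ^ (2 * k)) * exp (- (A * lg)) \<le>
            q ^ n * exp (A * lg) * exp (- (A * lg))"
          using elim(2) n by (intro mult_right_mono) (simp_all add: lg_def)
        also have "q ^ n * exp (A * lg) * exp (- (A * lg)) = q ^ n" by (simp add: exp_minus)
        finally show "(\<Sum>D\<in>(monic_squarefree n :: 'a poly set). central_value D ^ (2 * k)) * exp (- (A * lg)) \<le> q ^ n" .
      qed (intro ind cB1 cB2; auto simp: B1_def B2_def)+
      also have "\<dots> = q ^ n * (4 * (G * exp (real k ^ 2 * (1 + lg) / 2)) + 3)" by (simp add: algebra_simps)
      also have "\<dots> \<le> q ^ n * (M * exp (r * lg))"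
      proof (rule mult_left_mono)
        have "3 * real k * \<delta> * lg \<le> \<epsilon> * lg" using k\<delta> l by (intro mult_right_mono) auto
        \<comment> \<open>The coefficients of \<open>lg\<close>: \<open>k / 2\<close> from the
          squares of primes and \<open>k^2 / 2\<close> from the variance add up to
          \<open>k (k + 1) / 2\<close>, plus at most \<open>\<epsilon>\<close>.\<close>
        hence "real k * (3 * (\<delta> * lg) + lg / 2 + C) + real k ^ 2 * (1 + lg) / 2 \<le> (real k * C + real k ^ 2 / 2) + r * lg"
          by (simp add: r_def power2_eq_square field_simps)
        hence "G * exp (real k ^ 2 * (1 + lg) / 2) \<le> exp (real k * C + real k ^ 2 / 2) * exp (r * lg)"
          unfolding G_def exp_add[symmetric] by simp
        moreover have "1 \<le> exp (r * lg)" using r l by simp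
        moreover have "M * exp (r * lg) = 4 * (exp (real k * C + real k ^ 2 / 2) * exp (r * lg)) + 3 * exp (r * lg)"
          by (simp add: M_def algebra_simps)
        ultimately show "4 * (G * exp (real k ^ 2 * (1 + lg) / 2)) + 3 \<le> M * exp (r * lg)" by linarith
      qed (use q in simp)
      finally show "(\<Sum>D\<in>(monic_squarefree n :: 'a poly set). central_value D ^ k) \<le> q ^ n * (M * exp (r * ln (real n)))"
        by (simp add: lg_def)
    qed
  qed
  moreover have "M \<ge> 0" by (simp add: M_def)
  ultimately show ?thesis using that unfolding q_def r_def by blast
qed

theorem corollary1p7:
  fixes k :: nat and \<epsilon> :: real
  assumes "odd CARD('a::{finite,field})" and "\<epsilon> > 0"
  shows "(\<lambda>g::nat. 1 / real (card (monic_squarefree (2 * g + 2) :: 'a poly set)) *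
            (\<Sum>D \<in> (monic_squarefree (2 * g + 2) :: 'a poly set).
               norm (L_fun (of_real (real CARD('a) powr (- 1 / 2))) D) ^ k))
         \<in> O(\<lambda>g. real g powr (real k * (real k + 1) / 2 + \<epsilon>))"
proof -
  define r where "r = real k * (real k + 1) / 2 + \<epsilon>"
  define q where "q = real CARD('a)"
  have r: "r > 0" using assms(2) by (simp add: r_def add_nonneg_pos)
  have q: "q > 0" by (simp add: q_def)
  obtain M where M: "M \<ge> 0" and bound: "\<forall>\<^sub>F n in sequentially. even n \<longrightarrow>
    (\<Sum>D\<in>(monic_squarefree n :: 'a poly set). central_value D ^ k) \<le> q ^ n * (M * exp (r * ln (real n)))"
    by (rule moment_bound[OF assms, of k, folded q_def r_def]) (rule that)
  have "filterlim (\<lambda>g::nat. 2 * g + 2) sequentially sequentially"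
    by (rule filterlim_subseq) (auto intro: strict_monoI)
  from eventually_compose_filterlim[OF bound this]
  have ev: "\<forall>\<^sub>F g in sequentially. (\<Sum>D\<in>(monic_squarefree (2 * g + 2) :: 'a poly set). central_value D ^ k) \<le>
      q ^ (2 * g + 2) * (M * exp (r * ln (real (2 * g + 2))))" by simp
  have "\<forall>\<^sub>F g in sequentially.
      norm (1 / real (card (monic_squarefree (2 * g + 2) :: 'a poly set)) *
        (\<Sum>D\<in>(monic_squarefree (2 * g + 2) :: 'a poly set). central_value D ^ k)) \<le>
      2 * M * 4 powr r * norm (real g powr r)"
    using ev eventually_ge_at_top[of 1]
  proof eventually_elim
    case (elim g)
    define H where "H = real (card (monic_squarefree (2 * g + 2) :: 'a poly set))"
    define S where "S = (\<Sum>D\<in>(monic_squarefree (2 * g + 2) :: 'a poly set). central_value D ^ k)"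
    have S0: "S \<ge> 0" unfolding S_def by (intro sum_nonneg) auto
    have H2: "q ^ (2 * g + 2) \<le> 2 * H"
      unfolding q_def H_def by (rule card_monic_squarefree_ge[OF assms(1)])
    moreover have "q ^ (2 * g + 2) > 0" using q by simp
    ultimately have H: "H > 0" by linarith
    have "exp (r * ln (real (2 * g + 2))) = real (2 * g + 2) powr r"
      by (simp add: powr_def)
    also have "\<dots> \<le> (4 * real g) powr r"
      using r elim(2) by (intro powr_mono2) auto
    also have "\<dots> = 4 powr r * real g powr r" by (simp add: powr_mult)
    finally have e: "exp (r * ln (real (2 * g + 2))) \<le> 4 powr r * real g powr r" .
    have "S \<le> q ^ (2 * g + 2) * (M * exp (r * ln (real (2 * g + 2))))"
      unfolding S_def by (rule elim(1))
    \<comment> \<open>Passing from all monic polynomials to the square-free average costs the factor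
      2 in \<open>q ^ (2 * g + 2) \<le> 2 * H\<close>.\<close>
    also have "\<dots> \<le> (2 * H) * (M * (4 powr r * real g powr r))"
      using H2 H M e by (intro mult_mono mult_left_mono) auto
    finally have "1 / H * S \<le> 2 * M * 4 powr r * real g powr r"
      using H by (simp add: field_simps)
    moreover have "norm (1 / H * S) = 1 / H * S" using H S0 by simp
    moreover have "norm (real g powr r) = real g powr r" by simp
    ultimately show ?case unfolding H_def[symmetric] S_def[symmetric] by (simp only:)
  qed
  thus ?thesis
    unfolding r_def central_value_def by (rule bigoI)
qed

end
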